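(* Let $H$ be a Cohen--Macaulay very well-covered graph with $2d_0$ vertices $V(H)=\{x'_1,\ldots,x'_{d_0}\}\cup\{y'_1,\ldots,y'_{d_0}\}$ such that $\{x'_1,\ldots,x'_{d_0}\}$ is a minimal vertex cover of $H$, $\{y'_1,\ldots,y'_{d_0}\}$ is a maximal independent set of $H$, $\{x'_i,y'_i\}\in E(H)$ for all $i$, and $\{x'_i,y'_j\}\in E(H)$ implies $i\le j$. Let $n_1,\ldots,n_{d_0}$ be positive integers, $d=\sum_{i=1}^{d_0}n_i$, let $G=H(n_1,\ldots,n_{d_0})$ be the very well-covered graph obtained from $H$ by replacing the edges $\{x'_i,y'_i\}$ with the complete bipartite graphs $K_{n_i,n_i}$, and let $S=\Bbbk[V(G)]$. Then, for a positive integer $j$, the Hilbert series of $H^j_{\mathfrak{m}}(S/I(G))$ is given by $$F(H^j_{\mathfrak{m}}(S/I(G)),t)=\sum_\ell\dim_\Bbbk[H^j_{\mathfrak{m}}(S/I(G))]_\ell\,t^\ell=\sum_i\ \sum_{C\in\mathrm{Min}(H)}\big|\{D\subset\mathcal{C}(H;C) : d+N_D=|V(G)|-j\text{ and }|D|=i\}\big|\left(\frac{t^{-1}}{1-t^{-1}}\right)^{j-i}.$$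
   Context: Graphs are finite simple graphs; $\Bbbk$ is an arbitrary field. A graph is very well-covered if it has no isolated vertices and all its minimal vertex covers have the same cardinality, equal to half the number of its vertices. The edge ideal $I(\Gamma)\subseteq\Bbbk[V(\Gamma)]$ is generated by the products $uv$ with $\{u,v\}\in E(\Gamma)$; $\Gamma$ is Cohen--Macaulay if $\Bbbk[V(\Gamma)]/I(\Gamma)$ is. The graph $H(n_1,\ldots,n_{d_0})$ has vertex set $\bigcup_{i=1}^{d_0}(\{x_{i,1},\ldots,x_{i,n_i}\}\cup\{y_{i,1},\ldots,y_{i,n_i}\})$; each vertex $x'_i$ (resp. $y'_i$) of $H$ is replaced by the $n_i$ pairwise non-adjacent copies $x_{i,k}$ (resp. $y_{i,k}$), and a copy of $u$ is adjacent to a copy of $v$ if and only if $\{u,v\}\in E(H)$. $\mathrm{Min}(H)$ is the set of inclusion-minimal vertex covers of $H$. For $C\in\mathrm{Min}(H)$, $\mathcal{C}(H;C)=\{x'_s : y'_s\in C,\ (C\setminus\{y'_s\})\cup\{x'_s\}\in\mathrm{Min}(H)\}$. For $B\subseteq V(H)$, $N_B=\sum_s n_s$, the sum over those $s$ with $x'_s\in B$ or $y'_s\in B$. $\mathfrak{m}$ is the unique homogeneous maximal ideal of $S$.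
   Formalization: The printed condition d+N_D=|V(G)|-j is corrected to d+N_D=|V(G)|-j+i (with |D|=i); the printed formula already fails for H a single edge, n_1=1, j=1, where it misses the one-dimensional degree-0 part of H^1_m. *)

theory Defs
  imports
    "HOL-Library.Poly_Mapping"
    "HOL-Library.Extended_Nat"
    "HOL-Computational_Algebra.Formal_Laurent_Series"
    "HOL-Algebra.QuotRing"
    "HOL-Algebra.Ring_Divisibility"
    "Jordan_Normal_Form.VS_Connect"
begin

section \<open>Graphs\<close>

type_synonym 'v ugraph = "'v set \<times> 'v set set"

abbreviation verts :: "'v ugraph \<Rightarrow> 'v set" where "verts \<equiv> fst"
abbreviation edges :: "'v ugraph \<Rightarrow> 'v set set" where "edges \<equiv> snd"

definition simple_graph :: "'v ugraph \<Rightarrow> bool" where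
  "simple_graph G \<longleftrightarrow> finite (verts G) \<and>
     (\<forall>e\<in>edges G. \<exists>u\<in>verts G. \<exists>v\<in>verts G. u \<noteq> v \<and> e = {u, v})"

definition vertex_cover :: "'v ugraph \<Rightarrow> 'v set \<Rightarrow> bool" where
  "vertex_cover G C \<longleftrightarrow> C \<subseteq> verts G \<and> (\<forall>e\<in>edges G. e \<inter> C \<noteq> {})"

definition min_covers :: "'v ugraph \<Rightarrow> 'v set set" where
  "min_covers G = {C. vertex_cover G C \<and> (\<forall>C'. C' \<subset> C \<longrightarrow> \<not> vertex_cover G C')}"

definition independent_set :: "'v ugraph \<Rightarrow> 'v set \<Rightarrow> bool" where
  "independent_set G A \<longleftrightarrow> A \<subseteq> verts G \<and> (\<forall>e\<in>edges G. \<not> e \<subseteq> A)"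

definition maximal_independent_set :: "'v ugraph \<Rightarrow> 'v set \<Rightarrow> bool" where
  "maximal_independent_set G A \<longleftrightarrow>
     independent_set G A \<and> (\<forall>A'. A \<subset> A' \<longrightarrow> \<not> independent_set G A')"

definition very_well_covered :: "'v ugraph \<Rightarrow> bool" where
  "very_well_covered G \<longleftrightarrow> (\<forall>v\<in>verts G. \<exists>e\<in>edges G. v \<in> e) \<and>
     (\<forall>C\<in>min_covers G. 2 * card C = card (verts G))"

text \<open>The \<open>k\<close>-th copy of a vertex \<open>u\<close> of \<open>H\<close> is \<open>(u, k)\<close>.\<close>

definition blowup ::
  "'v ugraph \<Rightarrow> nat \<Rightarrow> (nat \<Rightarrow> 'v) \<Rightarrow> (nat \<Rightarrow> 'v) \<Rightarrow> (nat \<Rightarrow> nat) \<Rightarrow> ('v \<times> nat) ugraph" where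
  "blowup H d\<^sub>0 x y n =
     (let V = (\<Union>i\<in>{1..d\<^sub>0}. {x i, y i} \<times> {1..n i})
      in (V, {{(u, k), (v, l)} | u k v l. (u, k) \<in> V \<and> (v, l) \<in> V \<and> {u, v} \<in> edges H}))"

definition exchange_set ::
  "'v ugraph \<Rightarrow> nat \<Rightarrow> (nat \<Rightarrow> 'v) \<Rightarrow> (nat \<Rightarrow> 'v) \<Rightarrow> 'v set \<Rightarrow> 'v set" where
  "exchange_set H d\<^sub>0 x y C =
     {x s | s. s \<in> {1..d\<^sub>0} \<and> y s \<in> C \<and> (C - {y s}) \<union> {x s} \<in> min_covers H}"

definition weight ::
  "nat \<Rightarrow> (nat \<Rightarrow> 'v) \<Rightarrow> (nat \<Rightarrow> 'v) \<Rightarrow> (nat \<Rightarrow> nat) \<Rightarrow> 'v set \<Rightarrow> nat" where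
  "weight d\<^sub>0 x y n B = (\<Sum>s | s \<in> {1..d\<^sub>0} \<and> (x s \<in> B \<or> y s \<in> B). n s)"


section \<open>Cohen--Macaulay rings\<close>

definition regular_sequence :: "('a, 'm) ring_scheme \<Rightarrow> 'a list \<Rightarrow> bool" where
  "regular_sequence R as \<longleftrightarrow> set as \<subseteq> carrier R \<and> Idl\<^bsub>R\<^esub> (set as) \<noteq> carrier R \<and>
     (\<forall>i<length as. \<forall>b\<in>carrier R.
        as ! i \<otimes>\<^bsub>R\<^esub> b \<in> Idl\<^bsub>R\<^esub> (set (take i as)) \<longrightarrow> b \<in> Idl\<^bsub>R\<^esub> (set (take i as)))"

definition depth :: "('a, 'm) ring_scheme \<Rightarrow> 'a set \<Rightarrow> enat" where
  "depth R I = Sup {enat (length as) | as. set as \<subseteq> I \<and> regular_sequence R as}"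

definition height :: "('a, 'm) ring_scheme \<Rightarrow> 'a set \<Rightarrow> enat" where
  "height R P = Sup {enat r | r. \<exists>Q :: nat \<Rightarrow> 'a set.
     (\<forall>i\<le>r. primeideal (Q i) R) \<and> (\<forall>i<r. Q i \<subset> Q (Suc i)) \<and> Q r = P}"

text \<open>Since \<open>depth\<close> and \<open>height\<close> of a maximal ideal \<open>P\<close> are the depth and the dimension of the
  localization at \<open>P\<close>, this is the usual condition that all localizations at maximal ideals
  are Cohen--Macaulay.\<close>

definition cohen_macaulay :: "('a, 'm) ring_scheme \<Rightarrow> bool" where
  "cohen_macaulay R \<longleftrightarrow> cring R \<and> noetherian_ring R \<and>
     (\<forall>P. maximalideal P R \<longrightarrow> depth R P = height R P)"


section \<open>Polynomial rings and edge ideals\<close>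

type_synonym ('v, 'k) mpoly = "('v \<Rightarrow>\<^sub>0 nat) \<Rightarrow>\<^sub>0 'k"

definition poly_ring :: "'v set \<Rightarrow> ('v, 'k :: field) mpoly ring" where
  "poly_ring V = \<lparr>carrier = {p. \<forall>m\<in>Poly_Mapping.keys p. Poly_Mapping.keys m \<subseteq> V},
     mult = (*), one = 1, zero = 0, add = (+)\<rparr>"

definition poly_const :: "'k :: field \<Rightarrow> ('v, 'k) mpoly" where
  "poly_const c = Poly_Mapping.single 0 c"

definition poly_var :: "'v \<Rightarrow> ('v, 'k :: field) mpoly" where
  "poly_var v = Poly_Mapping.single (Poly_Mapping.single v 1) 1"

text \<open>The homogeneous component of degree \<open>\<delta>\<close>; it is zero for \<open>\<delta> < 0\<close>.\<close>

definition poly_hom :: "'v set \<Rightarrow> int \<Rightarrow> ('v, 'k :: field) mpoly set" where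
  "poly_hom V \<delta> = {p \<in> carrier (poly_ring V).
     \<forall>m\<in>Poly_Mapping.keys p. int (\<Sum>v\<in>Poly_Mapping.keys m. Poly_Mapping.lookup m v) = \<delta>}"

definition edge_ideal :: "'v ugraph \<Rightarrow> ('v, 'k :: field) mpoly set" where
  "edge_ideal G = Idl\<^bsub>poly_ring (verts G)\<^esub> {poly_var u * poly_var v | u v. {u, v} \<in> edges G}"

definition cohen_macaulay_graph :: "'k :: field itself \<Rightarrow> 'v ugraph \<Rightarrow> bool" where
  "cohen_macaulay_graph _ G \<longleftrightarrow>
     cohen_macaulay (poly_ring (verts G) Quot (edge_ideal G :: ('v, 'k) mpoly set))"


section \<open>Modules\<close>

text \<open>The record \<open>module\<close> extends \<open>ring\<close>, hence has fields \<open>mult\<close> and \<open>one\<close>. They play no role for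
  modules and are left undefined in the constructions below.\<close>

text \<open>The subquotient \<open>Z / B\<close> for submodules \<open>B \<subseteq> Z\<close> of \<open>M\<close>.\<close>

definition quot_module :: "('r, 'a, 'm) module_scheme \<Rightarrow> 'a set \<Rightarrow> 'a set \<Rightarrow> ('r, 'a set) module"
  where
  "quot_module M Z B = \<lparr>carrier = {B +>\<^bsub>M\<^esub> z | z. z \<in> Z}, mult = undefined, one = undefined,
     zero = B, add = set_add M, smult = (\<lambda>r A. \<Union>a\<in>A. B +>\<^bsub>M\<^esub> (r \<odot>\<^bsub>M\<^esub> a))\<rparr>"

definition poly_module :: "'v set \<Rightarrow> (('v, 'k :: field) mpoly, ('v, 'k) mpoly) module" where
  "poly_module V = ring.extend (poly_ring V) \<lparr>smult = (*)\<rparr>"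

definition edge_module :: "'v ugraph \<Rightarrow> (('v, 'k :: field) mpoly, ('v, 'k) mpoly set) module" where
  "edge_module G =
     quot_module (poly_module (verts G)) (carrier (poly_ring (verts G))) (edge_ideal G)"

definition edge_module_hom :: "'v ugraph \<Rightarrow> int \<Rightarrow> ('v, 'k :: field) mpoly set set" where
  "edge_module_hom G \<delta> = (\<lambda>p. edge_ideal G +>\<^bsub>poly_ring (verts G)\<^esub> p) ` poly_hom (verts G) \<delta>"


subsection \<open>Localization of a module at a polynomial\<close>

text \<open>Elements of \<open>M\<^sub>f\<close> are classes of pairs \<open>(m, k)\<close>, standing for \<open>m / f ^ k\<close>.\<close>

definition loc_rel ::
  "(('v, 'k :: field) mpoly, 'b, 'm) module_scheme \<Rightarrow> ('v, 'k) mpoly \<Rightarrow> (('b \<times> nat) \<times> ('b \<times> nat)) set"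
  where
  "loc_rel M f = {((m, k), (m', k')). m \<in> carrier M \<and> m' \<in> carrier M \<and>
     (\<exists>l. f ^ l \<odot>\<^bsub>M\<^esub> (f ^ k' \<odot>\<^bsub>M\<^esub> m) = f ^ l \<odot>\<^bsub>M\<^esub> (f ^ k \<odot>\<^bsub>M\<^esub> m'))}"

definition loc_frac ::
  "(('v, 'k :: field) mpoly, 'b, 'm) module_scheme \<Rightarrow> ('v, 'k) mpoly \<Rightarrow> 'b \<Rightarrow> nat \<Rightarrow> ('b \<times> nat) set"
  where
  "loc_frac M f m k = loc_rel M f `` {(m, k)}"

definition loc_module ::
  "(('v, 'k :: field) mpoly, 'b, 'm) module_scheme \<Rightarrow> ('v, 'k) mpoly \<Rightarrow>
   (('v, 'k) mpoly, ('b \<times> nat) set) module"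
  where
  "loc_module M f = \<lparr>carrier = (carrier M \<times> UNIV) // loc_rel M f,
     mult = undefined, one = undefined, zero = loc_frac M f \<zero>\<^bsub>M\<^esub> 0,
     add = (\<lambda>X Y. \<Union>(m, k)\<in>X. \<Union>(m', k')\<in>Y.
              loc_frac M f (f ^ k' \<odot>\<^bsub>M\<^esub> m \<oplus>\<^bsub>M\<^esub> f ^ k \<odot>\<^bsub>M\<^esub> m') (k + k')),
     smult = (\<lambda>p X. \<Union>(m, k)\<in>X. loc_frac M f (p \<odot>\<^bsub>M\<^esub> m) k)\<rparr>"

text \<open>The canonical map from \<open>M\<^sub>f\<close> to \<open>M\<^sub>f\<^sub>g\<close>.\<close>

definition loc_map ::
  "(('v, 'k :: field) mpoly, 'b, 'm) module_scheme \<Rightarrow> ('v, 'k) mpoly \<Rightarrow> ('v, 'k) mpoly \<Rightarrow>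
   ('b \<times> nat) set \<Rightarrow> ('b \<times> nat) set"
  where
  "loc_map M f g X = (\<Union>(m, k)\<in>X. loc_frac M (f * g) (g ^ k \<odot>\<^bsub>M\<^esub> m) k)"


section \<open>Local cohomology\<close>

text \<open>Local cohomology of a \<open>\<int>\<close>-graded \<open>k[V]\<close>-module \<open>M\<close> with support in the ideal generated by
  all variables, as the cohomology of the (extended) Cech complex of \<open>M\<close> on the variables:
  in cohomological degree \<open>p\<close> this is the direct sum of the localizations of \<open>M\<close> at
  \<open>var_prod F\<close> over all \<open>F \<subseteq> V\<close> with \<open>p\<close> elements. The differential preserves the grading, so
  that the degree \<open>\<delta>\<close> component of the cohomology is the cohomology of the complex of
  \<open>k\<close>-vector spaces formed by the components of degree \<open>\<delta>\<close>. The grading of \<open>M\<close> is given by its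
  homogeneous components \<open>gr \<delta>\<close>.\<close>

definition var_prod :: "'v set \<Rightarrow> ('v, 'k :: field) mpoly" where
  "var_prod F = (\<Prod>v\<in>F. poly_var v)"

text \<open>\<open>m / (var_prod F) ^ k\<close> has degree \<open>\<delta>\<close> if \<open>m\<close> has degree \<open>\<delta> + k * card F\<close>.\<close>

definition loc_hom ::
  "(('v, 'k :: field) mpoly, 'b, 'm) module_scheme \<Rightarrow> (int \<Rightarrow> 'b set) \<Rightarrow> 'v set \<Rightarrow> int \<Rightarrow>
   ('b \<times> nat) set set"
  where
  "loc_hom M gr F \<delta> = {loc_frac M (var_prod F) m k | m k. m \<in> gr (\<delta> + int k * int (card F))}"

definition cech_cochains ::
  "'v set \<Rightarrow> (('v, 'k :: field) mpoly, 'b, 'm) module_scheme \<Rightarrow> (int \<Rightarrow> 'b set) \<Rightarrow> nat \<Rightarrow> int \<Rightarrow>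
   ('k, 'v set \<Rightarrow> ('b \<times> nat) set) module"
  where
  "cech_cochains V M gr p \<delta> =
     (let FF = {F. F \<subseteq> V \<and> card F = p}; L = (\<lambda>F. loc_module M (var_prod F)) in
      \<lparr>carrier = (\<Pi>\<^sub>E F\<in>FF. loc_hom M gr F \<delta>),
       mult = undefined, one = undefined,
       zero = (\<lambda>F\<in>FF. \<zero>\<^bsub>L F\<^esub>),
       add = (\<lambda>c c'. \<lambda>F\<in>FF. c F \<oplus>\<^bsub>L F\<^esub> c' F),
       smult = (\<lambda>a c. \<lambda>F\<in>FF. poly_const a \<odot>\<^bsub>L F\<^esub> c F)\<rparr>)"

text \<open>The signs in the differential require an ordering of the variables. Any choice gives the
  same cohomology up to isomorphism.\<close>

definition vertex_pos :: "'v set \<Rightarrow> 'v \<Rightarrow> nat" where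
  "vertex_pos V = (SOME h. inj_on h V)"

definition cech_sign :: "'v set \<Rightarrow> 'v set \<Rightarrow> 'v \<Rightarrow> 'k :: field" where
  "cech_sign V F v = (- 1) ^ card {w \<in> F. vertex_pos V w < vertex_pos V v}"

definition cech_diff ::
  "'v set \<Rightarrow> (('v, 'k :: field) mpoly, 'b, 'm) module_scheme \<Rightarrow> nat \<Rightarrow>
   ('v set \<Rightarrow> ('b \<times> nat) set) \<Rightarrow> 'v set \<Rightarrow> ('b \<times> nat) set"
  where
  "cech_diff V M p c =
     (\<lambda>F\<in>{F. F \<subseteq> V \<and> card F = Suc p}.
        \<Oplus>\<^bsub>loc_module M (var_prod F)\<^esub> v\<in>F.
          poly_const (cech_sign V F v) \<odot>\<^bsub>loc_module M (var_prod F)\<^esub>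
            loc_map M (var_prod (F - {v})) (poly_var v) (c (F - {v})))"

definition cech_cocycles ::
  "'v set \<Rightarrow> (('v, 'k :: field) mpoly, 'b, 'm) module_scheme \<Rightarrow> (int \<Rightarrow> 'b set) \<Rightarrow> nat \<Rightarrow> int \<Rightarrow>
   ('v set \<Rightarrow> ('b \<times> nat) set) set"
  where
  "cech_cocycles V M gr p \<delta> =
     {c \<in> carrier (cech_cochains V M gr p \<delta>).
        cech_diff V M p c = \<zero>\<^bsub>cech_cochains V M gr (Suc p) \<delta>\<^esub>}"

fun cech_coboundaries ::
  "'v set \<Rightarrow> (('v, 'k :: field) mpoly, 'b, 'm) module_scheme \<Rightarrow> (int \<Rightarrow> 'b set) \<Rightarrow> nat \<Rightarrow> int \<Rightarrow>
   ('v set \<Rightarrow> ('b \<times> nat) set) set"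
  where
  "cech_coboundaries V M gr 0 \<delta> = {\<zero>\<^bsub>cech_cochains V M gr 0 \<delta>\<^esub>}"
| "cech_coboundaries V M gr (Suc p) \<delta> =
     cech_diff V M p ` carrier (cech_cochains V M gr p \<delta>)"

definition local_cohomology ::
  "'v set \<Rightarrow> (('v, 'k :: field) mpoly, 'b, 'm) module_scheme \<Rightarrow> (int \<Rightarrow> 'b set) \<Rightarrow> nat \<Rightarrow> int \<Rightarrow>
   ('k, ('v set \<Rightarrow> ('b \<times> nat) set) set) module"
  where
  "local_cohomology V M gr p \<delta> =
     quot_module (cech_cochains V M gr p \<delta>)
       (cech_cocycles V M gr p \<delta>) (cech_coboundaries V M gr p \<delta>)"

definition edge_local_cohomology ::
  "'v ugraph \<Rightarrow> nat \<Rightarrow> int \<Rightarrow>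
   ('k :: field, ('v set \<Rightarrow> (('v, 'k) mpoly set \<times> nat) set) set) module"
  where
  "edge_local_cohomology G =
     local_cohomology (verts G) (edge_module G) (edge_module_hom G)"

text \<open>The Hilbert series of a graded vector space, given by its components \<open>W \<delta>\<close>, that vanishes in
  all sufficiently large degrees. It is a Laurent series in \<open>t\<^sup>-\<^sup>1\<close>: the formal variable
  \<open>fls_X\<close> stands for \<open>t\<^sup>-\<^sup>1\<close>, hence the coefficient of \<open>t\<close> to the power \<open>\<delta>\<close> is the one of index
  \<open>- \<delta>\<close>. Finiteness of all components has to be required separately since \<open>vectorspace.dim\<close>
  is a natural number.\<close>

definition has_hilbert_series :: "(int \<Rightarrow> ('k :: field, 'a) module) \<Rightarrow> rat fls \<Rightarrow> bool" where
  "has_hilbert_series W F \<longleftrightarrow>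
     (\<forall>\<delta>. vectorspace class_ring (W \<delta>) \<and> vectorspace.fin_dim class_ring (W \<delta>) \<and>
          of_nat (vectorspace.dim class_ring (W \<delta>)) = fls_nth F (- \<delta>))"

end

theory Submission
  imports Defs
begin

text \<open>
  In a fixed multidegree \<open>a\<close> the Cech complex is the simplicial cochain complex of the family of
  all \<open>F\<close> that contain the negative support of \<open>a\<close> and for which the union of \<open>F\<close> with the support
  of \<open>a\<close> is independent. Such a complex is acyclic as soon as adding and removing a single vertex
  preserves the family. This settles all \<open>a\<close> with a positive entry and all \<open>a\<close> whose support does
  not consist of all copies of the vertices of an independent set \<open>A\<close> of \<open>H\<close>. In the remaining
  cases one has to understand the vertices of \<open>H\<close> that are neither in \<open>A\<close> nor adjacent to \<open>A\<close>. Since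
  every minimal cover contains exactly one end of each edge \<open>{x s, y s}\<close>, edges \<open>{u, x s}\<close> and
  \<open>{w, y s}\<close> force an edge \<open>{u, w}\<close>; together with the ordering condition this makes the complex
  acyclic unless these vertices induce a disjoint union of edges \<open>{x s, y s}\<close> for \<open>s\<close> in a set
  \<open>T\<close>. Then the family is a join of \<open>card T\<close> pairs of disjoint simplices, and its cohomology is
  one-dimensional. Finally such \<open>A\<close> correspond to pairs of a minimal cover \<open>C\<close> and a set
  \<open>D = x ` T\<close> of exchangeable vertices, \<open>A\<close> being the complement of \<open>C \<union> D\<close>.
\<close>

section \<open>Cochains on families of sets\<close>

text \<open>The local cohomology is given degree by degree, through classes of pairs in
  localizations, and not by multidegrees. The bridge is the coefficient function of a fraction: it
  identifies a localization of \<open>k[V] / I(G)\<close> with certain finitely supported functions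
  on integer exponents, so a cochain of degree \<delta> becomes a finitely supported family of
  cochains on set families, one for each exponent of total degree \<delta>. Finite support has to
  survive the choice of primitives, so zero is always lifted to zero. Acyclicity and
  one-dimensionality are stated for cochains of mixed degree. This keeps the gluing of families
  formal; a single degree is cut out only when primitives are assembled. The numbers in the formula
  can be read off one pair \<open>(C, D)\<close>. Its exponents are negative exactly on the copies
  of the vertices outside \<open>C\<close> and \<open>D\<close>. There are d - N_D such copies,
  which gives the power of the geometric series. A facet of the cross-polytope adds
  \<open>card D\<close> further vertices, so the class has Cech degree d - N_D +
  \<open>card D\<close>.\<close>

definition below_sign :: "('w \<Rightarrow> nat) \<Rightarrow> 'w set \<Rightarrow> 'w \<Rightarrow> 'k::field" where
  "below_sign h F v = (- 1) ^ card {w \<in> F. h w < h v}"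

lemma below_sign_square [simp]: "below_sign h F v * below_sign h F v = (1::'k::field)"
  unfolding below_sign_def by (simp flip: power_mult_distrib)

lemma below_sign_insert:
  assumes "finite F" "w \<notin> F"
  shows "below_sign h (insert w F) v = (if h w < h v then - below_sign h F v else below_sign h F v :: 'k::field)"
proof (cases "h w < h v")
  case True
  then have "{u \<in> insert w F. h u < h v} = insert w {u \<in> F. h u < h v}" by auto
  then show ?thesis using True assms by (simp add: below_sign_def)
next
  case False
  then have "{u \<in> insert w F. h u < h v} = {u \<in> F. h u < h v}" by auto
  then show ?thesis using False by (simp add: below_sign_def)
qed

text \<open>Adding \<open>u\<close> changes the sign at \<open>v\<close> exactly if \<open>u\<close>
  precedes \<open>v\<close> in the order \<open>h\<close>, and vice versa. As \<open>h\<close>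
  separates the two vertices, exactly one of the two signs changes.\<close>

lemma below_sign_exchange:
  assumes "finite F" "u \<notin> F" "v \<notin> F" "h u \<noteq> h v"
  shows "below_sign h (insert u (insert v F)) v * below_sign h (insert u F) u
       = - (below_sign h (insert u (insert v F)) u * below_sign h (insert v F) v :: 'k::field)"
proof -
  have "u \<noteq> v" using assms(4) by auto
  have a: "below_sign h (insert u (insert v F)) v = (if h u < h v then - below_sign h (insert v F) v else below_sign h (insert v F) v :: 'k)"
    using assms \<open>u \<noteq> v\<close> by (intro below_sign_insert) auto
  have "below_sign h (insert v (insert u F)) u = (if h v < h u then - below_sign h (insert u F) u else below_sign h (insert u F) u :: 'k)"
    using assms \<open>u \<noteq> v\<close> by (intro below_sign_insert) auto
  then have b: "below_sign h (insert u (insert v F)) u = (if h v < h u then - below_sign h (insert u F) u else below_sign h (insert u F) u :: 'k)"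
    by (simp add: insert_commute)
  show ?thesis using assms(4) unfolding a b by (auto simp: mult.commute)
qed

text \<open>The simplicial coboundary restricted to a family \<open>B\<close> of sets; on a convex family it is
  the relative cochain complex of a pair of simplicial complexes.\<close>

definition cobdry :: "('w \<Rightarrow> nat) \<Rightarrow> 'w set set \<Rightarrow> ('w set \<Rightarrow> 'k::field) \<Rightarrow> 'w set \<Rightarrow> 'k" where
  "cobdry h B c F = (if F \<in> B then \<Sum>v\<in>F. below_sign h F v * c (F - {v}) else 0)"

definition supported :: "'w set set \<Rightarrow> ('w set \<Rightarrow> 'k::field) \<Rightarrow> bool" where
  "supported B c \<longleftrightarrow> (\<forall>F. F \<notin> B \<longrightarrow> c F = 0)"

definition convex_family :: "'w set set \<Rightarrow> bool" where
  "convex_family B \<longleftrightarrow> (\<forall>A\<in>B. \<forall>C\<in>B. \<forall>E. A \<subseteq> E \<and> E \<subseteq> C \<longrightarrow> E \<in> B)"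

definition acyclic_family :: "'k::field itself \<Rightarrow> ('w \<Rightarrow> nat) \<Rightarrow> 'w set set \<Rightarrow> bool" where
  "acyclic_family _ h B \<longleftrightarrow> (\<forall>c :: 'w set \<Rightarrow> 'k. supported B c \<and> cobdry h B c = (\<lambda>_. 0) \<longrightarrow>
      (\<exists>b. supported B b \<and> cobdry h B b = c))"

text \<open>The cohomology is one-dimensional, spanned by the class of \<open>z\<close> in degree \<open>m\<close>.\<close>

definition sphere_like :: "('w \<Rightarrow> nat) \<Rightarrow> 'w set set \<Rightarrow> nat \<Rightarrow> ('w set \<Rightarrow> 'k::field) \<Rightarrow> bool" where
  "sphere_like h B m z \<longleftrightarrow> supported (B \<inter> {F. card F = m}) z \<and> cobdry h B z = (\<lambda>_. 0) \<and>
     (\<nexists>b. supported B b \<and> cobdry h B b = z) \<and>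
     (\<forall>c. supported B c \<and> cobdry h B c = (\<lambda>_. 0) \<longrightarrow>
        (\<exists>\<alpha> b. supported B b \<and> c = (\<lambda>F. \<alpha> * z F + cobdry h B b F)))"

lemma supportedD: "supported B c \<Longrightarrow> F \<notin> B \<Longrightarrow> c F = 0"
  by (simp add: supported_def)

lemma supported_mono: "supported A c \<Longrightarrow> A \<subseteq> B \<Longrightarrow> supported B c"
  by (auto simp: supported_def)

lemma cobdry_diff: "cobdry h B (\<lambda>F. b F - c F) F = cobdry h B b F - cobdry h B c F"
  by (simp add: cobdry_def sum_subtractf right_diff_distrib)

lemma cobdry_add: "cobdry h B (\<lambda>F. b F + c F) F = cobdry h B b F + cobdry h B c F"
  by (simp add: cobdry_def sum.distrib distrib_left)

lemma cobdry_scale: "cobdry h B (\<lambda>F. a * c F) F = a * cobdry h B c F"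
  by (simp add: cobdry_def sum_distrib_left mult.left_commute)

lemma cobdry_zero [simp]: "cobdry h B (\<lambda>_. 0) = (\<lambda>_. 0)"
  by (simp add: cobdry_def fun_eq_iff)

text \<open>Deleting two vertices in the two possible orders gives opposite signs. Convexity deals
  with a middle set \<open>F - {v}\<close> outside \<open>B\<close>: then no
  \<open>F - {v} - {u}\<close> lies in \<open>B\<close> either, since \<open>F - {v}\<close> is
  squeezed between it and \<open>F\<close>, so the omitted terms are zero anyway.\<close>

lemma cobdry_cobdry:
  assumes conv: "convex_family B" and supp: "supported B c" and fin: "\<forall>F\<in>B. finite F \<and> inj_on h F"
  shows "cobdry h B (cobdry h B c) = (\<lambda>_. 0 :: 'k::field)"
proof
  fix F
  show "cobdry h B (cobdry h B c) F = 0"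
  proof (cases "F \<in> B")
    case True
    then have "finite F" "inj_on h F" using fin by auto
    define t where "t = (\<lambda>v u. below_sign h F v * (below_sign h (F - {v}) u * c (F - {v} - {u})) :: 'k)"
    have inner: "below_sign h F v * cobdry h B c (F - {v}) = (\<Sum>u\<in>F - {v}. t v u)" if "v \<in> F" for v
    proof (cases "F - {v} \<in> B")
      case True
      then show ?thesis by (simp add: cobdry_def t_def sum_distrib_left)
    next
      case False
      have "c (F - {v} - {u}) = 0" for u
      proof (rule supportedD[OF supp])
        show "F - {v} - {u} \<notin> B"
        proof
          assume "F - {v} - {u} \<in> B"
          moreover have "F - {v} - {u} \<subseteq> F - {v}" "F - {v} \<subseteq> F" by auto
          ultimately show False
            using conv True False unfolding convex_family_def by blast
        qed
      qed
      then show ?thesis using False by (simp add: cobdry_def t_def)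
    qed
    have anti: "t v u = - t u v" if "v \<in> F" "u \<in> F" "u \<noteq> v" for u v
    proof -
      define E where "E = F - {u, v}"
      have F: "F = insert u (insert v E)" and E: "finite E" "u \<notin> E" "v \<notin> E"
        using that \<open>finite F\<close> by (auto simp: E_def)
      have "h u \<noteq> h v" using \<open>inj_on h F\<close> that by (auto dest: inj_onD)
      have e: "F - {v} = insert u E" "F - {u} = insert v E" "F - {v} - {u} = E" "F - {u} - {v} = E"
        using that by (auto simp: E_def)
      show ?thesis
        using below_sign_exchange[OF E \<open>h u \<noteq> h v\<close>, where 'k='k] unfolding t_def e(3,4) unfolding e(1,2) F[symmetric]
        by (simp flip: mult.assoc)
    qed
    \<comment> \<open>One half of the ordered pairs of distinct vertices. The mirror image is the
      other half, so the terms of the double sum cancel in pairs.\<close>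
    define P where "P = {(v,u). v \<in> F \<and> u \<in> F \<and> h v < h u}"
    have finP: "finite P" unfolding P_def
      by (rule finite_subset[of _ "F \<times> F"]) (auto simp: \<open>finite F\<close>)
    have "cobdry h B (cobdry h B c) F = (\<Sum>v\<in>F. \<Sum>u\<in>F - {v}. t v u)"
      using True inner by (simp add: cobdry_def[of h B "cobdry h B c"])
    also have "\<dots> = (\<Sum>(v,u)\<in>Sigma F (\<lambda>v. F - {v}). t v u)"
      by (intro sum.Sigma) (auto simp: \<open>finite F\<close>)
    also have "Sigma F (\<lambda>v. F - {v}) = P \<union> prod.swap ` P"
      using \<open>inj_on h F\<close> by (auto simp: P_def image_iff inj_on_def) (metis linorder_neqE_nat)
    also have "(\<Sum>(v,u)\<in>P \<union> prod.swap ` P. t v u) = (\<Sum>(v,u)\<in>P. t v u) + (\<Sum>(v,u)\<in>prod.swap ` P. t v u)"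
      by (intro sum.union_disjoint) (auto simp: P_def finP[unfolded P_def])
    also have "(\<Sum>(v,u)\<in>prod.swap ` P. t v u) = (\<Sum>(v,u)\<in>P. t u v)"
      by (subst sum.reindex) (auto intro!: sum.cong)
    also have "(\<Sum>(v,u)\<in>P. t v u) + (\<Sum>(v,u)\<in>P. t u v) = (\<Sum>(v,u)\<in>P. t v u + t u v)"
      by (simp add: sum.distrib case_prod_unfold)
    also have "\<dots> = 0" 
    proof (intro sum.neutral ballI, clarify)
      fix v u assume "(v, u) \<in> P"
      then have "v \<in> F" "u \<in> F" "u \<noteq> v" by (auto simp: P_def)
      then show "t v u + t u v = 0" using anti[of v u] by simp
    qed
    finally show ?thesis .
  qed (simp add: cobdry_def)
qed

text \<open>The family is a cone with apex \<open>v\<close>; the proof is the usual contracting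
  homotopy, written out for one cocycle at a time.\<close>

lemma acyclic_family_toggle:
  assumes fin: "\<forall>F\<in>B. finite F \<and> inj_on h (insert v F)"
    and add: "\<And>F. F \<in> B \<Longrightarrow> insert v F \<in> B" and del: "\<And>F. F \<in> B \<Longrightarrow> F - {v} \<in> B"
  shows "acyclic_family TYPE('k::field) h B"
  unfolding acyclic_family_def
proof (intro allI impI, elim conjE)
  fix c :: "'a set \<Rightarrow> 'k"
  assume supp: "supported B c" and cyc: "cobdry h B c = (\<lambda>_. 0)"
  \<comment> \<open>Contraction with \<open>v\<close>. It vanishes on sets containing
    \<open>v\<close>, so for \<open>v \<in> F\<close> a single term of the coboundary
    survives.\<close>
  define b :: "'a set \<Rightarrow> 'k" where "b = (\<lambda>F. if v \<in> F then 0 else below_sign h (insert v F) v * c (insert v F))"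
  have "supported B b"
    unfolding supported_def b_def
  proof (intro allI impI)
    fix F assume "F \<notin> B"
    then have "v \<in> F \<or> insert v F \<notin> B" using del[of "insert v F"] by auto
    then show "(if v \<in> F then 0 else below_sign h (insert v F) v * c (insert v F)) = 0"
      using supportedD[OF supp] by auto
  qed
  moreover have "cobdry h B b F = c F" for F
  proof (cases "F \<in> B")
    case False
    then show ?thesis using supportedD[OF supp] by (simp add: cobdry_def)
  next
    case True
    then have fF: "finite F" and inj: "inj_on h (insert v F)" using fin by auto
    show ?thesis
    proof (cases "v \<in> F")
      case vF: True
      have "(\<Sum>u\<in>F. below_sign h F u * b (F - {u})) = (\<Sum>u\<in>{v}. below_sign h F u * b (F - {u}))"
        by (intro sum.mono_neutral_right) (use vF fF in \<open>auto simp: b_def\<close>)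
      also have "\<dots> = below_sign h F v * below_sign h F v * c F"
        using vF by (simp add: b_def insert_absorb)
      finally show ?thesis using True by (simp add: cobdry_def)
    next
      case vF: False
      have ins: "insert v F \<in> B" using add True by auto
      \<comment> \<open>The cocycle condition at \<open>insert v F\<close> expresses
        \<open>c F\<close> by values of \<open>c\<close> on sets containing \<open>v\<close>, which
        are the values that \<open>b\<close> uses.\<close>
      have "0 = cobdry h B c (insert v F)" using cyc by simp
      also have "\<dots> = below_sign h (insert v F) v * c F +
          (\<Sum>u\<in>F. below_sign h (insert v F) u * c (insert v F - {u}))"
        using ins vF fF by (simp add: cobdry_def)
      finally have "below_sign h (insert v F) v * c F = - (\<Sum>u\<in>F. below_sign h (insert v F) u * c (insert v F - {u}))"
        by (simp only: eq_neg_iff_add_eq_0)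
      then have "below_sign h (insert v F) v * (below_sign h (insert v F) v * c F) =
         - (below_sign h (insert v F) v * (\<Sum>u\<in>F. below_sign h (insert v F) u * c (insert v F - {u})))"
        by (simp only: mult_minus_right)
      then have cF: "c F = - (\<Sum>u\<in>F. below_sign h (insert v F) v * (below_sign h (insert v F) u * c (insert v F - {u})))"
        by (simp add: sum_distrib_left flip: mult.assoc)
      have "cobdry h B b F = (\<Sum>u\<in>F. below_sign h F u * b (F - {u}))" using True by (simp add: cobdry_def)
      also have "\<dots> = (\<Sum>u\<in>F. - (below_sign h (insert v F) v * (below_sign h (insert v F) u * c (insert v F - {u}))))"
      proof (rule sum.cong[OF refl])
        fix u assume u: "u \<in> F"
        define E where "E = F - {u}"
        have F: "F = insert u E" and E: "finite E" "u \<notin> E" "v \<notin> E" "u \<noteq> v"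
          using u vF fF by (auto simp: E_def)
        have huv: "h v \<noteq> h u" using inj u E(4) by (auto simp: inj_on_def)
        have eq: "insert v F - {u} = insert v E" "F - {u} = E" "insert v (F - {u}) = insert v E" using E F by auto
        have "below_sign h (insert v (insert u E)) u * below_sign h (insert v E) v
            = - (below_sign h (insert v (insert u E)) v * below_sign h (insert u E) u :: 'k)"
          by (rule below_sign_exchange[OF E(1) E(3) E(2) huv])
        then have s: "below_sign h (insert v F) u * below_sign h (insert v E) v
            = - (below_sign h (insert v F) v * below_sign h F u :: 'k)" unfolding F[symmetric] .
        have "below_sign h F u * below_sign h (insert v E) v = 
            below_sign h (insert v F) v * below_sign h (insert v F) v * below_sign h F u * below_sign h (insert v E) v" by simp
        also have "\<dots> = - (below_sign h (insert v F) v * (- (below_sign h (insert v F) v * below_sign h F u)) * below_sign h (insert v E) v)" by (simp add: mult.assoc)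
        also have "\<dots> = - (below_sign h (insert v F) v * below_sign h (insert v F) u * (below_sign h (insert v E) v * below_sign h (insert v E) v) :: 'k)"
          unfolding s[symmetric] by (simp only: mult_ac)
        finally have "below_sign h F u * below_sign h (insert v E) v = - (below_sign h (insert v F) v * below_sign h (insert v F) u :: 'k)" by simp
        then show "below_sign h F u * b (F - {u}) = - (below_sign h (insert v F) v * (below_sign h (insert v F) u * c (insert v F - {u})))"
          using E(3) unfolding eq b_def by (simp flip: mult.assoc)
      qed
      finally show ?thesis using cF by (simp add: sum_negf)
    qed
  qed
  ultimately show "\<exists>b. supported B b \<and> cobdry h B b = c" by blast
qed

section \<open>The long exact sequence of an upward closed subfamily\<close>

definition restrict_to :: "'w set set \<Rightarrow> ('w set \<Rightarrow> 'k::field) \<Rightarrow> 'w set \<Rightarrow> 'k" where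
  "restrict_to A c F = (if F \<in> A then c F else 0)"

lemma supported_restrict_to [simp]: "supported A (restrict_to A c)"
  by (simp add: supported_def restrict_to_def)

text \<open>Upward closure makes the cochains supported on \<open>U\<close> a subcomplex; the
  quotient complex is that of the family \<open>B - U\<close>. The long exact sequence of this pair
  is used below in the form of explicit corrections of cochains.\<close>

definition upper_part :: "'w set set \<Rightarrow> 'w set set \<Rightarrow> bool" where
  "upper_part B U \<longleftrightarrow> U \<subseteq> B \<and> (\<forall>A\<in>U. \<forall>F\<in>B. A \<subseteq> F \<longrightarrow> F \<in> U)"

lemma cobdry_lower_part:
  assumes "upper_part B U" "supported B c" "F \<in> B - U"
  shows "cobdry h B c F = cobdry h (B - U) (restrict_to (B - U) c) F"
proof -
  have "c (F - {v}) = restrict_to (B - U) c (F - {v})" if "v \<in> F" for v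
  proof -
    have "F - {v} \<notin> U" using assms(1,3) unfolding upper_part_def by blast
    then show ?thesis using supportedD[OF assms(2)] by (auto simp: restrict_to_def)
  qed
  then show ?thesis using assms(3) by (simp add: cobdry_def)
qed

lemma cobdry_upper_part:
  assumes "upper_part B U" "supported U c"
  shows "cobdry h B c = cobdry h U c"
proof
  fix F
  show "cobdry h B c F = cobdry h U c F"
  proof (cases "F \<in> B - U")
    case True
    have "c (F - {v}) = 0" for v
      by (rule supportedD[OF assms(2)]) (use assms(1) True in \<open>auto simp: upper_part_def\<close>)
    then show ?thesis using True by (simp add: cobdry_def)
  next
    case False
    then show ?thesis using assms(1) by (auto simp: cobdry_def upper_part_def)
  qed
qed

lemma cocycle_restrict_lower:
  assumes "upper_part B U" "supported B c" "\<And>F. F \<in> B - U \<Longrightarrow> cobdry h B c F = e F" "supported (B - U) e"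
  shows "cobdry h (B - U) (restrict_to (B - U) c) = e"
proof
  fix F
  show "cobdry h (B - U) (restrict_to (B - U) c) F = e F"
    using cobdry_lower_part[OF assms(1,2), of F h] assms(3)[of F] supportedD[OF assms(4), of F]
    by (cases "F \<in> B - U") (auto simp: cobdry_def)
qed

text \<open>A primitive on the quotient complex, extended by zero, pushes \<open>c\<close> into the
  subcomplex.\<close>

lemma cobdry_correct_lower:
  assumes "upper_part B U" "supported B c" "supported (B - U) b"
    and "cobdry h (B - U) b = restrict_to (B - U) c"
  shows "supported U (\<lambda>F. c F - cobdry h B b F)"
  unfolding supported_def
proof (intro allI impI)
  fix F assume "F \<notin> U"
  have b: "supported B b" using assms(3) by (rule supported_mono) auto
  show "c F - cobdry h B b F = 0"
  proof (cases "F \<in> B")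
    case True
    have "restrict_to (B - U) b = b" using supportedD[OF assms(3)] by (auto simp: restrict_to_def fun_eq_iff)
    then have "cobdry h B b F = restrict_to (B - U) c F"
      using cobdry_lower_part[OF assms(1) b, of F h] True \<open>F \<notin> U\<close> assms(4) by simp
    then show ?thesis using True \<open>F \<notin> U\<close> by (simp add: restrict_to_def)
  next
    case False
    then show ?thesis using supportedD[OF assms(2)] by (simp add: cobdry_def)
  qed
qed

lemma acyclic_familyD:
  fixes c :: "'w set \<Rightarrow> 'k::field"
  assumes "acyclic_family TYPE('k) h B" "supported B c" "cobdry h B c = (\<lambda>_. 0)"
  obtains b where "supported B b" "cobdry h B b = c"
  using assms unfolding acyclic_family_def by blast

locale family_split =
  fixes h :: "'w \<Rightarrow> nat" and B U :: "'w set set"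
  assumes convex: "convex_family B" and fin: "\<forall>F\<in>B. finite F \<and> inj_on h F" and upper: "upper_part B U"
begin

lemma U_subset: "U \<subseteq> B"
  using upper by (simp add: upper_part_def)

lemma lower_correction:
  fixes c :: "'w set \<Rightarrow> 'k::field"
  assumes "acyclic_family TYPE('k) h (B - U)" "supported B c" "\<And>F. F \<in> B - U \<Longrightarrow> cobdry h B c F = 0"
  obtains b where "supported B b" "supported U (\<lambda>F. c F - cobdry h B b F)"
proof -
  have "cobdry h (B - U) (restrict_to (B - U) c) = (\<lambda>_. 0)"
    by (rule cocycle_restrict_lower[OF upper assms(2)]) (auto simp: assms(3) supported_def)
  then obtain b where b: "supported (B - U) b" "cobdry h (B - U) b = restrict_to (B - U) c"
    using acyclic_familyD[OF assms(1)] supported_restrict_to by metis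
  show ?thesis
    by (rule that[of b]) (use b in \<open>auto intro!: cobdry_correct_lower[OF upper assms(2)] elim: supported_mono\<close>)
qed

lemma cocycle_correction:
  fixes c b :: "'w set \<Rightarrow> 'k::field"
  assumes "cobdry h B c = (\<lambda>_. 0)" "supported B b" "supported U (\<lambda>F. c F - cobdry h B b F)"
  shows "cobdry h U (\<lambda>F. c F - cobdry h B b F) = (\<lambda>_. 0)"
  unfolding cobdry_upper_part[OF upper assms(3), symmetric]
  using assms(1) cobdry_cobdry[OF convex assms(2) fin] by (simp add: cobdry_diff fun_eq_iff)

lemma acyclic_family_union:
  assumes "acyclic_family TYPE('k::field) h (B - U)" "acyclic_family TYPE('k) h U"
  shows "acyclic_family TYPE('k) h B"
  unfolding acyclic_family_def
proof (intro allI impI, elim conjE)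
  fix c :: "'w set \<Rightarrow> 'k"
  assume c: "supported B c" "cobdry h B c = (\<lambda>_. 0)"
  obtain b where b: "supported B b" "supported U (\<lambda>F. c F - cobdry h B b F)"
    by (rule lower_correction[OF assms(1) c(1)]) (simp_all add: c(2))
  obtain b' where b': "supported U b'" "cobdry h U b' = (\<lambda>F. c F - cobdry h B b F)"
    using acyclic_familyD[OF assms(2) b(2) cocycle_correction[OF c(2) b]] .
  have "cobdry h B (\<lambda>F. b F + b' F) = c"
    using b'(2) unfolding cobdry_upper_part[OF upper b'(1), symmetric] by (simp add: cobdry_add fun_eq_iff)
  moreover have "supported B (\<lambda>F. b F + b' F)"
    using supportedD[OF b(1)] supportedD[OF supported_mono[OF b'(1) U_subset]] by (auto simp: supported_def)
  ultimately show "\<exists>b. supported B b \<and> cobdry h B b = c" by blast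
qed

text \<open>With an acyclic quotient the inclusion of the subcomplex is a quasi-isomorphism, so the
  same cochain \<open>z\<close> is a generator on \<open>B\<close>.\<close>

lemma sphere_like_upper:
  fixes z :: "'w set \<Rightarrow> 'k::field"
  assumes ac: "acyclic_family TYPE('k) h (B - U)" and z: "sphere_like h U m z"
  shows "sphere_like h B m z"
  unfolding sphere_like_def
proof (intro conjI allI impI)
  have zU: "supported U z" using z by (auto simp: sphere_like_def supported_def)
  show "supported (B \<inter> {F. card F = m}) z"
    using z U_subset by (auto simp: sphere_like_def elim!: supported_mono)
  show "cobdry h B z = (\<lambda>_. 0)"
    using z by (simp add: sphere_like_def cobdry_upper_part[OF upper zU])
  show "\<nexists>b. supported B b \<and> cobdry h B b = z"
  proof (rule notI, elim exE conjE)
    fix b assume b: "supported B b" "cobdry h B b = z"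
    obtain b' where b': "supported B b'" "supported U (\<lambda>F. b F - cobdry h B b' F)"
      by (rule lower_correction[OF ac b(1)]) (use supportedD[OF zU] b(2) in auto)
    have "cobdry h U (\<lambda>F. b F - cobdry h B b' F) = z"
      unfolding cobdry_upper_part[OF upper b'(2), symmetric]
      using b(2) cobdry_cobdry[OF convex b'(1) fin] by (simp add: cobdry_diff fun_eq_iff)
    then show False using z b'(2) unfolding sphere_like_def by blast
  qed
  fix c :: "'w set \<Rightarrow> 'k" assume c: "supported B c \<and> cobdry h B c = (\<lambda>_. 0)"
  obtain b where b: "supported B b" "supported U (\<lambda>F. c F - cobdry h B b F)"
    by (rule lower_correction[OF ac, of c]) (use c in auto)
  obtain \<alpha> b' where b': "supported U b'" "(\<lambda>F. c F - cobdry h B b F) = (\<lambda>F. \<alpha> * z F + cobdry h U b' F)"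
    using z b(2) cocycle_correction[of c, OF _ b] c unfolding sphere_like_def by metis
  have "c = (\<lambda>F. \<alpha> * z F + cobdry h B (\<lambda>F. b F + b' F) F)"
    using b'(2) unfolding cobdry_upper_part[OF upper b'(1), symmetric]
    by (auto simp: cobdry_add fun_eq_iff algebra_simps)
  moreover have "supported B (\<lambda>F. b F + b' F)"
    using supportedD[OF b(1)] supportedD[OF supported_mono[OF b'(1) U_subset]] by (auto simp: supported_def)
  ultimately show "\<exists>\<alpha> b. supported B b \<and> c = (\<lambda>F. \<alpha> * z F + cobdry h B b F)" by blast
qed

text \<open>With an acyclic subcomplex the projection to the quotient is a quasi-isomorphism. Here
  \<open>z\<close> need not stay a cocycle: its coboundary on \<open>B\<close> is a cocycle on
  \<open>U\<close>, and a primitive of that on \<open>U\<close> corrects it.\<close>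

lemma sphere_like_lower:
  fixes z :: "'w set \<Rightarrow> 'k::field"
  assumes ac: "acyclic_family TYPE('k) h U" and z: "sphere_like h (B - U) m z"
  shows "\<exists>z' :: 'w set \<Rightarrow> 'k. sphere_like h B m z'"
proof -
  have zL: "supported (B - U) z" using z by (auto simp: sphere_like_def supported_def)
  have zB: "supported B z" using zL by (rule supported_mono) auto
  have resz: "restrict_to (B - U) z = z" using supportedD[OF zL] by (auto simp: restrict_to_def)
  have dzU: "supported U (cobdry h B z)"
    unfolding supported_def
  proof (intro allI impI)
    fix F assume F: "F \<notin> U"
    show "cobdry h B z F = 0"
    proof (cases "F \<in> B")
      case True
      then have "cobdry h B z F = cobdry h (B - U) z F"
        using cobdry_lower_part[OF upper zB, of F h] F unfolding resz by blast
      then show ?thesis using z by (simp add: sphere_like_def)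
    qed (simp add: cobdry_def)
  qed
  have "cobdry h U (cobdry h B z) = (\<lambda>_. 0)"
    unfolding cobdry_upper_part[OF upper dzU, symmetric] by (rule cobdry_cobdry[OF convex zB fin])
  then obtain w where w: "supported U w" "cobdry h U w = cobdry h B z"
    using acyclic_familyD[OF ac dzU] by metis
  \<comment> \<open>The primitive \<open>w\<close> may have mixed degree, whereas the generator must
    live on sets with \<open>m\<close> elements. Truncation does not affect the coboundary, because
    that of \<open>z\<close> lives on sets with \<open>Suc m\<close> elements.\<close>
  define w' where "w' = (\<lambda>F. if card F = m then w F else 0)"
  have w': "supported U w'" using w(1) by (auto simp: supported_def w'_def)
  have zm: "z F = 0" if "card F \<noteq> m" for F
    using z that by (auto simp: sphere_like_def supported_def)
  have dw': "cobdry h B w' = cobdry h B z"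
  proof
    fix F
    show "cobdry h B w' F = cobdry h B z F"
    proof (cases "F \<in> B \<and> card F = Suc m")
      case True
      then have "card (F - {v}) = m" if "v \<in> F" for v using that by simp
      then have "cobdry h B w' F = cobdry h B w F" by (simp add: cobdry_def w'_def)
      then show ?thesis using w(2) cobdry_upper_part[OF upper w(1), of h] by simp
    next
      case False
      then show ?thesis
      proof (cases "F \<in> B")
        case True
        then have "card (F - {v}) \<noteq> m" if "v \<in> F" for v 
          using that False fin card_Suc_Diff1[of F v] by auto
        then show ?thesis by (simp add: cobdry_def w'_def zm)
      qed (simp add: cobdry_def)
    qed
  qed
  define z' where "z' = (\<lambda>F. z F - w' F)"
  have z'B: "supported B z'"
    using supportedD[OF zB] supportedD[OF supported_mono[OF w' U_subset]] by (auto simp: supported_def z'_def)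
  have rz': "restrict_to (B - U) z' = z"
    using supportedD[OF w'] supportedD[OF zL] by (auto simp: restrict_to_def z'_def)
  have cz': "cobdry h B z' = (\<lambda>_. 0)" using dw' by (simp add: z'_def cobdry_diff fun_eq_iff)
  have "sphere_like h B m z'"
    unfolding sphere_like_def
  proof (intro conjI allI impI)
    show "supported (B \<inter> {F. card F = m}) z'"
      using z'B zm by (auto simp: supported_def z'_def w'_def)
    show "cobdry h B z' = (\<lambda>_. 0)" by fact
    show "\<nexists>b. supported B b \<and> cobdry h B b = z'"
    proof (rule notI, elim exE conjE)
      fix b assume b: "supported B b" "cobdry h B b = z'"
      have "cobdry h (B - U) (restrict_to (B - U) b) = z"
        by (rule cocycle_restrict_lower[OF upper b(1)])
          (use zL b(2) in \<open>simp_all add: restrict_to_def flip: rz'\<close>)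
      then show False using z supported_restrict_to unfolding sphere_like_def by blast
    qed
    fix c :: "'w set \<Rightarrow> 'k" assume c: "supported B c \<and> cobdry h B c = (\<lambda>_. 0)"
    have "cobdry h (B - U) (restrict_to (B - U) c) = (\<lambda>_. 0)"
      by (rule cocycle_restrict_lower[OF upper]) (use c in \<open>auto simp: supported_def\<close>)
    then obtain \<alpha> b where b: "supported (B - U) b" 
        "restrict_to (B - U) c = (\<lambda>F. \<alpha> * z F + cobdry h (B - U) b F)"
      using z supported_restrict_to unfolding sphere_like_def by metis
    define c' where "c' = (\<lambda>F. c F - \<alpha> * z' F)"
    have c': "supported B c'" using c z'B by (auto simp: supported_def c'_def)
    have cc': "cobdry h B c' = (\<lambda>_. 0)"
      using c cz' by (simp add: c'_def cobdry_diff cobdry_scale fun_eq_iff)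
    have bB: "supported B b" using b(1) by (rule supported_mono) auto
    have "cobdry h (B - U) b = restrict_to (B - U) c'"
    proof
      fix F
      show "cobdry h (B - U) b F = restrict_to (B - U) c' F"
        using fun_cong[OF b(2), of F] fun_cong[OF rz', of F]
        by (cases "F \<in> B - U") (auto simp: restrict_to_def c'_def cobdry_def)
    qed
    then have s: "supported U (\<lambda>F. c' F - cobdry h B b F)"
      by (rule cobdry_correct_lower[OF upper c' b(1)])
    obtain b' where b': "supported U b'" "cobdry h U b' = (\<lambda>F. c' F - cobdry h B b F)"
      using acyclic_familyD[OF ac s cocycle_correction[OF cc' bB s]] .
    have "c = (\<lambda>F. \<alpha> * z' F + cobdry h B (\<lambda>F. b F + b' F) F)"
      using b'(2) unfolding cobdry_upper_part[OF upper b'(1), symmetric]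
      by (auto simp: cobdry_add fun_eq_iff c'_def algebra_simps)
    moreover have "supported B (\<lambda>F. b F + b' F)"
      using supportedD[OF bB] supportedD[OF supported_mono[OF b'(1) U_subset]] by (auto simp: supported_def)
    ultimately show "\<exists>\<alpha> b. supported B b \<and> c = (\<lambda>F. \<alpha> * z' F + cobdry h B b F)" by blast
  qed
  then show ?thesis by blast
qed

end

text \<open>The situation left after all collapses: no set obtained by deleting a vertex belongs to
  the family, so the coboundary is zero.\<close>

lemma sphere_like_singleton:
  "sphere_like h {K} (card K) (\<lambda>F. if F = K then 1 else 0 :: 'k::field)"
proof -
  have sup: "b (K - {v}) = 0" if "supported {K} b" "v \<in> K" for b :: "'a set \<Rightarrow> 'k" and v
    using that by (auto intro!: supportedD)
  have zero: "cobdry h {K} b = (\<lambda>_. 0)" if "supported {K} b" for b :: "'a set \<Rightarrow> 'k"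
    using sup[OF that] by (auto simp: cobdry_def fun_eq_iff)
  show ?thesis
    unfolding sphere_like_def
  proof (intro conjI allI impI)
    show "supported ({K} \<inter> {F. card F = card K}) (\<lambda>F. if F = K then 1 else 0 :: 'k)"
      by (auto simp: supported_def)
    show "cobdry h {K} (\<lambda>F. if F = K then 1 else 0) = (\<lambda>_. 0 :: 'k)"
      by (rule zero) (auto simp: supported_def)
    show "\<nexists>b. supported {K} b \<and> cobdry h {K} b = (\<lambda>F. if F = K then 1 else 0 :: 'k)"
    proof (rule notI, elim exE conjE)
      fix b :: "'a set \<Rightarrow> 'k" assume "supported {K} b" "cobdry h {K} b = (\<lambda>F. if F = K then 1 else 0)"
      then show False using zero[of b] by (metis one_neq_zero)
    qed
    fix c :: "'a set \<Rightarrow> 'k" assume c: "supported {K} c \<and> cobdry h {K} c = (\<lambda>_. 0)"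
    have "supported {K} (\<lambda>_. 0 :: 'k)" by (simp add: supported_def)
    moreover have "c = (\<lambda>F. c K * (if F = K then 1 else 0) + cobdry h {K} (\<lambda>_. 0 :: 'k) F)"
      using c by (auto simp: supported_def)
    ultimately show "\<exists>\<alpha> b. supported {K} b \<and> c = (\<lambda>F. \<alpha> * (if F = K then 1 else 0) + cobdry h {K} b F)"
      by blast
  qed
qed

section \<open>Links in the independence complex\<close>

text \<open>\<open>transfer_edge\<close> joins the neighbourhoods of the two ends of a matching edge
  completely. With \<open>u = w\<close> it says that no vertex is adjacent to both ends, since there
  are no loops.\<close>

locale ordered_matching =
  fixes H :: "'v ugraph" and d\<^sub>0 :: nat and x y :: "nat \<Rightarrow> 'v"
  assumes simple: "simple_graph H"
    and verts_eq: "verts H = x ` {1..d\<^sub>0} \<union> y ` {1..d\<^sub>0}"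
    and inj_x: "inj_on x {1..d\<^sub>0}" and inj_y: "inj_on y {1..d\<^sub>0}"
    and disjoint: "x ` {1..d\<^sub>0} \<inter> y ` {1..d\<^sub>0} = {}"
    and matched: "i \<in> {1..d\<^sub>0} \<Longrightarrow> {x i, y i} \<in> edges H"
    and transfer_edge: "i \<in> {1..d\<^sub>0} \<Longrightarrow> {u, x i} \<in> edges H \<Longrightarrow> {w, y i} \<in> edges H \<Longrightarrow> {u, w} \<in> edges H"
    and y_independent: "i \<in> {1..d\<^sub>0} \<Longrightarrow> k \<in> {1..d\<^sub>0} \<Longrightarrow> {y i, y k} \<notin> edges H"
    and ordered: "i \<in> {1..d\<^sub>0} \<Longrightarrow> k \<in> {1..d\<^sub>0} \<Longrightarrow> {x i, y k} \<in> edges H \<Longrightarrow> i \<le> k"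
begin

abbreviation adj :: "'v \<Rightarrow> 'v \<Rightarrow> bool" where "adj u v \<equiv> {u, v} \<in> edges H"

lemma adj_sym: "adj u v \<Longrightarrow> adj v u"
  by (simp add: insert_commute)

lemma adj_verts: "adj u v \<Longrightarrow> u \<in> verts H \<and> v \<in> verts H \<and> u \<noteq> v"
  using simple unfolding simple_graph_def by (metis doubleton_eq_iff)

lemma not_adj_self [simp]: "{u} \<notin> edges H"
  using adj_verts[of u u] by auto

lemma edge_cases:
  assumes "e \<in> edges H"
  obtains u v where "e = {u, v}" "adj u v"
  using assms simple unfolding simple_graph_def by metis

lemma vertex_cases:
  assumes "u \<in> verts H"
  obtains i where "i \<in> {1..d\<^sub>0}" "u = x i" | i where "i \<in> {1..d\<^sub>0}" "u = y i"
  using assms unfolding verts_eq by blast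

lemma x_verts [simp]: "i \<in> {1..d\<^sub>0} \<Longrightarrow> x i \<in> verts H" and y_verts [simp]: "i \<in> {1..d\<^sub>0} \<Longrightarrow> y i \<in> verts H"
  by (auto simp: verts_eq)

lemma x_neq_y: "i \<in> {1..d\<^sub>0} \<Longrightarrow> k \<in> {1..d\<^sub>0} \<Longrightarrow> x i \<noteq> y k"
  using disjoint by blast

lemma x_eq_iff: "i \<in> {1..d\<^sub>0} \<Longrightarrow> k \<in> {1..d\<^sub>0} \<Longrightarrow> x i = x k \<longleftrightarrow> i = k"
  and y_eq_iff: "i \<in> {1..d\<^sub>0} \<Longrightarrow> k \<in> {1..d\<^sub>0} \<Longrightarrow> y i = y k \<longleftrightarrow> i = k"
  using inj_x inj_y by (auto dest: inj_onD)

lemma finite_verts: "finite (verts H)"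
  using simple by (simp add: simple_graph_def)

lemma independent_iff: "independent_set H A \<longleftrightarrow> A \<subseteq> verts H \<and> (\<forall>u\<in>A. \<forall>v\<in>A. \<not> adj u v)"
proof
  assume r: "A \<subseteq> verts H \<and> (\<forall>u\<in>A. \<forall>v\<in>A. \<not> adj u v)"
  then show "independent_set H A"
    unfolding independent_set_def by (metis edge_cases insert_subset)
qed (auto simp: independent_set_def)

lemma y_neighbour:
  assumes "s \<in> {1..d\<^sub>0}" "adj u (y s)"
  obtains r where "r \<in> {1..d\<^sub>0}" "u = x r" "r \<le> s"
proof -
  have "u \<in> verts H" using adj_verts[OF assms(2)] by simp
  then show ?thesis
    by (cases rule: vertex_cases) (use assms y_independent ordered that in blast)+
qed

definition link_verts :: "'v set \<Rightarrow> 'v set" where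
  "link_verts A = {u \<in> verts H. u \<notin> A \<and> (\<forall>w\<in>A. \<not> adj u w)}"

text \<open>The independence complex induced on \<open>link_verts A\<close> is then the boundary of the cross-polytope
  with the antipodal pairs \<open>{x s, y s}\<close> for \<open>s \<in> T\<close>.\<close>

definition cross_link :: "'v set \<Rightarrow> nat set \<Rightarrow> bool" where
  "cross_link A T \<longleftrightarrow> independent_set H A \<and> T \<subseteq> {1..d\<^sub>0} \<and> link_verts A = x ` T \<union> y ` T \<and>
     (\<forall>s\<in>T. \<forall>u\<in>link_verts A. adj (x s) u \<longrightarrow> u = y s)"

text \<open>In the case \<open>fold\<close> the vertex \<open>y s\<close> is a leaf of the graph
  induced on the link, and the neighbourhood of \<open>w\<close> is contained in that of
  \<open>x s\<close>. These two facts provide the two toggles used later: the leaf may be added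
  whenever \<open>x s\<close> is absent, and \<open>w\<close> whenever \<open>x s\<close> is
  present.\<close>

lemma cross_link_cases:
  assumes A: "independent_set H A" and not_cross: "\<nexists>T. cross_link A T"
  obtains (isolated) u where "u \<in> link_verts A" "\<forall>v\<in>link_verts A. \<not> adj u v"
  | (fold) s w where "s \<in> {1..d\<^sub>0}" "x s \<in> link_verts A" "y s \<in> link_verts A" "w \<in> link_verts A"
      "\<forall>v\<in>link_verts A. adj (y s) v \<longrightarrow> v = x s" "w \<noteq> x s" "w \<noteq> y s" "\<not> adj w (x s)"
      "\<forall>v. adj w v \<longrightarrow> adj v (x s)"
proof (cases "\<exists>u\<in>link_verts A. \<forall>v\<in>link_verts A. \<not> adj u v")
  case True
  then show ?thesis using isolated by blast
next
  case False
  then have nb: "\<exists>v\<in>link_verts A. adj u v" if "u \<in> link_verts A" for u using that by blast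
  have Aind: "\<And>u v. u \<in> A \<Longrightarrow> v \<in> A \<Longrightarrow> \<not> adj u v" using A by (auto simp: independent_iff)
  \<comment> \<open>Were \<open>y s\<close> excluded by a neighbour in \<open>A\<close>, then
    \<open>transfer_edge\<close> would make every neighbour of \<open>x s\<close> in the link
    adjacent to that vertex of \<open>A\<close>.\<close>
  have mate: "y s \<in> link_verts A" if s: "s \<in> {1..d\<^sub>0}" "x s \<in> link_verts A" for s
  proof (rule ccontr)
    assume "y s \<notin> link_verts A"
    moreover have "y s \<notin> A" using s matched by (auto simp: link_verts_def)
    ultimately obtain w where w: "w \<in> A" "adj (y s) w" using s by (auto simp: link_verts_def)
    obtain v where v: "v \<in> link_verts A" "adj (x s) v" using nb[OF s(2)] by blast
    have "adj v w" using transfer_edge[OF s(1)] v(2) w(2) adj_sym by blast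
    then show False using v(1) w(1) by (auto simp: link_verts_def)
  qed
  have mate': "x s \<in> link_verts A" if s: "s \<in> {1..d\<^sub>0}" "y s \<in> link_verts A" for s
  proof (rule ccontr)
    assume "x s \<notin> link_verts A"
    moreover have "x s \<notin> A" using s matched adj_sym by (auto simp: link_verts_def)
    ultimately obtain w where w: "w \<in> A" "adj (x s) w" using s by (auto simp: link_verts_def)
    obtain v where v: "v \<in> link_verts A" "adj (y s) v" using nb[OF s(2)] by blast
    have "adj w v" using transfer_edge[OF s(1)] v(2) w(2) adj_sym by blast
    then show False using v(1) w(1) adj_sym by (auto simp: link_verts_def)
  qed
  define T where "T = {s \<in> {1..d\<^sub>0}. x s \<in> link_verts A}"
  have TW: "link_verts A = x ` T \<union> y ` T"
  proof
    show "link_verts A \<subseteq> x ` T \<union> y ` T"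
    proof
      fix u assume u: "u \<in> link_verts A"
      then have "u \<in> verts H" by (simp add: link_verts_def)
      then show "u \<in> x ` T \<union> y ` T"
        by (cases rule: vertex_cases) (use u mate' in \<open>auto simp: T_def\<close>)
    qed
  qed (use mate in \<open>auto simp: T_def\<close>)
  define Q where "Q = (\<lambda>s. s \<in> T \<and> (\<exists>u\<in>link_verts A. adj (x s) u \<and> u \<noteq> y s))"
  have "\<exists>s. Q s"
  proof (rule ccontr)
    assume "\<nexists>s. Q s"
    then have "\<forall>s\<in>T. \<forall>u\<in>link_verts A. adj (x s) u \<longrightarrow> u = y s" by (auto simp: Q_def)
    moreover have "T \<subseteq> {1..d\<^sub>0}" by (auto simp: T_def)
    ultimately have "cross_link A T" unfolding cross_link_def using A TW by blast
    then show False using not_cross by blast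
  qed
  \<comment> \<open>The least index violating the cross-polytope condition. A neighbour of
    \<open>y s\<close> has the form \<open>x r\<close> with \<open>r \<le> s\<close>, and
    \<open>r < s\<close> would make \<open>r\<close> a smaller violation; this turns
    \<open>y s\<close> into a leaf.\<close>
  then obtain s where s: "Q s" and least: "\<And>r. r < s \<Longrightarrow> \<not> Q r"
    using exists_least_iff[of Q] by auto
  have sT: "s \<in> {1..d\<^sub>0}" "x s \<in> link_verts A" and ys: "y s \<in> link_verts A" using s mate by (auto simp: Q_def T_def)
  obtain u where u: "u \<in> link_verts A" "adj (x s) u" "u \<noteq> y s" using s by (auto simp: Q_def)
  have leaf: "\<forall>v\<in>link_verts A. adj (y s) v \<longrightarrow> v = x s"
  proof (intro ballI impI)
    fix v assume v: "v \<in> link_verts A" "adj (y s) v"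
    then obtain r where r: "r \<in> {1..d\<^sub>0}" "v = x r" "r \<le> s"
      using y_neighbour[OF sT(1)] adj_sym by metis
    have "\<not> r < s"
    proof
      assume "r < s"
      have "Q r" unfolding Q_def using r v ys \<open>r < s\<close> y_eq_iff[OF sT(1) r(1)] adj_sym
        by (auto simp: T_def intro!: bexI[of _ "y s"])
      then show False using least \<open>r < s\<close> by blast
    qed
    then show "v = x s" using r by simp
  qed
  have "u \<in> verts H" using u by (simp add: link_verts_def)
  then show ?thesis
  proof (cases rule: vertex_cases)
    \<comment> \<open>The vertex \<open>w\<close> is the partner of the additional neighbour
      \<open>u\<close> of \<open>x s\<close>: \<open>transfer_edge\<close> at this pair makes every
      neighbour of \<open>w\<close> a neighbour of \<open>x s\<close>.\<close>
    case (1 t)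
    have ts: "t \<noteq> s" using u(2) 1 by auto
    show ?thesis
    proof (rule fold[OF sT ys _ leaf])
      show "y t \<in> link_verts A" using mate 1 u by simp
      show "y t \<noteq> x s" using x_neq_y sT 1 by metis
      show "y t \<noteq> y s" using ts 1 sT y_eq_iff by blast
      show "\<not> adj (y t) (x s)"
        using transfer_edge[OF 1(1), of "x s" "x s"] u(2) 1(2) adj_sym by auto
      show "\<forall>v. adj (y t) v \<longrightarrow> adj v (x s)"
        using transfer_edge[OF 1(1), of "x s"] u(2) 1(2) adj_sym by metis
    qed
  next
    case (2 t)
    have ts: "t \<noteq> s" using u(3) 2 by auto
    show ?thesis
    proof (rule fold[OF sT ys _ leaf])
      show "x t \<in> link_verts A" using mate' 2 u by simp
      show "x t \<noteq> y s" using x_neq_y sT 2 by metis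
      show "x t \<noteq> x s" using ts 2 sT x_eq_iff by blast
      show "\<not> adj (x t) (x s)"
        using transfer_edge[OF 2(1), of "x s" "x s"] u(2) 2(2) adj_sym by auto
      show "\<forall>v. adj (x t) v \<longrightarrow> adj v (x s)"
        using transfer_edge[OF 2(1), of _ "x s"] u(2) 2(2) adj_sym by metis
    qed
  qed
qed

end

section \<open>Set families in the blown-up graph\<close>

locale blown_up_matching = ordered_matching H d\<^sub>0 x y
  for H :: "'v ugraph" and d\<^sub>0 :: nat and x y :: "nat \<Rightarrow> 'v" +
  fixes n :: "nat \<Rightarrow> nat" and h :: "'v \<times> nat \<Rightarrow> nat"
  assumes mult_pos: "i \<in> {1..d\<^sub>0} \<Longrightarrow> n i > 0"
    and inj_h: "inj_on h (verts (blowup H d\<^sub>0 x y n))"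
begin

abbreviation G :: "('v \<times> nat) ugraph" where "G \<equiv> blowup H d\<^sub>0 x y n"

lemma verts_G: "verts G = (\<Union>i\<in>{1..d\<^sub>0}. {x i, y i} \<times> {1..n i})"
  by (simp add: blowup_def Let_def)

lemma edges_G: "edges G = {{p, q} | p q. p \<in> verts G \<and> q \<in> verts G \<and> adj (fst p) (fst q)}"
  by (auto simp: blowup_def Let_def)

lemma finite_verts_G: "finite (verts G)"
  by (auto simp: verts_G)

lemma fst_verts_G: "p \<in> verts G \<Longrightarrow> fst p \<in> verts H"
  by (auto simp: verts_G)

lemma first_copy: "u \<in> verts H \<Longrightarrow> (u, 1) \<in> verts G"
  using mult_pos by (auto simp: verts_G verts_eq Suc_le_eq)

lemma independent_G_iff:
  "independent_set G A \<longleftrightarrow> A \<subseteq> verts G \<and> (\<forall>p\<in>A. \<forall>q\<in>A. \<not> adj (fst p) (fst q))"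
proof
  assume "independent_set G A"
  then have A: "A \<subseteq> verts G" "\<And>e. e \<in> edges G \<Longrightarrow> \<not> e \<subseteq> A" by (auto simp: independent_set_def)
  have "\<not> adj (fst p) (fst q)" if "p \<in> A" "q \<in> A" for p q
  proof
    assume "adj (fst p) (fst q)"
    then have "{p, q} \<in> edges G"
      using that A(1) unfolding edges_G by blast
    then show False using A(2)[of "{p, q}"] that by auto
  qed
  then show "A \<subseteq> verts G \<and> (\<forall>p\<in>A. \<forall>q\<in>A. \<not> adj (fst p) (fst q))" using A(1) by blast
next
  assume r: "A \<subseteq> verts G \<and> (\<forall>p\<in>A. \<forall>q\<in>A. \<not> adj (fst p) (fst q))"
  have "\<not> e \<subseteq> A" if e: "e \<in> edges G" for e
  proof -
    obtain p q where "e = {p, q}" "adj (fst p) (fst q)" using e unfolding edges_G by blast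
    then show ?thesis using r by blast
  qed
  then show "independent_set G A" using r by (simp add: independent_set_def)
qed

text \<open>With \<open>N\<close> and \<open>P\<close> the negative and the positive support of an
  exponent, this indexes the nonzero terms of the Cech complex in that multidegree.\<close>

definition block :: "('v \<times> nat) set \<Rightarrow> ('v \<times> nat) set \<Rightarrow> ('v \<times> nat) set set" where
  "block N P = {F. N \<subseteq> F \<and> independent_set G (F \<union> P)}"

definition preimage :: "'v set \<Rightarrow> ('v \<times> nat) set" where
  "preimage A = {p \<in> verts G. fst p \<in> A}"

lemma fin_block: "F \<in> block N P \<Longrightarrow> finite F \<and> inj_on h F"
  unfolding block_def independent_G_iff
  by (auto intro: finite_subset[OF _ finite_verts_G] inj_on_subset[OF inj_h])

lemma convex_block: "convex_family (block N P)"
  unfolding convex_family_def block_def independent_G_iff by blast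

lemma toggle:
  assumes "B \<subseteq> Pow (verts G)" "v \<in> verts G" "\<And>F. F \<in> B \<Longrightarrow> insert v F \<in> B" "\<And>F. F \<in> B \<Longrightarrow> F - {v} \<in> B"
  shows "acyclic_family TYPE('k::field) h B"
proof (rule acyclic_family_toggle[OF _ assms(3,4)])
  show "\<forall>F\<in>B. finite F \<and> inj_on h (insert v F)"
  proof
    fix F assume "F \<in> B"
    then have "insert v F \<subseteq> verts G" using assms(1,2) by auto
    then have "finite (insert v F)" "inj_on h (insert v F)"
      using finite_subset[OF _ finite_verts_G] inj_on_subset[OF inj_h] by blast+
    then show "finite F \<and> inj_on h (insert v F)" by simp
  qed
qed

lemma block_subset: "block N P \<subseteq> Pow (verts G)"
  by (auto simp: block_def independent_G_iff)

lemma link_neighbour: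
  assumes "F \<in> block (preimage A) {}" "p \<in> F" "A \<subseteq> verts H"
  shows "fst p \<in> A \<or> fst p \<in> link_verts A"
proof -
  have "\<not> adj (fst p) w" if "w \<in> A" for w
  proof -
    have "(w, 1) \<in> preimage A" using that assms(3) first_copy by (auto simp: preimage_def)
    then show ?thesis using assms(1,2) unfolding block_def independent_G_iff by force
  qed
  moreover have "fst p \<in> verts H"
    by (rule fst_verts_G) (use assms(1,2) in \<open>auto simp: block_def independent_G_iff\<close>)
  ultimately show ?thesis by (auto simp: link_verts_def)
qed

lemma insert_block:
  assumes "F \<in> block N {}" "p \<in> verts G" "\<And>q. q \<in> F \<Longrightarrow> \<not> adj (fst p) (fst q)"
  shows "insert p F \<in> block N {}"
  using assms adj_sym unfolding block_def independent_G_iff by auto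

lemma remove_block:
  assumes "F \<in> block N P" "p \<notin> N"
  shows "F - {p} \<in> block N P"
  using assms unfolding block_def independent_G_iff by auto

lemma link_nadj: "u \<in> link_verts A \<Longrightarrow> w \<in> A \<Longrightarrow> \<not> adj u w"
  by (simp add: link_verts_def)

text \<open>Toggling a vertex outside \<open>N\<close> only requires that it be compatible with
  every member of the family. When no single vertex has this property, the family is split by the
  presence of \<open>x s\<close>, and each half has a toggle of its own.\<close>

lemma acyclic_block:
  assumes disj: "N \<inter> P = {}" and non: "\<nexists>A T. P = {} \<and> N = preimage A \<and> cross_link A T"
  shows "acyclic_family TYPE('k::field) h (block N P)"
proof (cases "P = {}")
  case False
  then obtain v where v: "v \<in> P" by blast
  show ?thesis
  proof (cases "v \<in> verts G")
    case True
    show ?thesis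
    proof (rule toggle[OF block_subset True])
      fix F assume F: "F \<in> block N P"
      \<comment> \<open>Independence only concerns \<open>F \<union> P\<close>, which already
        contains \<open>v\<close>; deletion is allowed because \<open>v\<close> is not in
        \<open>N\<close>.\<close>
      have "insert v F \<union> P = F \<union> P" "F - {v} \<union> P = F \<union> P" using v by auto
      then show "insert v F \<in> block N P" "F - {v} \<in> block N P"
        using F disj v by (auto simp: block_def)
    qed
  next
    case False
    then have "block N P = {}" using v by (auto simp: block_def independent_G_iff)
    then show ?thesis by (auto simp: acyclic_family_def supported_def cobdry_def fun_eq_iff)
  qed
next
  case P: True
  show ?thesis
  proof (cases "block N P = {}")
    case True
    then show ?thesis by (auto simp: acyclic_family_def supported_def cobdry_def fun_eq_iff)
  next
    case False
    then have N: "independent_set G N"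
      unfolding block_def independent_G_iff P by blast
    define A where "A = fst ` N"
    have A: "independent_set H A"
      using N fst_verts_G by (fastforce simp: A_def independent_G_iff independent_iff)
    have AV: "A \<subseteq> verts H" using A by (simp add: independent_iff)
    have NA: "N \<subseteq> preimage A" using N by (auto simp: A_def preimage_def independent_G_iff)
    show ?thesis
    proof (cases "N = preimage A")
      case False
      then obtain p where p: "p \<in> verts G" "fst p \<in> A" "p \<notin> N" using NA by (auto simp: preimage_def)
      then obtain q where q: "q \<in> N" "fst q = fst p" by (auto simp: A_def)
      \<comment> \<open>Copies of one vertex have the same neighbours, so \<open>p\<close> is
        compatible with every \<open>F\<close> containing its twin \<open>q\<close>.\<close>
      have "acyclic_family TYPE('k::field) h (block N {})"
      proof (rule toggle[OF block_subset p(1)])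
        fix F assume F: "F \<in> block N {}"
        show "insert p F \<in> block N {}"
          by (rule insert_block[OF F p(1)]) (use F q in \<open>auto simp: block_def independent_G_iff simp flip: q(2)\<close>)
        show "F - {p} \<in> block N {}" using remove_block[OF F p(3)] .
      qed
      then show ?thesis by (simp add: P)
    next
      case True
      then have not_cross: "\<nexists>T. cross_link A T" using non P by blast
      have notN: "(u, 1) \<in> verts G" "(u, 1) \<notin> N" if "u \<in> link_verts A" for u
        using that first_copy by (auto simp: True preimage_def link_verts_def)
      have "acyclic_family TYPE('k::field) h (block N {})"
        using A not_cross
      proof (cases rule: cross_link_cases)
        case (isolated u)
        show ?thesis
        proof (rule toggle[OF block_subset notN(1)[OF isolated(1)]])
          fix F assume F: "F \<in> block N {}"
          show "F - {(u, 1)} \<in> block N {}" using remove_block[OF F notN(2)[OF isolated(1)]] .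
          show "insert (u, 1) F \<in> block N {}"
          proof (rule insert_block[OF F notN(1)[OF isolated(1)]])
            fix q assume "q \<in> F"
            then have "fst q \<in> A \<or> fst q \<in> link_verts A" using link_neighbour F AV True by blast
            then show "\<not> adj (fst (u, 1)) (fst q)" using isolated link_nadj by auto
          qed
        qed
      next
        case (fold s w)
        \<comment> \<open>Sets without copies of \<open>x s\<close> are toggled by a copy of \<open>y s\<close>, the others by a copy of \<open>w\<close>.\<close>
        define U where "U = {F \<in> block N {}. \<exists>p\<in>F. fst p = x s}"
        interpret family_split h "block N {}" U
          using convex_block fin_block by unfold_locales (auto simp: U_def upper_part_def)
        show ?thesis
        proof (rule acyclic_family_union)
          show "acyclic_family TYPE('k) h (block N {} - U)"
          proof (rule toggle[OF _ notN(1)[OF fold(3)]])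
            show "block N {} - U \<subseteq> Pow (verts G)" using block_subset by blast
            fix F assume F: "F \<in> block N {} - U"
            show "F - {(y s, 1)} \<in> block N {} - U"
              using F remove_block[OF _ notN(2)[OF fold(3)]] by (auto simp: U_def)
            have "insert (y s, 1) F \<in> block N {}"
            proof (rule insert_block[OF _ notN(1)[OF fold(3)]])
              show "F \<in> block N {}" using F by simp
              fix q assume q: "q \<in> F"
              then have "fst q \<in> A \<or> fst q \<in> link_verts A" "fst q \<noteq> x s" 
                using F link_neighbour[OF _ q AV] True by (auto simp: U_def)
              then show "\<not> adj (fst (y s, 1)) (fst q)" using fold(5) link_nadj[OF fold(3)] by auto
            qed
            then show "insert (y s, 1) F \<in> block N {} - U" 
              using F x_neq_y[OF fold(1) fold(1)] by (auto simp: U_def)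
          qed
          show "acyclic_family TYPE('k) h U"
          proof (rule toggle[OF _ notN(1)[OF fold(4)]])
            show "U \<subseteq> Pow (verts G)" using block_subset U_subset by blast
            fix F assume F: "F \<in> U"
            then obtain p where p: "p \<in> F" "fst p = x s" and FB: "F \<in> block N {}" by (auto simp: U_def)
            show "F - {(w, 1)} \<in> U"
              using p fold(6) remove_block[OF FB notN(2)[OF fold(4)]] by (auto simp: U_def)
            have "insert (w, 1) F \<in> block N {}"
            proof (rule insert_block[OF FB notN(1)[OF fold(4)]])
              fix q assume q: "q \<in> F"
              then have "\<not> adj (fst q) (x s)" using p FB by (auto simp: block_def independent_G_iff simp flip: p(2))
              then show "\<not> adj (fst (w, 1)) (fst q)" using fold(9) by auto
            qed
            then show "insert (w, 1) F \<in> U" using p by (auto simp: U_def)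
          qed
        qed
      qed
      then show ?thesis by (simp add: P)
    qed
  qed
qed

text \<open>A discrete Morse argument: the single surviving set consists of all copies of the
  vertices of \<open>A\<close> and the first copy of each \<open>x s\<close>, and its size is the
  degree of the class. The multiplicities of the collapsed pairs do not enter the added
  \<open>card T\<close>, since a simplex on any positive number of copies is contractible.\<close>

lemma sphere_like_block:
  assumes cross: "cross_link A T"
  shows "\<exists>z :: ('v \<times> nat) set \<Rightarrow> 'k::field. sphere_like h (block (preimage A) {}) (card (preimage A) + card T) z"
proof -
  define N where "N = preimage A"
  have A: "independent_set H A" and T: "T \<subseteq> {1..d\<^sub>0}" and L: "link_verts A = x ` T \<union> y ` T"
    and L': "\<And>s u. s \<in> T \<Longrightarrow> u \<in> link_verts A \<Longrightarrow> adj (x s) u \<Longrightarrow> u = y s"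
    using cross unfolding cross_link_def by blast+
  have AV: "A \<subseteq> verts H" using A by (simp add: independent_iff)
  have finT: "finite T" using T finite_subset by blast
  have inlink: "x s \<in> link_verts A" "y s \<in> link_verts A" if "s \<in> T" for s using that L by auto
  have notN: "(u, 1) \<in> verts G" "(u, 1) \<notin> N" if "u \<in> link_verts A" for u
    using that first_copy by (auto simp: N_def preimage_def link_verts_def)
  \<comment> \<open>The pairs \<open>x s\<close>, \<open>y s\<close> are collapsed one after the other: \<open>S\<close> is the set of those already treated.\<close>
  define R where "R = (\<lambda>S. {F \<in> block N {}. \<forall>s\<in>S. {p \<in> F. fst p \<in> {x s, y s}} = {(x s, 1)}})"
  have R_sub: "R S \<subseteq> Pow (verts G)" for S using block_subset by (auto simp: R_def)
  have convR: "convex_family (R S)" for S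
    unfolding convex_family_def
  proof (intro ballI allI impI, elim conjE)
    fix C D E assume CD: "C \<in> R S" "D \<in> R S" and E: "C \<subseteq> E" "E \<subseteq> D"
    then have "E \<in> block N {}" using convex_block unfolding convex_family_def R_def by blast
    moreover have "{p \<in> E. fst p \<in> {x s, y s}} = {(x s, 1)}" if "s \<in> S" for s
    proof -
      have "{p \<in> C. fst p \<in> {x s, y s}} = {(x s, 1)}" "{p \<in> D. fst p \<in> {x s, y s}} = {(x s, 1)}"
        using CD that unfolding R_def by blast+
      then show ?thesis using E by blast
    qed
    ultimately show "E \<in> R S" by (simp add: R_def)
  qed
  have other: "fst p \<noteq> x r \<and> fst p \<noteq> y r" if "r \<in> T" "s \<in> T" "r \<noteq> s" "fst p = x s \<or> fst p = y s" for r s and p :: "'v \<times> nat"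
  proof -
    have "r \<in> {1..d\<^sub>0}" "s \<in> {1..d\<^sub>0}" using that T by auto
    then have "x s \<noteq> x r" "x s \<noteq> y r" "y s \<noteq> x r" "y s \<noteq> y r"
      using that(3) x_neq_y[of s r] x_neq_y[of r s] x_eq_iff[of s r] y_eq_iff[of s r] by metis+
    then show ?thesis using that(4) by auto
  qed
  have keep: "insert p F \<in> R S" "F - {p} \<in> R S"
    if "F \<in> R S" "S \<subseteq> T" "s \<in> T - S" "fst p = x s \<or> fst p = y s" "insert p F \<in> block N {}" "p \<notin> N" for F S s p
  proof -
    have ne: "fst p \<noteq> x r \<and> fst p \<noteq> y r" if "r \<in> S" for r
      by (rule other[of r s]) (use that \<open>S \<subseteq> T\<close> \<open>s \<in> T - S\<close> \<open>fst p = x s \<or> fst p = y s\<close> in auto)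
    have e: "{q \<in> insert p F. fst q \<in> {x r, y r}} = {q \<in> F. fst q \<in> {x r, y r}}"
       "{q \<in> F - {p}. fst q \<in> {x r, y r}} = {q \<in> F. fst q \<in> {x r, y r}}" if "r \<in> S" for r
      using ne[OF that] by auto
    have f: "{q \<in> F. fst q \<in> {x r, y r}} = {(x r, 1)}" if "r \<in> S" for r
      using \<open>F \<in> R S\<close> that unfolding R_def by blast
    show "insert p F \<in> R S"
      unfolding R_def mem_Collect_eq using \<open>insert p F \<in> block N {}\<close> e(1) f by simp
    have "F - {p} \<in> block N {}" using \<open>F \<in> R S\<close> remove_block[OF _ \<open>p \<notin> N\<close>] by (simp add: R_def)
    then show "F - {p} \<in> R S"
      unfolding R_def mem_Collect_eq using e(2) f by simp
  qed
  have step: "\<exists>z :: ('v \<times> nat) set \<Rightarrow> 'k. sphere_like h (R S) m z"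
    if z: "\<exists>z :: ('v \<times> nat) set \<Rightarrow> 'k. sphere_like h (R (insert s S)) m z" and S: "S \<subseteq> T" "s \<in> T" "s \<notin> S" for S s m
  proof -
    have s0: "s \<in> {1..d\<^sub>0}" using T S by auto
    \<comment> \<open>A copy of \<open>y s\<close> toggles \<open>R S - U\<close>, the first copy of \<open>x s\<close> toggles \<open>U'\<close>.\<close>
    define U where "U = {F \<in> R S. \<exists>p\<in>F. fst p = x s}"
    define U' where "U' = {F \<in> U. \<exists>p\<in>F. fst p = x s \<and> p \<noteq> (x s, 1)}"
    have convU: "convex_family U"
      using convR[of S] unfolding convex_family_def U_def by blast
    interpret O: family_split h "R S" U
      using convR fin_block by unfold_locales (auto simp: U_def R_def upper_part_def)
    interpret I: family_split h U U'
      using convU fin_block by unfold_locales (auto simp: U'_def U_def R_def upper_part_def)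
    have ac1: "acyclic_family TYPE('k) h (R S - U)"
    proof (rule toggle[OF _ notN(1)[OF inlink(2)[OF S(2)]]])
      show "R S - U \<subseteq> Pow (verts G)" using R_sub by blast
      fix F assume F: "F \<in> R S - U"
      then have FB: "F \<in> block N {}" by (simp add: R_def)
      have ins: "insert (y s, 1) F \<in> block N {}"
      proof (rule insert_block[OF FB notN(1)[OF inlink(2)[OF S(2)]]])
        fix q assume q: "q \<in> F"
        then have ne: "fst q \<noteq> x s" using F by (auto simp: U_def)
        have "fst q \<in> A \<or> fst q \<in> link_verts A" using link_neighbour[OF FB[unfolded N_def] q AV] .
        then show "\<not> adj (fst (y s, 1)) (fst q)"
        proof
          assume "fst q \<in> link_verts A"
          moreover then obtain t where "t \<in> T" "fst q = x t \<or> fst q = y t" using L by auto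
          ultimately show ?thesis
            using L'[of t "y s"] inlink(2)[OF S(2)] ne y_eq_iff[OF s0, of t] y_independent[OF s0, of t] T adj_sym by auto
        qed (use link_nadj[OF inlink(2)[OF S(2)]] in auto)
      qed
      show "insert (y s, 1) F \<in> R S - U" "F - {(y s, 1)} \<in> R S - U"
        using keep[of F S s "(y s, 1)"] F S ins notN(2)[OF inlink(2)[OF S(2)]] x_neq_y[OF s0 s0] by (auto simp: U_def)
    qed
    have ac2: "acyclic_family TYPE('k) h U'"
    proof (rule toggle[OF _ notN(1)[OF inlink(1)[OF S(2)]]])
      show "U' \<subseteq> Pow (verts G)" using R_sub by (auto simp: U'_def U_def)
      fix F assume F: "F \<in> U'"
      then have FB: "F \<in> block N {}" and FR: "F \<in> R S" by (auto simp: U'_def U_def R_def)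
      obtain p where p: "p \<in> F" "fst p = x s" "p \<noteq> (x s, 1)" using F by (auto simp: U'_def)
      have ins: "insert (x s, 1) F \<in> block N {}"
        by (rule insert_block[OF FB notN(1)[OF inlink(1)[OF S(2)]]])
          (use FB p in \<open>auto simp: block_def independent_G_iff simp flip: p(2)\<close>)
      show "insert (x s, 1) F \<in> U'" "F - {(x s, 1)} \<in> U'"
        using keep[of F S s "(x s, 1)"] FR S ins notN(2)[OF inlink(1)[OF S(2)]] p by (auto simp: U'_def U_def)
    qed
    have eq: "U - U' = R (insert s S)"
    proof (intro equalityI subsetI)
      fix F assume F: "F \<in> U - U'"
      then have FR: "F \<in> R S" by (simp add: U_def)
      have xs: "\<And>p. p \<in> F \<Longrightarrow> fst p = x s \<Longrightarrow> p = (x s, 1)" and ex: "(x s, 1) \<in> F"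
        using F by (auto simp: U_def U'_def)
      have "fst p \<noteq> y s" if "p \<in> F" for p
      proof
        assume py: "fst p = y s"
        have "\<forall>p\<in>F. \<forall>q\<in>F. \<not> adj (fst p) (fst q)"
          using FR unfolding R_def block_def independent_G_iff by blast
        from this[rule_format, OF ex that] show False using matched[OF s0] by (simp add: py)
      qed
      then have "{p \<in> F. fst p \<in> {x s, y s}} \<subseteq> {(x s, 1)}" using xs by blast
      then have "{p \<in> F. fst p \<in> {x s, y s}} = {(x s, 1)}" using ex by auto
      then show "F \<in> R (insert s S)" using FR unfolding R_def by blast
    next
      fix F assume F: "F \<in> R (insert s S)"
      then have FR: "F \<in> R S" and e: "{p \<in> F. fst p \<in> {x s, y s}} = {(x s, 1)}" unfolding R_def by blast+
      have xs: "p = (x s, 1)" if "p \<in> F" "fst p = x s" for p 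
        using that e by (metis (mono_tags, lifting) insertI1 mem_Collect_eq singletonD)
      have ex: "(x s, 1) \<in> F" using e by auto
      then have "\<exists>p\<in>F. fst p = x s" by force
      then show "F \<in> U - U'" using FR xs by (auto simp: U_def U'_def)
    qed
    \<comment> \<open>Put back sets from the inside out: those with a further copy of
      \<open>x s\<close> form an acyclic subcomplex of the complex of \<open>U\<close>, and those
      without any copy of \<open>x s\<close> an acyclic quotient of the complex of
      \<open>R S\<close>.\<close>
    obtain z :: "('v \<times> nat) set \<Rightarrow> 'k" where "sphere_like h (U - U') m z" using z eq by auto
    from I.sphere_like_lower[OF ac2 this] obtain z' :: "('v \<times> nat) set \<Rightarrow> 'k" where "sphere_like h U m z'" by blast
    from O.sphere_like_upper[OF ac1 this] show ?thesis by blast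
  qed
  define K where "K = N \<union> (\<lambda>s. (x s, 1)) ` T"
  have base: "R T = {K}"
  proof (intro equalityI subsetI)
    fix F assume F: "F \<in> R T"
    then have FB: "F \<in> block N {}" by (simp add: R_def)
    have e: "{p \<in> F. fst p \<in> {x s, y s}} = {(x s, 1)}" if "s \<in> T" for s
      using F that unfolding R_def by blast
    have "F = K"
    proof
      show "K \<subseteq> F" using FB e by (auto simp: K_def block_def)
      show "F \<subseteq> K"
      proof
        fix p assume p: "p \<in> F"
        then have "fst p \<in> A \<or> fst p \<in> link_verts A" using link_neighbour[OF FB[unfolded N_def] _ AV] by blast
        then show "p \<in> K"
        proof
          assume "fst p \<in> A"
          then show ?thesis using p FB by (auto simp: K_def N_def preimage_def block_def independent_G_iff)
        next
          assume "fst p \<in> link_verts A"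
          then obtain s where s: "s \<in> T" "fst p \<in> {x s, y s}" using L by auto
          then have "p \<in> {(x s, 1)}" using e[OF s(1)] p by blast
          then show ?thesis using s by (auto simp: K_def)
        qed
      qed
    qed
    then show "F \<in> {K}" by simp
  next
    fix F assume "F \<in> {K}"
    then have F: "F = K" by simp
    have KB: "K \<in> block N {}"
      unfolding block_def independent_G_iff
    proof (intro CollectI conjI ballI)
      show "N \<subseteq> K" by (auto simp: K_def)
      show "K \<union> {} \<subseteq> verts G" using notN(1) inlink(1) by (auto simp: K_def N_def preimage_def)
      have "\<not> adj (fst p) (fst q)" if "p \<in> K" "q \<in> K" for p q
      proof -
        have fK: "fst p \<in> A \<or> fst p \<in> x ` T" if "p \<in> K" for p
          using that by (auto simp: K_def N_def preimage_def)
        have xx: "\<not> adj (x s) (x t)" if "s \<in> T" "t \<in> T" for s t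
          using L'[OF that(1) inlink(1)[OF that(2)]] x_neq_y[of t s] that T by (metis subsetD)
        have xA: "\<not> adj (x s) a" "\<not> adj a (x s)" if "s \<in> T" "a \<in> A" for s a
          using link_nadj[OF inlink(1)[OF that(1)] that(2)] adj_sym by blast+
        show ?thesis using fK[OF that(1)] fK[OF that(2)] xx xA A by (auto simp: independent_iff)
      qed
      then show "\<And>p q. p \<in> K \<union> {} \<Longrightarrow> q \<in> K \<union> {} \<Longrightarrow> \<not> adj (fst p) (fst q)" by simp
    qed
    have "{p \<in> K. fst p \<in> {x s, y s}} = {(x s, 1)}" if "s \<in> T" for s
    proof -
      have "x s \<notin> A" "y s \<notin> A" using inlink[OF that] by (auto simp: link_verts_def)
      then show ?thesis using other[OF that] that unfolding K_def N_def preimage_def by fastforce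
    qed
    then show "F \<in> R T" using KB F by (simp add: R_def)
  qed
  have Kcard: "card K = card N + card T"
  proof -
    have "N \<inter> (\<lambda>s. (x s, 1)) ` T = {}" using notN(2)[OF inlink(1)] by auto
    moreover have "finite N" unfolding N_def preimage_def using finite_verts_G by auto
    moreover have "card ((\<lambda>s. (x s, 1 :: nat)) ` T) = card T"
      by (rule card_image) (use inj_on_subset[OF inj_x T] in \<open>auto simp: inj_on_def\<close>)
    ultimately show ?thesis unfolding K_def using finT by (simp add: card_Un_disjoint)
  qed
  \<comment> \<open>Here \<open>S\<close> collects the pairs that are restored. For the empty
    \<open>S\<close> this is the base family \<open>{K}\<close>; for \<open>S = T\<close> no
    condition is left and \<open>R {}\<close> is the block itself.\<close>
  have "\<exists>z :: ('v \<times> nat) set \<Rightarrow> 'k. sphere_like h (R (T - S)) (card K) z" if "S \<subseteq> T" for S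
    using finite_subset[OF that finT] that
  proof (induction S rule: finite_induct)
    case empty
    then show ?case using sphere_like_singleton[of h K] by (auto simp: base)
  next
    case (insert s S)
    have "insert s (T - insert s S) = T - S" using insert by auto
    then show ?case using step[of s "T - insert s S" "card K"] insert by auto
  qed
  from this[of T] show ?thesis by (simp add: R_def N_def Kcard[unfolded N_def])
qed

end

section \<open>Minimal covers and exchanges\<close>

context ordered_matching
begin

lemma image_mem_iff:
  assumes "i \<in> {1..d\<^sub>0}" "T \<subseteq> {1..d\<^sub>0}"
  shows "x i \<in> x ` T \<longleftrightarrow> i \<in> T" "y i \<in> y ` T \<longleftrightarrow> i \<in> T" "x i \<notin> y ` T" "y i \<notin> x ` T"
proof -
  show "x i \<in> x ` T \<longleftrightarrow> i \<in> T" by (rule inj_on_image_mem_iff[OF inj_x assms])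
  show "y i \<in> y ` T \<longleftrightarrow> i \<in> T" by (rule inj_on_image_mem_iff[OF inj_y assms])
  show "x i \<notin> y ` T" "y i \<notin> x ` T" using disjoint assms by blast+
qed

definition transversal :: "'v set \<Rightarrow> bool" where
  "transversal K \<longleftrightarrow> (\<forall>i\<in>{1..d\<^sub>0}. x i \<in> K \<longleftrightarrow> y i \<notin> K)"

lemma vertex_cover_iff: "vertex_cover H C \<longleftrightarrow> C \<subseteq> verts H \<and> independent_set H (verts H - C)"
proof
  assume "vertex_cover H C"
  then show "C \<subseteq> verts H \<and> independent_set H (verts H - C)"
    unfolding vertex_cover_def independent_set_def by blast
next
  assume r: "C \<subseteq> verts H \<and> independent_set H (verts H - C)"
  have "e \<inter> C \<noteq> {}" if E: "e \<in> edges H" for e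
  proof -
    obtain u v where e: "e = {u, v}" "adj u v" using E by (rule edge_cases)
    then have "e \<subseteq> verts H" using adj_verts[of u v] by simp
    then show ?thesis using r E unfolding independent_set_def by blast
  qed
  then show "vertex_cover H C" using r by (simp add: vertex_cover_def)
qed

lemma min_cover_of_transversal:
  assumes "C \<subseteq> verts H" "independent_set H (verts H - C)" "transversal C"
  shows "C \<in> min_covers H"
  unfolding min_covers_def
proof (intro CollectI conjI allI impI notI)
  show "vertex_cover H C" using assms(1,2) by (simp add: vertex_cover_iff)
  fix C' assume C': "C' \<subset> C" "vertex_cover H C'"
  then obtain u where u: "u \<in> C" "u \<notin> C'" by blast
  then have "u \<in> verts H" using assms(1) by blast
  then obtain i where i: "i \<in> {1..d\<^sub>0}" "u = x i \<or> u = y i" by (cases rule: vertex_cases) auto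
  have "x i \<notin> C' \<and> y i \<notin> C'"
    using i u assms(3) C'(1) unfolding transversal_def by blast
  moreover have "{x i, y i} \<inter> C' \<noteq> {}"
    using C'(2) matched[OF i(1)] unfolding vertex_cover_def by blast
  ultimately show False by blast
qed

end

locale well_covered_matching = ordered_matching +
  assumes transversal_min_cover: "C \<in> min_covers H \<Longrightarrow> transversal C"
begin

lemma min_covers_iff: "C \<in> min_covers H \<longleftrightarrow> C \<subseteq> verts H \<and> independent_set H (verts H - C) \<and> transversal C"
  using min_cover_of_transversal transversal_min_cover vertex_cover_iff
  by (auto simp: min_covers_def)

lemma exchange_set_alt:
  assumes C: "C \<in> min_covers H" and D: "D \<subseteq> exchange_set H d\<^sub>0 x y C"
  obtains T where "D = x ` T" "T \<subseteq> {1..d\<^sub>0}" "\<And>s. s \<in> T \<Longrightarrow> y s \<in> C \<and> x s \<in> verts H - C"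
    "\<And>s. s \<in> T \<Longrightarrow> C - {y s} \<union> {x s} \<in> min_covers H"
proof
  define T where "T = {s \<in> {1..d\<^sub>0}. x s \<in> D}"
  have ex: "y s \<in> C \<and> C - {y s} \<union> {x s} \<in> min_covers H" if "s \<in> T" for s
  proof -
    have "x s \<in> exchange_set H d\<^sub>0 x y C" "s \<in> {1..d\<^sub>0}" using that D by (auto simp: T_def)
    then show ?thesis unfolding exchange_set_def using x_eq_iff by blast
  qed
  show "D = x ` T" using D by (auto simp: T_def exchange_set_def)
  show "T \<subseteq> {1..d\<^sub>0}" by (auto simp: T_def)
  show "y s \<in> C \<and> x s \<in> verts H - C" if "s \<in> T" for s
    using ex[OF that] that C by (auto simp: min_covers_iff transversal_def T_def)
  show "C - {y s} \<union> {x s} \<in> min_covers H" if "s \<in> T" for s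
    using ex[OF that] by blast
qed

lemma cross_link_of_exchange:
  assumes C: "C \<in> min_covers H" and T: "T \<subseteq> {1..d\<^sub>0}"
    and yT: "\<And>s. s \<in> T \<Longrightarrow> y s \<in> C \<and> x s \<in> verts H - C"
    and ex: "\<And>s. s \<in> T \<Longrightarrow> C - {y s} \<union> {x s} \<in> min_covers H"
  shows "cross_link (verts H - C - x ` T) T"
proof -
  define K where "K = verts H - C"
  define A where "A = K - x ` T"
  have K: "independent_set H K" and trC: "transversal C" and CV: "C \<subseteq> verts H"
    using C by (auto simp: min_covers_iff K_def)
  have Kind: "\<And>u v. u \<in> K \<Longrightarrow> v \<in> K \<Longrightarrow> \<not> adj u v" using K unfolding independent_iff by blast
  have ynadj: "\<not> adj (y s) u" if s: "s \<in> T" "u \<in> K" "u \<noteq> x s" for s u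
  proof -
    have "independent_set H (verts H - (C - {y s} \<union> {x s}))" using ex[OF s(1)] by (simp add: min_covers_iff)
    moreover have "y s \<in> verts H - (C - {y s} \<union> {x s})"
      using yT[OF s(1)] CV s T x_neq_y[of s s] by auto
    moreover have "u \<in> verts H - (C - {y s} \<union> {x s})" using s by (auto simp: K_def)
    ultimately show ?thesis unfolding independent_iff by blast
  qed
  have xK: "x s \<in> K" if "s \<in> T" for s using yT that by (auto simp: K_def)
  have yK: "y s \<notin> K" if "s \<in> T" for s using yT that by (auto simp: K_def)
  have AI: "independent_set H A" using K by (auto simp: A_def independent_iff)
  have inx: "x s \<in> link_verts A" if "s \<in> T" for s
    using that T xK Kind by (auto simp: link_verts_def A_def)
  have iny: "y s \<in> link_verts A" if "s \<in> T" for s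
  proof -
    have "\<not> adj (y s) w" if "w \<in> A" for w
      using ynadj[OF \<open>s \<in> T\<close>, of w] that \<open>s \<in> T\<close> by (auto simp: A_def)
    then show ?thesis using that T yK by (auto simp: link_verts_def A_def)
  qed
  have "link_verts A \<subseteq> x ` T \<union> y ` T"
  proof
    fix u assume u: "u \<in> link_verts A"
    have out: "t \<in> T" if t: "t \<in> {1..d\<^sub>0}" "u = x t \<or> u = y t" for t
    proof (rule ccontr)
      assume "t \<notin> T"
      then have "x t \<notin> x ` T" "y t \<notin> x ` T" using image_mem_iff[OF t(1) T] by simp_all
      moreover have "x t \<in> K \<or> y t \<in> K" using trC t(1) by (auto simp: transversal_def K_def)
      ultimately have "x t \<in> A \<or> y t \<in> A" by (auto simp: A_def)
      moreover have "u \<notin> A" "\<And>a. a \<in> A \<Longrightarrow> \<not> adj u a" using u by (auto simp: link_verts_def)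
      ultimately show False using t matched[OF t(1)] adj_sym by blast
    qed
    have "u \<in> verts H" using u by (simp add: link_verts_def)
    then show "u \<in> x ` T \<union> y ` T" by (cases rule: vertex_cases) (use out in blast)+
  qed
  then have L: "link_verts A = x ` T \<union> y ` T" using inx iny by blast
  have "u = y s" if "s \<in> T" "u \<in> link_verts A" "adj (x s) u" for s u
  proof -
    from that(2) consider t where "t \<in> T" "u = x t" | t where "t \<in> T" "u = y t" using L by auto
    then show ?thesis
    proof cases
      case (2 t)
      then have "x s = x t" using ynadj[OF 2(1) xK[OF that(1)]] that(3) adj_sym by blast
      then have "s = t" using x_eq_iff[of s t] that(1) 2(1) T by blast
      then show ?thesis using 2 by simp
    qed (use Kind xK that in blast)
  qed
  then show ?thesis using AI T L unfolding cross_link_def A_def K_def by blast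
qed

lemma exchange_of_cross_link:
  assumes cross: "cross_link A T"
  defines "C \<equiv> verts H - (A \<union> x ` T)"
  shows "C \<in> min_covers H" "x ` T \<subseteq> exchange_set H d\<^sub>0 x y C" "verts H - C - x ` T = A"
proof -
  have A: "independent_set H A" and T: "T \<subseteq> {1..d\<^sub>0}" and L: "link_verts A = x ` T \<union> y ` T"
    and L': "\<And>s u. s \<in> T \<Longrightarrow> u \<in> link_verts A \<Longrightarrow> adj (x s) u \<Longrightarrow> u = y s"
    using cross unfolding cross_link_def by blast+
  have AV: "A \<subseteq> verts H" and Aind: "\<And>u v. u \<in> A \<Longrightarrow> v \<in> A \<Longrightarrow> \<not> adj u v" using A unfolding independent_iff by blast+
  have inlink: "x s \<in> link_verts A" "y s \<in> link_verts A" if "s \<in> T" for s using that L by auto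
  have notA: "x s \<notin> A" "y s \<notin> A" "x s \<in> verts H" "y s \<in> verts H" if "s \<in> T" for s
    using inlink[OF that] by (auto simp: link_verts_def)
  have nadjA: "\<not> adj u a" "\<not> adj a u" if "u \<in> link_verts A" "a \<in> A" for u a
    using that adj_sym by (auto simp: link_verts_def)
  define K where "K = A \<union> x ` T"
  have KV: "K \<subseteq> verts H" using AV notA by (auto simp: K_def)
  have CK: "verts H - C = K" using KV by (auto simp: C_def K_def)
  have xx: "\<not> adj (x s) (x t)" if "s \<in> T" "t \<in> T" for s t
    using L'[OF that(1) inlink(1)[OF that(2)]] x_neq_y[of t s] that T by (metis subsetD)
  have Kind: "independent_set H K"
    unfolding independent_iff using KV xx nadjA[OF inlink(1)] Aind by (auto simp: K_def)
  have pair: "x i \<in> K \<longleftrightarrow> y i \<notin> K" if i: "i \<in> {1..d\<^sub>0}" for i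
  proof
    assume "x i \<in> K"
    then show "y i \<notin> K" using Kind matched[OF i] unfolding independent_iff by blast
  next
    assume "y i \<notin> K"
    show "x i \<in> K"
    proof (rule ccontr)
      assume xi: "x i \<notin> K"
      then have "i \<notin> T" by (auto simp: K_def)
      then have "x i \<notin> x ` T" "x i \<notin> y ` T" "y i \<notin> x ` T" "y i \<notin> y ` T"
        using image_mem_iff[OF i T] by simp_all
      then have "x i \<notin> link_verts A" "y i \<notin> link_verts A" using L by auto
      then obtain a b where "a \<in> A" "adj (x i) a" "b \<in> A" "adj (y i) b"
        using xi \<open>y i \<notin> K\<close> i by (auto simp: link_verts_def K_def)
      then show False using transfer_edge[OF i, of a b] Aind adj_sym by blast
    qed
  qed
  have tr: "transversal C" using pair KV CK unfolding transversal_def C_def K_def by auto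
  show C: "C \<in> min_covers H"
    using Kind CK tr by (simp add: min_covers_iff C_def)
  show "x ` T \<subseteq> exchange_set H d\<^sub>0 x y C"
  proof
    fix u assume "u \<in> x ` T"
    then obtain s where s: "s \<in> T" "u = x s" by blast
    then have s0: "s \<in> {1..d\<^sub>0}" using T by blast
    have xsK: "x s \<in> K" using s by (simp add: K_def)
    then have ysC: "y s \<in> C" using pair[OF s0] s0 CK by (auto simp: C_def K_def)
    have eq: "verts H - (C - {y s} \<union> {x s}) = insert (y s) (K - {x s})"
      using CK s0 x_neq_y[OF s0 s0] by (auto simp: C_def K_def)
    have yK: "\<not> adj (y s) v \<and> \<not> adj v (y s)" if "v \<in> K - {x s}" for v
    proof (cases "v \<in> A")
      case True
      then show ?thesis using nadjA[OF inlink(2)[OF s(1)]] by blast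
    next
      case False
      then obtain t where t: "t \<in> T" "v = x t" "t \<noteq> s" using \<open>v \<in> K - {x s}\<close> by (auto simp: K_def)
      then have "\<not> adj (x t) (y s)" using L'[OF t(1) inlink(2)[OF s(1)]] y_eq_iff[of s t] s0 T by auto
      then show ?thesis using t adj_sym by blast
    qed
    have "independent_set H (insert (y s) (K - {x s}))"
      unfolding independent_iff using Kind yK s0 by (auto simp: independent_iff)
    moreover have "transversal (C - {y s} \<union> {x s})"
      using tr ysC x_eq_iff[OF _ s0] y_eq_iff[OF _ s0] x_neq_y[OF _ s0] x_neq_y[OF s0]
      unfolding transversal_def by (metis DiffE DiffI UnCI UnE insert_iff singletonD)
    ultimately have "C - {y s} \<union> {x s} \<in> min_covers H"
      unfolding min_covers_iff eq using s0 x_verts[OF s0] by (auto simp: C_def simp del: x_verts)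
    then show "u \<in> exchange_set H d\<^sub>0 x y C" using s s0 ysC by (auto simp: exchange_set_def)
  qed
  show "verts H - C - x ` T = A" using CK notA by (auto simp: K_def)
qed

lemma cross_link_unique:
  assumes "cross_link A T" "cross_link A T'"
  shows "T = T'"
proof -
  have "T = {s \<in> {1..d\<^sub>0}. x s \<in> link_verts A}" if "cross_link A T" for T
  proof -
    have T: "T \<subseteq> {1..d\<^sub>0}" "link_verts A = x ` T \<union> y ` T" using that unfolding cross_link_def by blast+
    show ?thesis unfolding T(2) using T(1) image_mem_iff[OF _ T(1)] by blast
  qed
  then show ?thesis using assms by metis
qed

lemma the_cross_link: "cross_link A T \<Longrightarrow> (THE T. cross_link A T) = T"
  using cross_link_unique the_equality by metis

text \<open>Any choice of one end from each pair in \<open>T\<close> completes \<open>A\<close> to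
  the complement of a minimal cover. Taking all the ends \<open>x s\<close> singles out one of these
  covers, so \<open>A\<close> is counted once. The inverse recovers \<open>T\<close> from
  \<open>A\<close>, whose link determines it.\<close>

lemma bij_exchange_cross_link:
  "bij_betw (\<lambda>(C, D). verts H - C - D) (SIGMA C:min_covers H. Pow (exchange_set H d\<^sub>0 x y C)) {A. \<exists>T. cross_link A T}"
proof (rule bij_betwI[where g = "\<lambda>A. let T = (THE T. cross_link A T) in (verts H - (A \<union> x ` T), x ` T)"])
  show "(\<lambda>(C, D). verts H - C - D) \<in> (SIGMA C:min_covers H. Pow (exchange_set H d\<^sub>0 x y C)) \<rightarrow> {A. \<exists>T. cross_link A T}"
  proof (clarsimp)
    fix C D assume CD: "C \<in> min_covers H" "D \<subseteq> exchange_set H d\<^sub>0 x y C"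
    then obtain T where T: "D = x ` T" "T \<subseteq> {1..d\<^sub>0}" "\<And>s. s \<in> T \<Longrightarrow> y s \<in> C \<and> x s \<in> verts H - C"
    "\<And>s. s \<in> T \<Longrightarrow> C - {y s} \<union> {x s} \<in> min_covers H" by (rule exchange_set_alt) blast
    show "\<exists>T. cross_link (verts H - C - D) T" using cross_link_of_exchange[OF CD(1) T(2-4)] T(1) by blast
  qed
  show "(\<lambda>A. let T = (THE T. cross_link A T) in (verts H - (A \<union> x ` T), x ` T)) \<in> 
      {A. \<exists>T. cross_link A T} \<rightarrow> (SIGMA C:min_covers H. Pow (exchange_set H d\<^sub>0 x y C))"
  proof (intro funcsetI)
    fix A assume "A \<in> {A. \<exists>T. cross_link A T}"
    then obtain T where T: "cross_link A T" by blast
    show "(let T = (THE T. cross_link A T) in (verts H - (A \<union> x ` T), x ` T)) \<in>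
      (SIGMA C:min_covers H. Pow (exchange_set H d\<^sub>0 x y C))"
      unfolding the_cross_link[OF T] Let_def using exchange_of_cross_link[OF T] by blast
  qed
  fix p assume "p \<in> (SIGMA C:min_covers H. Pow (exchange_set H d\<^sub>0 x y C))"
  then obtain C D where CD: "p = (C, D)" "C \<in> min_covers H" "D \<subseteq> exchange_set H d\<^sub>0 x y C" by blast
  then obtain T where T: "D = x ` T" "T \<subseteq> {1..d\<^sub>0}" "\<And>s. s \<in> T \<Longrightarrow> y s \<in> C \<and> x s \<in> verts H - C"
    "\<And>s. s \<in> T \<Longrightarrow> C - {y s} \<union> {x s} \<in> min_covers H" using exchange_set_alt by metis
  have t: "(THE T'. cross_link (verts H - C - x ` T) T') = T"
    by (rule the_cross_link[OF cross_link_of_exchange[OF CD(2) T(2-4)]])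
  have "verts H - (verts H - C - x ` T \<union> x ` T) = C"
    using T(3) CD(2) by (auto simp: min_covers_iff)
  then show "(let T = (THE T. cross_link ((\<lambda>(C, D). verts H - C - D) p) T) in
      (verts H - ((\<lambda>(C, D). verts H - C - D) p \<union> x ` T), x ` T)) = p"
    by (simp add: CD(1) t Let_def T(1))
next
  fix A assume "A \<in> {A. \<exists>T. cross_link A T}"
  then obtain T where "cross_link A T" by blast
  then show "(\<lambda>(C, D). verts H - C - D) (let T = (THE T. cross_link A T) in (verts H - (A \<union> x ` T), x ` T)) = A"
    using exchange_of_cross_link(3) by (simp add: the_cross_link Let_def)
qed

end

section \<open>Polynomials and the edge ideal\<close>

abbreviation (input) "lookup \<equiv> Poly_Mapping.lookup"
abbreviation (input) "keys \<equiv> Poly_Mapping.keys"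
abbreviation (input) "single \<equiv> Poly_Mapping.single"

lemma keys_add_nat: "keys (m + m' :: 'w \<Rightarrow>\<^sub>0 nat) = keys m \<union> keys m'"
  by (auto simp: in_keys_iff lookup_add)

lemma carrier_poly_ring: "p \<in> carrier (poly_ring V) \<longleftrightarrow> (\<forall>m\<in>keys p. keys m \<subseteq> V)"
  and poly_ring_simps [simp]: "mult (poly_ring V) = (*)" "add (poly_ring V) = (+)" "zero (poly_ring V) = 0"
    "one (poly_ring V) = 1"
  by (simp_all add: poly_ring_def)

lemma poly_ring_add_closed: "p \<in> carrier (poly_ring V) \<Longrightarrow> q \<in> carrier (poly_ring V) \<Longrightarrow> p + q \<in> carrier (poly_ring V)"
  unfolding carrier_poly_ring using keys_add[of p q] by blast

lemma poly_ring_uminus_closed: "p \<in> carrier (poly_ring V) \<Longrightarrow> - p \<in> carrier (poly_ring V)"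
  by (simp add: carrier_poly_ring in_keys_iff)

lemma poly_ring_mult_closed: "p \<in> carrier (poly_ring V) \<Longrightarrow> q \<in> carrier (poly_ring V) \<Longrightarrow> p * q \<in> carrier (poly_ring V)"
  unfolding carrier_poly_ring using keys_mult[of p q] by (fastforce simp: keys_add_nat)

lemma poly_ring_zero_closed [simp]: "0 \<in> carrier (poly_ring V)"
  and poly_ring_one_closed [simp]: "1 \<in> carrier (poly_ring V)"
  by (simp_all add: carrier_poly_ring)

lemma poly_ring_cring: "cring (poly_ring V :: ('w, 'k::field) mpoly ring)"
proof (rule cringI)
  show "abelian_group (poly_ring V :: ('w, 'k) mpoly ring)"
  proof (rule abelian_groupI)
    fix p :: "('w, 'k) mpoly" assume "p \<in> carrier (poly_ring V)"
    then show "\<exists>q\<in>carrier (poly_ring V). q \<oplus>\<^bsub>poly_ring V\<^esub> p = \<zero>\<^bsub>poly_ring V\<^esub>"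
      by (intro bexI[of _ "- p"]) (auto simp: poly_ring_uminus_closed)
  qed (simp_all add: poly_ring_add_closed add_ac)
  show "comm_monoid (poly_ring V :: ('w, 'k) mpoly ring)"
    by (rule comm_monoidI) (simp_all add: poly_ring_mult_closed mult_ac)
qed (simp add: algebra_simps)

lemma sum_monomials: "(\<Sum>m\<in>keys p. single m (lookup p m)) = p"
proof (rule poly_mapping_eqI)
  fix k
  show "lookup (\<Sum>m\<in>keys p. single m (lookup p m)) k = lookup p k"
    by (simp add: lookup_sum lookup_single when_def in_keys_iff)
qed

text \<open>For natural \<open>k\<close> the exponent of the \<open>k\<close>-th power of
  \<open>var_prod F\<close>, for integer \<open>k\<close> the corresponding shift of Laurent
  exponents. It has this meaning for finite \<open>F\<close> only.\<close>

definition constant_exp :: "'w set \<Rightarrow> 'a::zero \<Rightarrow> 'w \<Rightarrow>\<^sub>0 'a" where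
  "constant_exp F k = Abs_poly_mapping (\<lambda>v. if v \<in> F then k else 0)"

lemma lookup_constant_exp: "finite F \<Longrightarrow> lookup (constant_exp F k) v = (if v \<in> F then k else 0)"
  unfolding constant_exp_def by (subst lookup_Abs_poly_mapping) (auto elim: finite_subset[rotated])

lemma keys_constant_exp: "finite F \<Longrightarrow> keys (constant_exp F k) \<subseteq> F"
  by (auto simp: in_keys_iff lookup_constant_exp split: if_splits)

lemma constant_exp_add: "finite F \<Longrightarrow> constant_exp F (k + l :: 'a::monoid_add) = constant_exp F k + constant_exp F l"
  by (rule poly_mapping_eqI) (simp add: lookup_constant_exp lookup_add)

lemma constant_exp_zero [simp]: "finite F \<Longrightarrow> constant_exp F 0 = 0"
  by (rule poly_mapping_eqI) (simp add: lookup_constant_exp)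

lemma constant_exp_empty [simp]: "constant_exp {} k = 0"
  by (simp add: constant_exp_def)

lemma constant_exp_insert:
  "finite F \<Longrightarrow> v \<notin> F \<Longrightarrow> constant_exp (insert v F) (k :: 'a::monoid_add) = single v k + constant_exp F k"
  by (rule poly_mapping_eqI) (auto simp: lookup_constant_exp lookup_add lookup_single when_def)

lemma var_prod_eq: "finite F \<Longrightarrow> (var_prod F :: ('w, 'k::field) mpoly) = single (constant_exp F 1) 1"
proof (induction F rule: finite_induct)
  case (insert v F)
  then have "var_prod (insert v F) = (poly_var v :: ('w, 'k) mpoly) * var_prod F"
    by (simp add: var_prod_def)
  also have "\<dots> = single (constant_exp (insert v F) 1) 1"
    using insert by (simp add: poly_var_def mult_single constant_exp_insert)
  finally show ?case .
qed (simp add: var_prod_def)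

lemma var_prod_power: "finite F \<Longrightarrow> (var_prod F :: ('w, 'k::field) mpoly) ^ k = single (constant_exp F k) 1"
proof (induction k)
  case (Suc k)
  then show ?case using constant_exp_add[of F 1 k] by (simp add: var_prod_eq mult_single)
qed simp

lemma poly_var_power: "(poly_var v :: ('w, 'k::field) mpoly) ^ k = single (single v k) 1"
  by (induction k) (simp_all add: poly_var_def mult_single flip: single_add)

lemma var_prod_insert: "finite F \<Longrightarrow> v \<notin> F \<Longrightarrow> var_prod F * poly_var v = (var_prod (insert v F) :: ('w, 'k::field) mpoly)"
  by (simp add: var_prod_def mult.commute)

definition int_exp :: "('w \<Rightarrow>\<^sub>0 nat) \<Rightarrow> 'w \<Rightarrow>\<^sub>0 int" where
  "int_exp m = Poly_Mapping.map int m"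

lemma lookup_int_exp [simp]: "lookup (int_exp m) v = int (lookup m v)"
  by (simp add: int_exp_def Poly_Mapping.map.rep_eq when_def)

lemma keys_int_exp [simp]: "keys (int_exp m) = keys m"
  by (auto simp: in_keys_iff)

lemma int_exp_add: "int_exp (m + m') = int_exp m + int_exp m'"
  by (rule poly_mapping_eqI) (simp add: lookup_add)

lemma int_exp_zero [simp]: "int_exp 0 = 0"
  by (rule poly_mapping_eqI) simp

lemma int_exp_inject [simp]: "int_exp m = int_exp m' \<longleftrightarrow> m = m'"
  by (auto simp: poly_mapping_eq_iff fun_eq_iff)

lemma int_exp_constant_exp: "finite F \<Longrightarrow> int_exp (constant_exp F k) = constant_exp F (int k)"
  by (rule poly_mapping_eqI) (simp add: lookup_constant_exp)

lemma int_exp_single: "int_exp (single v k) = single v (int k)"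
  by (rule poly_mapping_eqI) (simp add: lookup_single when_def)

lemma int_exp_surj:
  assumes "\<And>v. 0 \<le> lookup e v"
  obtains m where "e = int_exp m"
proof
  have "finite {v. nat (lookup e v) \<noteq> 0}"
    by (rule finite_subset[OF _ finite_keys[of e]]) (auto simp: in_keys_iff)
  then show "e = int_exp (Abs_poly_mapping (\<lambda>v. nat (lookup e v)))"
    using assms by (intro poly_mapping_eqI) simp
qed

text \<open>The coefficient at an integer exponent, which is zero unless the exponent is non-negative.\<close>

definition coef :: "('w, 'k::field) mpoly \<Rightarrow> ('w \<Rightarrow>\<^sub>0 int) \<Rightarrow> 'k" where
  "coef p e = (\<Sum>m\<in>keys p. if e = int_exp m then lookup p m else 0)"

lemma coef_int_exp [simp]: "coef p (int_exp m) = lookup p m"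
  by (simp add: coef_def in_keys_iff)

lemma coef_eq_0: "(\<And>m. e \<noteq> int_exp m) \<Longrightarrow> coef p e = 0"
  by (simp add: coef_def)

lemma coef_negative: "lookup e v < 0 \<Longrightarrow> coef p e = 0"
  by (rule coef_eq_0) auto

lemma coef_nonzeroE:
  assumes "coef p e \<noteq> 0"
  obtains m where "m \<in> keys p" "e = int_exp m"
proof -
  obtain m where "e = int_exp m" using assms coef_eq_0 by metis
  then show ?thesis using that[of m] assms by (simp add: in_keys_iff)
qed

lemma coef_add: "coef (p + q) e = coef p e + coef q e"
  by (cases "\<exists>m. e = int_exp m") (auto simp: coef_eq_0 lookup_add)

lemma coef_sum: "coef (\<Sum>i\<in>A. p i) e = (\<Sum>i\<in>A. coef (p i) e)"
  by (cases "\<exists>m. e = int_exp m") (auto simp: coef_eq_0 lookup_sum)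

lemma coef_single: "coef (single m c) e = (if e = int_exp m then c else 0)"
proof (cases "\<exists>m. e = int_exp m")
  case True
  then show ?thesis by (auto simp: lookup_single when_def)
qed (auto simp: coef_eq_0)

text \<open>The gain from integer exponents: multiplication by a monomial is a plain shift, without
  a divisibility condition.\<close>

lemma coef_monomial_mult: "coef (single m c * p) e = c * coef p (e - int_exp m)"
proof -
  have "single m c * p = (\<Sum>m'\<in>keys p. single (m + m') (c * lookup p m'))"
    by (subst sum_monomials[of p, symmetric]) (simp add: sum_distrib_left mult_single)
  also have "coef \<dots> e = (\<Sum>m'\<in>keys p. if e = int_exp (m + m') then c * lookup p m' else 0)"
    by (simp add: coef_sum coef_single)
  also have "\<dots> = (\<Sum>m'\<in>keys p. c * (if e - int_exp m = int_exp m' then lookup p m' else 0))"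
    by (intro sum.cong) (auto simp: int_exp_add algebra_simps)
  finally show ?thesis by (simp add: coef_def sum_distrib_left)
qed

lemma coef_const_mult: "coef (poly_const c * p) e = c * coef p e"
  by (simp add: poly_const_def coef_monomial_mult)

section \<open>The edge ideal in terms of coefficients\<close>

locale edge_ring =
  fixes G :: "'w ugraph"
  assumes simple: "simple_graph G"
begin

abbreviation V :: "'w set" where "V \<equiv> verts G"

abbreviation indep :: "'w set \<Rightarrow> bool" where "indep \<equiv> independent_set G"

lemma finite_V: "finite V"
  using simple by (simp add: simple_graph_def)

lemma indep_subset: "indep A \<Longrightarrow> B \<subseteq> A \<Longrightarrow> indep B"
  unfolding independent_set_def by blast

lemma indep_V: "indep A \<Longrightarrow> A \<subseteq> V"
  by (simp add: independent_set_def)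

lemma not_indepE:
  assumes "\<not> indep A" "A \<subseteq> V"
  obtains u v where "{u, v} \<in> edges G" "u \<in> A" "v \<in> A" "u \<noteq> v"
proof -
  obtain e where e: "e \<in> edges G" "e \<subseteq> A" using assms by (auto simp: independent_set_def)
  then obtain u v where "u \<noteq> v" "e = {u, v}" using simple unfolding simple_graph_def by metis
  then show ?thesis using that e by auto
qed

text \<open>Membership can be tested on single monomials. The right-hand side is an ideal containing
  the generators; conversely a monomial with dependent support is divisible by some
  generator.\<close>

lemma edge_ideal_eq:
  "edge_ideal G = {p :: ('w, 'k::field) mpoly. p \<in> carrier (poly_ring V) \<and> (\<forall>m\<in>keys p. \<not> indep (keys m))}"
    (is "_ = ?I")
proof
  let ?R = "poly_ring V :: ('w, 'k) mpoly ring"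
  let ?S = "{poly_var u * poly_var v | u v. {u, v} \<in> edges G} :: ('w, 'k) mpoly set"
  have single: "(poly_var u * poly_var v :: ('w, 'k) mpoly) = single (single u 1 + single v 1) 1" for u v
    by (simp add: poly_var_def mult_single)
  interpret R: cring ?R by (rule poly_ring_cring)
  have mult: "p * q \<in> ?I" if "p \<in> ?I" "q \<in> carrier ?R" for p q
  proof -
    have "\<not> indep (keys m)" if "m \<in> keys (p * q)" for m
    proof -
      obtain a b where "m = a + b" "a \<in> keys p" using keys_mult[of p q] \<open>m \<in> _\<close> by blast
      then show ?thesis using \<open>p \<in> ?I\<close> indep_subset[of "keys m" "keys a"]
        by (auto simp: keys_add_nat)
    qed
    then show ?thesis using that poly_ring_mult_closed by auto
  qed
  have "ideal ?I ?R"
  proof (rule idealI[OF R.ring_axioms])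
    show "subgroup ?I (add_monoid ?R)"
    proof (rule R.add.subgroupI)
      fix p assume p: "p \<in> ?I"
      have "- p \<in> ?I" using p poly_ring_uminus_closed[of p] by auto
      moreover have "\<ominus>\<^bsub>?R\<^esub> p = - p"
        by (rule R.minus_equality) (use p poly_ring_uminus_closed[of p] in auto)
      ultimately show "\<ominus>\<^bsub>?R\<^esub> p \<in> ?I" by simp
      fix q assume q: "q \<in> ?I"
      show "p \<oplus>\<^bsub>?R\<^esub> q \<in> ?I" using p q poly_ring_add_closed[of p] keys_add[of p q] by auto
    next
      have "0 \<in> ?I" by (simp add: carrier_poly_ring)
      then show "?I \<noteq> {}" by blast
    qed auto
  qed (use mult in \<open>auto simp: mult.commute\<close>)
  moreover have "?S \<subseteq> ?I"
  proof
    fix p assume "p \<in> ?S"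
    then obtain u v where uv: "{u, v} \<in> edges G" "p = poly_var u * poly_var v" by blast
    obtain a b where "{u, v} = {a, b}" "a \<in> V" "b \<in> V" using simple uv(1) unfolding simple_graph_def by metis
    then have "{u, v} \<subseteq> V" by simp
    moreover have "keys p = {single u 1 + single v 1}"
      unfolding uv(2) single by simp
    moreover have "keys (single u 1 + single v 1 :: 'w \<Rightarrow>\<^sub>0 nat) = {u, v}"
      by (simp add: keys_add_nat insert_commute)
    ultimately show "p \<in> ?I" using uv(1) by (auto simp: carrier_poly_ring independent_set_def)
  qed
  ultimately show "edge_ideal G \<subseteq> ?I"
    unfolding edge_ideal_def genideal_def by blast
  show "?I \<subseteq> edge_ideal G"
  proof
    fix p :: "('w, 'k) mpoly" assume p: "p \<in> ?I"
    show "p \<in> edge_ideal G"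
      unfolding edge_ideal_def genideal_def
    proof (intro InterI, elim CollectE conjE)
      fix J assume J: "ideal J ?R" "?S \<subseteq> J"
      interpret J: ideal J ?R by fact
      have mon: "single m (lookup p m) \<in> J" if m: "m \<in> keys p" for m
      proof -
        have mV: "keys m \<subseteq> V" using p m by (auto simp: carrier_poly_ring)
        obtain u v where uv: "{u, v} \<in> edges G" "u \<in> keys m" "v \<in> keys m" "u \<noteq> v"
          using p m not_indepE[OF _ mV] by blast
        define e :: "'w \<Rightarrow>\<^sub>0 nat" where "e = single u 1 + single v 1"
        have "lookup e w \<le> lookup m w" for w
          using uv(2-4) by (auto simp: e_def lookup_add lookup_single when_def in_keys_iff)
        then have me: "(m - e) + e = m"
          by (intro poly_mapping_eqI) (simp add: lookup_add lookup_minus)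
        have "single (m - e) (lookup p m) \<in> carrier ?R"
        proof -
          have "keys (m - e) \<subseteq> V"
            using mV by (auto simp: in_keys_iff lookup_minus)
          then show ?thesis by (auto simp: carrier_poly_ring)
        qed
        moreover have "poly_var u * poly_var v \<in> J" using J(2) uv(1) by blast
        ultimately have "single (m - e) (lookup p m) * (poly_var u * poly_var v) \<in> J"
          using J.I_l_closed by simp
        then show ?thesis unfolding single e_def[symmetric] by (simp add: mult_single me)
      qed
      have "(\<Sum>m\<in>K. single m (lookup p m)) \<in> J" if "K \<subseteq> keys p" for K
        using finite_subset[OF that finite_keys] that
      proof (induction K rule: finite_induct)
        case empty
        have "\<zero>\<^bsub>?R\<^esub> \<in> J" by (rule additive_subgroup.zero_closed[OF J.is_additive_subgroup])
        then show ?case by simp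
      next
        case (insert m K)
        then show ?case using J.a_closed[OF mon[of m]] by simp
      qed
      from this[of "keys p"] show "p \<in> J" by (simp add: sum_monomials)
    qed
  qed
qed

end

section \<open>Localizations at products of variables\<close>

lemma poly_module_simps [simp]:
  "carrier (poly_module V) = carrier (poly_ring V)" "add (poly_module V) = (+)" "zero (poly_module V) = 0"
  "smult (poly_module V) = (*)"
  by (simp_all add: poly_module_def ring.extend_def)

lemma poly_ring_single: "single m (c :: 'k::field) \<in> carrier (poly_ring V) \<longleftrightarrow> c = 0 \<or> keys m \<subseteq> V"
  by (simp add: carrier_poly_ring)

lemma coef_diff: "coef (p - q) e = coef p e - coef q e"
  by (cases "\<exists>m. e = int_exp m") (auto simp: coef_eq_0 lookup_minus)

lemma UN_const: "A \<noteq> {} \<Longrightarrow> (\<And>x. x \<in> A \<Longrightarrow> f x = c) \<Longrightarrow> (\<Union>x\<in>A. f x) = c"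
  by auto

context edge_ring
begin

abbreviation polys :: "('w, 'k::field) mpoly set" where "polys \<equiv> carrier (poly_ring V)"

definition cls :: "('w, 'k::field) mpoly \<Rightarrow> ('w, 'k) mpoly set" where
  "cls p = edge_ideal G +>\<^bsub>poly_ring V\<^esub> p"

text \<open>Equality modulo the edge ideal. Quantifying over integer exponents changes nothing, as
  both coefficients vanish when an entry is negative, but it allows shifts in both
  directions.\<close>

definition equiv_mod :: "('w, 'k::field) mpoly \<Rightarrow> ('w, 'k) mpoly \<Rightarrow> bool" where
  "equiv_mod p q \<longleftrightarrow> (\<forall>e. indep (keys e) \<longrightarrow> coef p e = coef q e)"

lemma edge_ideal_iff: "p \<in> edge_ideal G \<longleftrightarrow> p \<in> polys \<and> equiv_mod p 0"
proof -
  have "(\<forall>m\<in>keys p. \<not> indep (keys m)) \<longleftrightarrow> equiv_mod p 0"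
  proof
    assume l: "\<forall>m\<in>keys p. \<not> indep (keys m)"
    show "equiv_mod p 0"
      unfolding equiv_mod_def
    proof (intro allI impI)
      fix e :: "'w \<Rightarrow>\<^sub>0 int" assume e: "indep (keys e)"
      have "coef p e = 0"
      proof (rule ccontr)
        assume "coef p e \<noteq> 0"
        then obtain m where "m \<in> keys p" "e = int_exp m" by (rule coef_nonzeroE)
        then show False using l e by simp
      qed
      then show "coef p e = coef 0 e" by (simp add: coef_def)
    qed
  next
    assume r: "equiv_mod p 0"
    show "\<forall>m\<in>keys p. \<not> indep (keys m)"
    proof (intro ballI notI)
      fix m assume m: "m \<in> keys p" "indep (keys m)"
      then have "coef p (int_exp m) = coef 0 (int_exp m)" using r unfolding equiv_mod_def by (metis keys_int_exp)
      then show False using m(1) by (simp add: in_keys_iff)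
    qed
  qed
  then show ?thesis by (simp add: edge_ideal_eq)
qed

lemma cls_eq:
  fixes p :: "('w, 'k::field) mpoly"
  assumes "p \<in> polys"
  shows "cls p = {q \<in> polys. equiv_mod q p}"
proof -
  have "q \<in> polys \<and> equiv_mod q p \<longleftrightarrow> (\<exists>i\<in>edge_ideal G. q = i + p)" for q :: "('w, 'k) mpoly"
  proof
    assume q: "q \<in> polys \<and> equiv_mod q p"
    then have "q - p \<in> polys" using poly_ring_add_closed[OF _ poly_ring_uminus_closed[OF assms], of q] by simp
    moreover have "equiv_mod (q - p) 0" using q by (auto simp: equiv_mod_def coef_diff coef_def[of 0])
    ultimately show "\<exists>i\<in>edge_ideal G. q = i + p" by (intro bexI[of _ "q - p"]) (auto simp: edge_ideal_iff)
  next
    assume "\<exists>i\<in>edge_ideal G. q = i + p"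
    then show "q \<in> polys \<and> equiv_mod q p"
      using poly_ring_add_closed[OF _ assms] by (auto simp: edge_ideal_iff equiv_mod_def coef_add coef_def[of 0])
  qed
  then show ?thesis by (auto simp: cls_def a_r_coset_def')
qed

lemma equiv_mod_refl [simp]: "equiv_mod p p"
  by (simp add: equiv_mod_def)

lemma cls_eq_iff: "p \<in> polys \<Longrightarrow> q \<in> polys \<Longrightarrow> cls p = cls q \<longleftrightarrow> equiv_mod p q"
  by (simp add: cls_eq set_eq_iff) (metis equiv_mod_def equiv_mod_refl)

lemma module_coset: "edge_ideal G +>\<^bsub>poly_module V\<^esub> p = cls p"
  by (simp add: cls_def a_r_coset_def')

lemma edge_ideal_cls: "edge_ideal G = cls 0"
  by (auto simp: cls_eq edge_ideal_iff)

abbreviation E :: "(('w, 'k::field) mpoly, ('w, 'k) mpoly set) module" where "E \<equiv> edge_module G"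

lemma edge_module_carrier: "carrier E = cls ` polys"
  by (auto simp: edge_module_def quot_module_def module_coset)

lemma edge_module_zero: "\<zero>\<^bsub>E\<^esub> = cls 0"
  by (simp add: edge_module_def quot_module_def edge_ideal_cls)

lemma edge_module_add:
  assumes "p \<in> polys" "q \<in> polys"
  shows "cls p \<oplus>\<^bsub>E\<^esub> cls q = cls (p + q)"
proof -
  have "(\<Union>a\<in>cls p. \<Union>b\<in>cls q. {a + b}) = cls (p + q)"
  proof (intro equalityI subsetI)
    fix r assume "r \<in> (\<Union>a\<in>cls p. \<Union>b\<in>cls q. {a + b})"
    then show "r \<in> cls (p + q)"
      by (auto simp: cls_eq assms poly_ring_add_closed equiv_mod_def coef_add)
  next
    fix r assume r: "r \<in> cls (p + q)"
    then have "r - p \<in> cls q"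
      using assms poly_ring_add_closed[OF _ poly_ring_uminus_closed[OF assms(1)], of r]
      by (auto simp: cls_eq poly_ring_add_closed equiv_mod_def coef_add coef_diff)
    moreover have "p \<in> cls p" "r = p + (r - p)" using assms by (auto simp: cls_eq)
    ultimately show "r \<in> (\<Union>a\<in>cls p. \<Union>b\<in>cls q. {a + b})" by blast
  qed
  then show ?thesis by (simp add: edge_module_def quot_module_def set_add_def')
qed

lemma equiv_mod_monomial_mult:
  assumes "equiv_mod p q"
  shows "equiv_mod (single m c * p) (single m c * q)"
  unfolding equiv_mod_def
proof (intro allI impI)
  fix e :: "'w \<Rightarrow>\<^sub>0 int" assume e: "indep (keys e)"
  have "coef p (e - int_exp m) = coef q (e - int_exp m)"
  proof (cases "\<exists>m'. e - int_exp m = int_exp m'")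
    case True
    then obtain m' where m': "e - int_exp m = int_exp m'" by blast
    then have "e = int_exp (m' + m)" by (simp add: int_exp_add algebra_simps)
    then have "indep (keys (int_exp m'))"
      using e by (auto simp: keys_add_nat intro: indep_subset)
    then show ?thesis using assms unfolding m' equiv_mod_def by blast
  qed (auto simp: coef_eq_0)
  then show "coef (single m c * p) e = coef (single m c * q) e"
    by (simp add: coef_monomial_mult)
qed

lemma edge_module_smult:
  assumes "keys m \<subseteq> V" "p \<in> polys"
  shows "single m c \<odot>\<^bsub>E\<^esub> cls p = cls (single m c * p)"
proof -
  have closed: "single m c * a \<in> polys" if "a \<in> polys" for a
    using poly_ring_mult_closed[OF _ that] assms(1) by (auto simp: poly_ring_single)
  have "cls (single m c * a) = cls (single m c * p)" if "a \<in> cls p" for a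
    using that assms closed equiv_mod_monomial_mult by (auto simp: cls_eq[OF assms(2)] cls_eq_iff)
  moreover have "p \<in> cls p" using assms by (simp add: cls_eq)
  ultimately have "(\<Union>a\<in>cls p. cls (single m c * a)) = cls (single m c * p)"
    by (intro UN_const) blast+
  then show ?thesis by (simp add: edge_module_def quot_module_def module_coset)
qed

text \<open>The coefficients of the element \<open>p / (var_prod F) ^ k\<close> of the localization of \<open>k[V] / I(G)\<close>.\<close>

definition frac_coef :: "'w set \<Rightarrow> ('w, 'k::field) mpoly \<Rightarrow> nat \<Rightarrow> ('w \<Rightarrow>\<^sub>0 int) \<Rightarrow> 'k" where
  "frac_coef F p k a = (if indep (F \<union> keys a) then coef p (a + constant_exp F (int k)) else 0)"

lemma finite_sub: "F \<subseteq> V \<Longrightarrow> finite F"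
  using finite_V finite_subset by blast

lemma var_prod_power_closed: "F \<subseteq> V \<Longrightarrow> p \<in> polys \<Longrightarrow> var_prod F ^ k * p \<in> polys"
  using keys_constant_exp[OF finite_sub, of F k]
  by (auto simp: var_prod_power finite_sub poly_ring_single intro!: poly_ring_mult_closed)

lemma coef_var_prod_power: "F \<subseteq> V \<Longrightarrow> coef (var_prod F ^ k * p) e = coef p (e - constant_exp F (int k))"
  by (simp add: var_prod_power finite_sub coef_monomial_mult int_exp_constant_exp)

lemma edge_module_var_prod: "F \<subseteq> V \<Longrightarrow> p \<in> polys \<Longrightarrow> var_prod F ^ k \<odot>\<^bsub>E\<^esub> cls p = cls (var_prod F ^ k * p)"
  using keys_constant_exp[OF finite_sub, of F k] edge_module_smult[of "constant_exp F k" p 1]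
  by (simp add: var_prod_power finite_sub subset_trans)

text \<open>The coefficient function is a complete invariant of a fraction. From left to right, the
  coefficient at \<open>a\<close> is tested after multiplication by a high power of
  \<open>var_prod F\<close>, which enlarges the support of \<open>a\<close> at most by
  \<open>F\<close>; this explains the condition that \<open>F \<union> keys a\<close> be
  independent.\<close>

lemma loc_rel_iff:
  assumes F: "F \<subseteq> V" and pq: "p \<in> polys" "q \<in> polys"
  shows "((cls p, k), (cls q, l)) \<in> loc_rel E (var_prod F) \<longleftrightarrow> frac_coef F p k = frac_coef F q l"
proof -
  note fF = finite_sub[OF F]
  define s where "s = (\<lambda>n. constant_exp F (int n))"
  have s_add: "s (i + j) = s i + s j" for i j using constant_exp_add[OF fF] by (simp add: s_def)
  have "((cls p, k), (cls q, l)) \<in> loc_rel E (var_prod F) \<longleftrightarrow>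
      (\<exists>t. equiv_mod (var_prod F ^ t * (var_prod F ^ l * p)) (var_prod F ^ t * (var_prod F ^ k * q)))"
    using F pq by (simp add: loc_rel_def edge_module_carrier edge_module_var_prod var_prod_power_closed cls_eq_iff)
  also have "\<dots> \<longleftrightarrow> (\<exists>t. \<forall>e. indep (keys e) \<longrightarrow> coef p (e - s t - s l) = coef q (e - s t - s k))"
    by (simp add: equiv_mod_def coef_var_prod_power[OF F] s_def)
  also have "\<dots> \<longleftrightarrow> frac_coef F p k = frac_coef F q l"
  proof
    assume "\<exists>t. \<forall>e. indep (keys e) \<longrightarrow> coef p (e - s t - s l) = coef q (e - s t - s k)"
    then obtain t where t: "\<And>e. indep (keys e) \<Longrightarrow> coef p (e - s t - s l) = coef q (e - s t - s k)" by blast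
    show "frac_coef F p k = frac_coef F q l"
    proof
      fix a
      have "coef p (a + s k) = coef q (a + s l)" if a: "indep (F \<union> keys a)"
      proof -
        have "keys (a + s (t + l + k)) \<subseteq> keys a \<union> F"
          using keys_add[of a "s (t + l + k)"] keys_constant_exp[OF fF, of "int (t + l + k)"] by (auto simp: s_def)
        then have "indep (keys (a + s (t + l + k)))" using a by (auto intro: indep_subset)
        from t[OF this] show ?thesis by (simp add: s_add algebra_simps)
      qed
      then show "frac_coef F p k a = frac_coef F q l a" by (simp add: frac_coef_def s_def)
    qed
  next
    assume eq: "frac_coef F p k = frac_coef F q l"
    \<comment> \<open>One extra factor \<open>var_prod F\<close> suffices. If the shifted exponent
      is not controlled by \<open>frac_coef\<close>, then independence of \<open>keys e\<close>
      forces \<open>e\<close> to vanish at some vertex of \<open>F\<close>, and the extra factor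
      makes both exponents negative there.\<close>
    have "coef p (e - s 1 - s l) = coef q (e - s 1 - s k)" if e: "indep (keys e)" for e
    proof (cases "indep (F \<union> keys (e - s (1 + l + k)))")
      case True
      then have eq': "coef p (e - s (1 + l + k) + s k) = coef q (e - s (1 + l + k) + s l)"
        using fun_cong[OF eq, of "e - s (1 + l + k)"] by (simp add: frac_coef_def s_def)
      have e: "e - s (1 + l + k) + s k = e - s 1 - s l" "e - s (1 + l + k) + s l = e - s 1 - s k"
        unfolding s_add by (simp_all add: algebra_simps)
      show ?thesis using eq' unfolding e .
    next
      case False
      have "\<not> F \<subseteq> keys e"
      proof
        assume sub: "F \<subseteq> keys e"
        have "keys (e - s (1 + l + k)) \<subseteq> keys e \<union> F"
          using keys_diff[of e "s (1 + l + k)"] keys_constant_exp[OF fF, of "int (1 + l + k)"] by (auto simp: s_def)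
        then show False using False indep_subset[OF e, of "F \<union> keys (e - s (1 + l + k))"] sub by auto
      qed
      then obtain v where v: "v \<in> F" "lookup e v = 0" by (auto simp: in_keys_iff)
      have neg: "lookup (e - s 1 - s i) v < 0" for i
        using v by (simp add: lookup_minus s_def lookup_constant_exp[OF fF])
      show ?thesis unfolding coef_negative[OF neg] ..
    qed
    then show "\<exists>t. \<forall>e. indep (keys e) \<longrightarrow> coef p (e - s t - s l) = coef q (e - s t - s k)" by blast
  qed
  finally show ?thesis .
qed

abbreviation frac :: "'w set \<Rightarrow> ('w, 'k::field) mpoly \<Rightarrow> nat \<Rightarrow> (('w, 'k) mpoly set \<times> nat) set" where
  "frac F p k \<equiv> loc_frac E (var_prod F) (cls p) k"

abbreviation Loc :: "'w set \<Rightarrow> (('w, 'k::field) mpoly, (('w, 'k) mpoly set \<times> nat) set) module" where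
  "Loc F \<equiv> loc_module E (var_prod F)"

lemma frac_eq:
  assumes F: "F \<subseteq> V" and p: "p \<in> polys"
  shows "frac F p k = {(cls q, l) | q l. q \<in> polys \<and> frac_coef F q l = frac_coef F p k}"
proof -
  have "(m, l) \<in> frac F p k \<longleftrightarrow> (\<exists>q. m = cls q \<and> q \<in> polys \<and> frac_coef F q l = frac_coef F p k)" for m l
  proof
    assume "(m, l) \<in> frac F p k"
    then have r: "((cls p, k), (m, l)) \<in> loc_rel E (var_prod F)" by (simp add: loc_frac_def)
    then have "m \<in> carrier E" by (simp add: loc_rel_def)
    then obtain q where q: "q \<in> polys" "m = cls q" by (auto simp: edge_module_carrier)
    then show "\<exists>q. m = cls q \<and> q \<in> polys \<and> frac_coef F q l = frac_coef F p k"
      using r loc_rel_iff[OF F p q(1)] by auto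
  next
    assume "\<exists>q. m = cls q \<and> q \<in> polys \<and> frac_coef F q l = frac_coef F p k"
    then show "(m, l) \<in> frac F p k" using loc_rel_iff[OF F p] by (auto simp: loc_frac_def)
  qed
  then show ?thesis by (auto simp: set_eq_iff)
qed

lemma frac_self: "F \<subseteq> V \<Longrightarrow> p \<in> polys \<Longrightarrow> (cls p, k) \<in> frac F p k"
  by (auto simp: frac_eq)

lemma frac_eq_iff:
  assumes "F \<subseteq> V" "p \<in> polys" "q \<in> polys"
  shows "frac F p k = frac F q l \<longleftrightarrow> frac_coef F p k = frac_coef F q l"
proof
  assume "frac F p k = frac F q l"
  then have "(cls p, k) \<in> frac F q l" using frac_self[OF assms(1,2), of k] by simp
  then show "frac_coef F p k = frac_coef F q l"
    using loc_rel_iff[OF assms(1,3,2)] by (simp add: loc_frac_def)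
qed (simp add: frac_eq assms)

lemma Loc_carrier: "F \<subseteq> V \<Longrightarrow> carrier (Loc F) = {frac F p k | p k. p \<in> polys}"
  by (auto simp: loc_module_def quotient_def edge_module_carrier loc_frac_def)

lemma frac_coef_shift:
  assumes "F \<subseteq> V"
  shows "frac_coef F (var_prod F ^ l * p) (k + l) = frac_coef F p k"
proof
  fix a
  have "constant_exp F (int k + int l) = constant_exp F (int k) + constant_exp F (int l)"
    using constant_exp_add[OF finite_sub[OF assms]] .
  then show "frac_coef F (var_prod F ^ l * p) (k + l) a = frac_coef F p k a"
    by (simp add: frac_coef_def coef_var_prod_power[OF assms])
qed

lemma frac_coef_add: "frac_coef F (p + q) k = (\<lambda>a. frac_coef F p k a + frac_coef F q k a)"
  by (auto simp: frac_coef_def coef_add)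

lemma frac_coef_const: "frac_coef F (poly_const c * p) k = (\<lambda>a. c * frac_coef F p k a)"
  by (auto simp: frac_coef_def coef_const_mult)

lemma Loc_add:
  fixes p p' :: "('w, 'k::field) mpoly"
  assumes F: "F \<subseteq> V" and p: "p \<in> polys" "p' \<in> polys"
  shows "frac F p k \<oplus>\<^bsub>Loc F\<^esub> frac F p' k' = frac F (var_prod F ^ k' * p + var_prod F ^ k * p') (k + k')"
proof -
  have eq: "frac_coef F (var_prod F ^ l' * q + var_prod F ^ l * q') (l + l') =
      (\<lambda>a. frac_coef F q l a + frac_coef F q' l' a)" for q q' :: "('w, 'k) mpoly" and l l'
    using frac_coef_shift[OF F, of l' q l] frac_coef_shift[OF F, of l q' l'] by (simp add: frac_coef_add add.commute)
  have "loc_frac E (var_prod F) (var_prod F ^ l' \<odot>\<^bsub>E\<^esub> m \<oplus>\<^bsub>E\<^esub> var_prod F ^ l \<odot>\<^bsub>E\<^esub> m') (l + l') =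
      frac F (var_prod F ^ k' * p + var_prod F ^ k * p') (k + k')"
    if m: "(m, l) \<in> frac F p k" "(m', l') \<in> frac F p' k'" for m l m' l'
  proof -
    obtain q where q: "m = cls q" "q \<in> polys" "frac_coef F q l = frac_coef F p k"
      using m(1) frac_eq[OF F p(1)] by auto
    obtain q' where q': "m' = cls q'" "q' \<in> polys" "frac_coef F q' l' = frac_coef F p' k'"
      using m(2) frac_eq[OF F p(2)] by auto
    have "var_prod F ^ l' \<odot>\<^bsub>E\<^esub> m \<oplus>\<^bsub>E\<^esub> var_prod F ^ l \<odot>\<^bsub>E\<^esub> m' = cls (var_prod F ^ l' * q + var_prod F ^ l * q')"
      using q q' F by (simp add: edge_module_var_prod edge_module_add var_prod_power_closed)
    then show ?thesis
      using F p q q' by (simp add: frac_eq_iff poly_ring_add_closed var_prod_power_closed eq)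
  qed
  then have "(\<Union>(m, l)\<in>frac F p k. \<Union>(m', l')\<in>frac F p' k'.
      loc_frac E (var_prod F) (var_prod F ^ l' \<odot>\<^bsub>E\<^esub> m \<oplus>\<^bsub>E\<^esub> var_prod F ^ l \<odot>\<^bsub>E\<^esub> m') (l + l')) =
      frac F (var_prod F ^ k' * p + var_prod F ^ k * p') (k + k')"
    using frac_self[OF F p(1), of k] frac_self[OF F p(2), of k'] by (intro UN_const) (auto intro!: UN_const)
  then show ?thesis by (simp add: loc_module_def)
qed

lemma Loc_add_coef:
  assumes F: "F \<subseteq> V" and p: "p \<in> polys" "p' \<in> polys"
  obtains r where "r \<in> polys" "frac F p k \<oplus>\<^bsub>Loc F\<^esub> frac F p' k' = frac F r (k + k')"
    "frac_coef F r (k + k') = (\<lambda>a. frac_coef F p k a + frac_coef F p' k' a)"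
proof (rule that)
  show "frac F p k \<oplus>\<^bsub>Loc F\<^esub> frac F p' k' = frac F (var_prod F ^ k' * p + var_prod F ^ k * p') (k + k')"
    by (rule Loc_add[OF assms])
  show "frac_coef F (var_prod F ^ k' * p + var_prod F ^ k * p') (k + k') = (\<lambda>a. frac_coef F p k a + frac_coef F p' k' a)"
    using frac_coef_shift[OF F, of k' p k] frac_coef_shift[OF F, of k p' k'] by (simp add: frac_coef_add add.commute)
qed (use F p in \<open>simp add: poly_ring_add_closed var_prod_power_closed\<close>)

lemma poly_const_closed: "p \<in> polys \<Longrightarrow> poly_const c * p \<in> polys"
  by (rule poly_ring_mult_closed) (simp_all add: poly_const_def poly_ring_single)

lemma Loc_smult:
  assumes F: "F \<subseteq> V" and p: "p \<in> polys"
  shows "poly_const c \<odot>\<^bsub>Loc F\<^esub> frac F p k = frac F (poly_const c * p) k"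
proof -
  have "loc_frac E (var_prod F) (poly_const c \<odot>\<^bsub>E\<^esub> m) l = frac F (poly_const c * p) k"
    if m: "(m, l) \<in> frac F p k" for m l
  proof -
    obtain q where q: "m = cls q" "q \<in> polys" "frac_coef F q l = frac_coef F p k"
      using m frac_eq[OF F p] by auto
    have "poly_const c \<odot>\<^bsub>E\<^esub> m = cls (poly_const c * q)"
      using edge_module_smult[of 0 q c] q by (simp add: poly_const_def)
    then show ?thesis using F p q by (simp add: frac_eq_iff poly_const_closed frac_coef_const)
  qed
  then have "(\<Union>(m, l)\<in>frac F p k. loc_frac E (var_prod F) (poly_const c \<odot>\<^bsub>E\<^esub> m) l) = frac F (poly_const c * p) k"
    using frac_self[OF F p, of k] by (intro UN_const) auto
  then show ?thesis by (simp add: loc_module_def)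
qed

lemma Loc_zero: "\<zero>\<^bsub>Loc F\<^esub> = frac F 0 0"
  by (simp add: loc_module_def edge_module_zero)

lemma frac_coef_zero [simp]: "frac_coef F 0 k = (\<lambda>_. 0)"
  by (auto simp: frac_coef_def coef_def)

lemma poly_var_power_closed: "v \<in> V \<Longrightarrow> p \<in> polys \<Longrightarrow> poly_var v ^ k * p \<in> polys"
  by (rule poly_ring_mult_closed) (simp_all add: poly_var_power poly_ring_single)

text \<open>In coordinates the map to the larger localization forgets the exponents whose support
  becomes dependent with \<open>v\<close> added and leaves the other coefficients alone.\<close>

lemma frac_coef_localize:
  assumes "F \<subseteq> V" "v \<notin> F"
  shows "frac_coef (insert v F) (poly_var v ^ k * p) k =
    (\<lambda>a. if indep (insert v F \<union> keys a) then frac_coef F p k a else 0)"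
proof
  fix a :: "'w \<Rightarrow>\<^sub>0 int"
  have "indep (F \<union> keys a)" if "indep (insert v F \<union> keys a)"
    using that by (rule indep_subset) auto
  moreover have "coef (poly_var v ^ k * p) (a + constant_exp (insert v F) (int k)) = coef p (a + constant_exp F (int k))"
  proof -
    have "a + constant_exp (insert v F) (int k) - int_exp (single v k) = a + constant_exp F (int k)"
      using finite_sub[OF assms(1)] assms(2) by (simp add: constant_exp_insert int_exp_single)
    then show ?thesis by (simp only: poly_var_power coef_monomial_mult mult_1)
  qed
  ultimately show "frac_coef (insert v F) (poly_var v ^ k * p) k a =
      (if indep (insert v F \<union> keys a) then frac_coef F p k a else 0)"
    by (simp add: frac_coef_def)
qed

lemma loc_map_frac:
  fixes p :: "('w, 'k::field) mpoly"
  assumes F: "F \<subseteq> V" and v: "v \<in> V" "v \<notin> F" and p: "p \<in> polys"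
  shows "loc_map E (var_prod F) (poly_var v) (frac F p k) = frac (insert v F) (poly_var v ^ k * p) k"
proof -
  have vF: "var_prod F * poly_var v = (var_prod (insert v F) :: ('w, 'k) mpoly)"
    by (rule var_prod_insert[OF finite_sub[OF F] v(2)])
  have iF: "insert v F \<subseteq> V" using F v by simp
  have "loc_frac E (var_prod (insert v F)) (poly_var v ^ l \<odot>\<^bsub>E\<^esub> m) l = frac (insert v F) (poly_var v ^ k * p) k"
    if m: "(m, l) \<in> frac F p k" for m l
  proof -
    obtain q where q: "m = cls q" "q \<in> polys" "frac_coef F q l = frac_coef F p k"
      using m frac_eq[OF F p] by auto
    have "poly_var v ^ l \<odot>\<^bsub>E\<^esub> m = cls (poly_var v ^ l * q)"
      using edge_module_smult[of "single v l" q 1] q v by (simp add: poly_var_power)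
    moreover have "frac_coef (insert v F) (poly_var v ^ l * q) l = frac_coef (insert v F) (poly_var v ^ k * p) k"
      unfolding frac_coef_localize[OF F v(2)] q(3) ..
    ultimately show ?thesis
      using iF p q(2) v(1) by (simp add: frac_eq_iff poly_var_power_closed)
  qed
  then have "(\<Union>(m, l)\<in>frac F p k. loc_frac E (var_prod (insert v F)) (poly_var v ^ l \<odot>\<^bsub>E\<^esub> m) l) = frac (insert v F) (poly_var v ^ k * p) k"
    using frac_self[OF F p, of k] by (intro UN_const) auto
  then show ?thesis by (simp add: loc_map_def vF)
qed

section \<open>Coordinates on the localizations\<close>

definition decode :: "'w set \<Rightarrow> (('w, 'k::field) mpoly set \<times> nat) set \<Rightarrow> ('w \<Rightarrow>\<^sub>0 int) \<Rightarrow> 'k" where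
  "decode F X = (THE \<phi>. \<exists>p\<in>polys. \<exists>k. X = frac F p k \<and> \<phi> = frac_coef F p k)"

lemma decode_frac: "F \<subseteq> V \<Longrightarrow> p \<in> polys \<Longrightarrow> decode F (frac F p k) = frac_coef F p k"
  unfolding decode_def by (rule the_equality) (auto simp: frac_eq_iff)

lemma LocE:
  assumes "F \<subseteq> V" "X \<in> carrier (Loc F)"
  obtains p k where "p \<in> polys" "X = frac F p k" "decode F X = frac_coef F p k"
proof -
  obtain p k where p: "p \<in> polys" "X = frac F p k" using assms by (auto simp: Loc_carrier)
  have "decode F X = frac_coef F p k" unfolding p(2) by (rule decode_frac[OF assms(1) p(1)])
  with p show ?thesis by (rule that)
qed

lemma LocI: "F \<subseteq> V \<Longrightarrow> p \<in> polys \<Longrightarrow> frac F p k \<in> carrier (Loc F)"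
  by (auto simp: Loc_carrier)

lemma decode_inj: "F \<subseteq> V \<Longrightarrow> X \<in> carrier (Loc F) \<Longrightarrow> Y \<in> carrier (Loc F) \<Longrightarrow> decode F X = decode F Y \<Longrightarrow> X = Y"
proof -
  assume F: "F \<subseteq> V" and X: "X \<in> carrier (Loc F)" and Y: "Y \<in> carrier (Loc F)" and eq: "decode F X = decode F Y"
  obtain p k where p: "p \<in> polys" "X = frac F p k" "decode F X = frac_coef F p k" using LocE[OF F X] .
  obtain q l where q: "q \<in> polys" "Y = frac F q l" "decode F Y = frac_coef F q l" using LocE[OF F Y] .
  have "frac_coef F p k = frac_coef F q l" using eq p(3) q(3) by simp
  then show "X = Y" unfolding p(2) q(2) frac_eq_iff[OF F p(1) q(1)] .
qed

lemma decode_add: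
  assumes "F \<subseteq> V" "X \<in> carrier (Loc F)" "Y \<in> carrier (Loc F)"
  shows "X \<oplus>\<^bsub>Loc F\<^esub> Y \<in> carrier (Loc F)" "decode F (X \<oplus>\<^bsub>Loc F\<^esub> Y) = (\<lambda>a. decode F X a + decode F Y a)"
proof -
  obtain p k where p: "p \<in> polys" "X = frac F p k" "decode F X = frac_coef F p k" using LocE[OF assms(1,2)] .
  obtain q l where q: "q \<in> polys" "Y = frac F q l" "decode F Y = frac_coef F q l" using LocE[OF assms(1,3)] .
  obtain r where r: "r \<in> polys" "frac F p k \<oplus>\<^bsub>Loc F\<^esub> frac F q l = frac F r (k + l)"
    "frac_coef F r (k + l) = (\<lambda>a. frac_coef F p k a + frac_coef F q l a)"
    using Loc_add_coef[OF assms(1) p(1) q(1)] .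
  show "X \<oplus>\<^bsub>Loc F\<^esub> Y \<in> carrier (Loc F)" unfolding p(2) q(2) r(2) by (rule LocI[OF assms(1) r(1)])
  show "decode F (X \<oplus>\<^bsub>Loc F\<^esub> Y) = (\<lambda>a. decode F X a + decode F Y a)"
    unfolding p(3) q(3) r(3)[symmetric] unfolding p(2) q(2) r(2) by (rule decode_frac[OF assms(1) r(1)])
qed

lemma decode_smult:
  assumes "F \<subseteq> V" "X \<in> carrier (Loc F)"
  shows "poly_const c \<odot>\<^bsub>Loc F\<^esub> X \<in> carrier (Loc F)" "decode F (poly_const c \<odot>\<^bsub>Loc F\<^esub> X) = (\<lambda>a. c * decode F X a)"
proof -
  obtain p k where p: "p \<in> polys" "X = frac F p k" "decode F X = frac_coef F p k" using LocE[OF assms] .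
  have eq: "poly_const c \<odot>\<^bsub>Loc F\<^esub> X = frac F (poly_const c * p) k" unfolding p(2) by (rule Loc_smult[OF assms(1) p(1)])
  show "poly_const c \<odot>\<^bsub>Loc F\<^esub> X \<in> carrier (Loc F)" unfolding eq by (rule LocI[OF assms(1) poly_const_closed[OF p(1)]])
  show "decode F (poly_const c \<odot>\<^bsub>Loc F\<^esub> X) = (\<lambda>a. c * decode F X a)"
    unfolding eq p(3) decode_frac[OF assms(1) poly_const_closed[OF p(1)]] by (rule frac_coef_const)
qed

lemma decode_zero: "F \<subseteq> V \<Longrightarrow> \<zero>\<^bsub>Loc F\<^esub> \<in> carrier (Loc F)" "F \<subseteq> V \<Longrightarrow> decode F (\<zero>\<^bsub>Loc F\<^esub>) = (\<lambda>_. 0 :: 'k::field)"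
  by (simp_all add: Loc_zero LocI decode_frac)

lemma decode_loc_map:
  assumes "F \<subseteq> V" "v \<in> V" "v \<notin> F" "X \<in> carrier (Loc F)"
  shows "loc_map E (var_prod F) (poly_var v) X \<in> carrier (Loc (insert v F))"
    "decode (insert v F) (loc_map E (var_prod F) (poly_var v) X) =
      (\<lambda>a. if indep (insert v F \<union> keys a) then decode F X a else 0)"
proof -
  obtain p k where p: "p \<in> polys" "X = frac F p k" "decode F X = frac_coef F p k" using LocE[OF assms(1,4)] .
  have iF: "insert v F \<subseteq> V" using assms by simp
  have eq: "loc_map E (var_prod F) (poly_var v) X = frac (insert v F) (poly_var v ^ k * p) k"
    unfolding p(2) by (rule loc_map_frac[OF assms(1-3) p(1)])
  note closed = poly_var_power_closed[OF assms(2) p(1), of k]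
  show "loc_map E (var_prod F) (poly_var v) X \<in> carrier (Loc (insert v F))" unfolding eq by (rule LocI[OF iF closed])
  show "decode (insert v F) (loc_map E (var_prod F) (poly_var v) X) =
      (\<lambda>a. if indep (insert v F \<union> keys a) then decode F X a else 0)"
    unfolding eq p(3) decode_frac[OF iF closed] by (rule frac_coef_localize[OF assms(1,3)])
qed

text \<open>Provides what the finite sums in the Cech differential require; the laws are pulled back
  along the injective \<open>decode\<close>.\<close>

lemma Loc_abelian_monoid:
  assumes F: "F \<subseteq> V"
  shows "abelian_monoid (Loc F :: (('w, 'k::field) mpoly, _) module)"
proof (rule abelian_monoidI)
  note d = decode_add[OF F] decode_zero[OF F]
  fix X Y Z :: "(('w, 'k) mpoly set \<times> nat) set"
  assume XY: "X \<in> carrier (Loc F)" "Y \<in> carrier (Loc F)"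
  show "X \<oplus>\<^bsub>Loc F\<^esub> Y = Y \<oplus>\<^bsub>Loc F\<^esub> X"
    by (rule decode_inj[OF F]) (use XY in \<open>simp_all add: d add.commute\<close>)
  assume Z: "Z \<in> carrier (Loc F)"
  show "X \<oplus>\<^bsub>Loc F\<^esub> Y \<oplus>\<^bsub>Loc F\<^esub> Z = X \<oplus>\<^bsub>Loc F\<^esub> (Y \<oplus>\<^bsub>Loc F\<^esub> Z)"
    by (rule decode_inj[OF F]) (use XY Z in \<open>simp_all add: d add.assoc\<close>)
next
  fix X :: "(('w, 'k) mpoly set \<times> nat) set" assume "X \<in> carrier (Loc F)"
  then show "\<zero>\<^bsub>Loc F\<^esub> \<oplus>\<^bsub>Loc F\<^esub> X = X"
    by (intro decode_inj[OF F]) (simp_all add: decode_add[OF F] decode_zero[OF F])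
qed (simp_all add: decode_add[OF F] decode_zero[OF F])

lemma decode_finsum:
  assumes F: "F \<subseteq> V" and A: "finite A" and X: "\<And>i. i \<in> A \<Longrightarrow> X i \<in> carrier (Loc F)"
  shows "(\<Oplus>\<^bsub>Loc F\<^esub>i\<in>A. X i) \<in> carrier (Loc F)" "decode F (\<Oplus>\<^bsub>Loc F\<^esub>i\<in>A. X i) = (\<lambda>a. \<Sum>i\<in>A. decode F (X i) a)"
proof -
  interpret abelian_monoid "Loc F" by (rule Loc_abelian_monoid[OF F])
  have "(\<Oplus>\<^bsub>Loc F\<^esub>i\<in>A. X i) \<in> carrier (Loc F) \<and> decode F (\<Oplus>\<^bsub>Loc F\<^esub>i\<in>A. X i) = (\<lambda>a. \<Sum>i\<in>A. decode F (X i) a)"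
    using A X
  proof (induction A rule: finite_induct)
    case (insert i A)
    then have "(\<Oplus>\<^bsub>Loc F\<^esub>i\<in>insert i A. X i) = X i \<oplus>\<^bsub>Loc F\<^esub> (\<Oplus>\<^bsub>Loc F\<^esub>i\<in>A. X i)"
      by (intro finsum_insert) auto
    then show ?case using insert decode_add[OF F, of "X i" "\<Oplus>\<^bsub>Loc F\<^esub>i\<in>A. X i"] by simp
  qed (simp add: decode_zero[OF F])
  then show "(\<Oplus>\<^bsub>Loc F\<^esub>i\<in>A. X i) \<in> carrier (Loc F)" "decode F (\<Oplus>\<^bsub>Loc F\<^esub>i\<in>A. X i) = (\<lambda>a. \<Sum>i\<in>A. decode F (X i) a)"
    by blast+
qed

end

section \<open>The Cech complex\<close>

lemma vectorspace_of_vec_iso: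
  fixes Q :: "('k::field, 'q, 'm) module_scheme" and f :: "'k vec \<Rightarrow> 'q"
  assumes inj: "inj_on f (carrier_vec n)" and carrier: "carrier Q = f ` carrier_vec n"
    and add: "\<And>u v. u \<in> carrier_vec n \<Longrightarrow> v \<in> carrier_vec n \<Longrightarrow> f u \<oplus>\<^bsub>Q\<^esub> f v = f (u + v)"
    and smult: "\<And>a v. v \<in> carrier_vec n \<Longrightarrow> a \<odot>\<^bsub>Q\<^esub> f v = f (a \<cdot>\<^sub>v v)"
    and zero: "\<zero>\<^bsub>Q\<^esub> = f (0\<^sub>v n)"
  shows "vectorspace class_ring Q" "vectorspace.fin_dim class_ring Q" "vectorspace.dim class_ring Q = n"
proof -
  have "abelian_group Q"
  proof (rule abelian_groupI)
    fix X assume "X \<in> carrier Q"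
    then obtain v where v: "v \<in> carrier_vec n" "X = f v" by (auto simp: carrier)
    then show "\<exists>Y\<in>carrier Q. Y \<oplus>\<^bsub>Q\<^esub> X = \<zero>\<^bsub>Q\<^esub>"
      by (intro bexI[of _ "f (- v)"]) (auto simp: carrier add zero)
  qed (auto simp: carrier add zero add_ac assoc_add_vec comm_add_vec)
  moreover have "Module.module_axioms class_ring Q"
    by (unfold_locales) (auto simp: carrier add smult add_smult_distrib_vec smult_add_distrib_vec smult_smult_assoc)
  ultimately have "Module.module class_ring Q"
    by (intro Module.module.intro class_cring.cring_axioms)
  then show vs: "vectorspace class_ring Q"
    unfolding vectorspace_def using class_field by blast
  interpret Vn: vectorspace class_ring "module_vec TYPE('k) n" by (rule vec_vs)
  interpret Q: vectorspace class_ring Q by (rule vs)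
  have fd: "vectorspace.fin_dim class_ring (module_vec TYPE('k) n)"
    by (rule vec_space.fin_dim)
  interpret L: linear_map class_ring "module_vec TYPE('k) n" Q f
    by unfold_locales (auto simp: module_hom_def module_vec_simps carrier add smult)
  have surj: "f ` carrier (module_vec TYPE('k) n) = carrier Q" by (simp add: module_vec_simps carrier)
  show "vectorspace.fin_dim class_ring Q" by (rule L.surj_fin_dim[OF fd surj])
  have "vectorspace.dim class_ring (module_vec TYPE('k) n) = vectorspace.dim class_ring Q"
    by (rule L.dim_eq[OF fd _ surj]) (simp add: module_vec_simps inj)
  then show "vectorspace.dim class_ring Q = n" by (simp add: vec_space.dim_is_n)
qed

text \<open>The cosets of \<open>B\<close> are the fibres of \<psi>. The hypothesis
  \<open>diff\<close> takes the place of subtraction, since \<open>M\<close> is only assumed to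
  satisfy the listed laws.\<close>

lemma quot_module_dim:
  fixes M :: "('k::field, 'a, 'm) module_scheme" and \<psi> :: "'a \<Rightarrow> 'k vec"
  assumes add: "\<And>z z'. z \<in> Z \<Longrightarrow> z' \<in> Z \<Longrightarrow> z \<oplus>\<^bsub>M\<^esub> z' \<in> Z \<and> \<psi> (z \<oplus>\<^bsub>M\<^esub> z') = \<psi> z + \<psi> z'"
    and smult: "\<And>a z. z \<in> Z \<Longrightarrow> a \<odot>\<^bsub>M\<^esub> z \<in> Z \<and> \<psi> (a \<odot>\<^bsub>M\<^esub> z) = a \<cdot>\<^sub>v \<psi> z"
    and assoc: "\<And>u v w. u \<in> Z \<Longrightarrow> v \<in> Z \<Longrightarrow> w \<in> Z \<Longrightarrow> u \<oplus>\<^bsub>M\<^esub> v \<oplus>\<^bsub>M\<^esub> w = u \<oplus>\<^bsub>M\<^esub> (v \<oplus>\<^bsub>M\<^esub> w)"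
    and surj: "\<psi> ` Z = carrier_vec n"
    and B: "B = {z \<in> Z. \<psi> z = 0\<^sub>v n}"
    and diff: "\<And>z z'. z \<in> Z \<Longrightarrow> z' \<in> Z \<Longrightarrow> \<psi> z = \<psi> z' \<Longrightarrow> \<exists>b\<in>B. z' = b \<oplus>\<^bsub>M\<^esub> z"
  shows "vectorspace class_ring (quot_module M Z B)" "vectorspace.fin_dim class_ring (quot_module M Z B)"
    "vectorspace.dim class_ring (quot_module M Z B) = n"
proof -
  define fib where "fib = (\<lambda>w. {z \<in> Z. \<psi> z = w})"
  have vecs: "\<psi> z \<in> carrier_vec n" if "z \<in> Z" for z using that surj by blast
  have coset: "B +>\<^bsub>M\<^esub> z = fib (\<psi> z)" if z: "z \<in> Z" for z
  proof (intro equalityI subsetI)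
    fix u assume "u \<in> B +>\<^bsub>M\<^esub> z"
    then obtain b where b: "b \<in> B" "u = b \<oplus>\<^bsub>M\<^esub> z" by (auto simp: a_r_coset_def')
    then show "u \<in> fib (\<psi> z)" using add[of b z] z vecs[OF z] by (auto simp: B fib_def)
  next
    fix u assume "u \<in> fib (\<psi> z)"
    then have "u \<in> Z" "\<psi> z = \<psi> u" by (auto simp: fib_def)
    then show "u \<in> B +>\<^bsub>M\<^esub> z" using diff[OF z, of u] by (auto simp: a_r_coset_def')
  qed
  have ex: "\<exists>z. z \<in> fib w" if "w \<in> carrier_vec n" for w
  proof -
    have "w \<in> \<psi> ` Z" using that surj by simp
    then show ?thesis by (auto simp: fib_def)
  qed
  have fib_add: "fib u <+>\<^bsub>M\<^esub> fib v = fib (u + v)" if u: "u \<in> carrier_vec n" and v: "v \<in> carrier_vec n" for u v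
  proof (intro equalityI subsetI)
    fix z assume "z \<in> fib u <+>\<^bsub>M\<^esub> fib v"
    then show "z \<in> fib (u + v)" using add by (auto simp: set_add_def' fib_def)
  next
    fix z assume z: "z \<in> fib (u + v)"
    obtain p q where pq: "p \<in> fib u" "q \<in> fib v" using ex u v by blast
    then have pq': "p \<in> Z" "q \<in> Z" "\<psi> p = u" "\<psi> q = v" by (auto simp: fib_def)
    obtain b where b: "b \<in> B" "z = b \<oplus>\<^bsub>M\<^esub> (p \<oplus>\<^bsub>M\<^esub> q)"
      using diff[of "p \<oplus>\<^bsub>M\<^esub> q" z] z add[OF pq'(1,2)] pq' by (auto simp: fib_def)
    then have bZ: "b \<in> Z" "\<psi> b = 0\<^sub>v n" by (auto simp: B)
    have "z = (b \<oplus>\<^bsub>M\<^esub> p) \<oplus>\<^bsub>M\<^esub> q" using b assoc bZ pq' by simp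
    moreover have "b \<oplus>\<^bsub>M\<^esub> p \<in> fib u" using add[OF bZ(1) pq'(1)] bZ pq' u by (simp add: fib_def)
    ultimately show "z \<in> fib u <+>\<^bsub>M\<^esub> fib v" using pq by (auto simp: set_add_def')
  qed
  have fib_smult: "(\<Union>z\<in>fib w. B +>\<^bsub>M\<^esub> (a \<odot>\<^bsub>M\<^esub> z)) = fib (a \<cdot>\<^sub>v w)" if w: "w \<in> carrier_vec n" for a w
  proof (rule UN_const)
    show "fib w \<noteq> {}" using ex[OF w] by blast
    show "B +>\<^bsub>M\<^esub> (a \<odot>\<^bsub>M\<^esub> z) = fib (a \<cdot>\<^sub>v w)" if "z \<in> fib w" for z
      using that smult[of z a] coset[of "a \<odot>\<^bsub>M\<^esub> z"] by (simp add: fib_def)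
  qed
  have carrier: "carrier (quot_module M Z B) = fib ` carrier_vec n"
  proof -
    have "{B +>\<^bsub>M\<^esub> z | z. z \<in> Z} = fib ` (\<psi> ` Z)" using coset by blast
    then show ?thesis by (simp add: quot_module_def surj)
  qed
  have inj: "inj_on fib (carrier_vec n)"
  proof (rule inj_onI)
    fix u v assume "u \<in> carrier_vec n" "v \<in> carrier_vec n" "fib u = fib v"
    then show "u = v" using ex[of u] by (auto simp: fib_def)
  qed
  have zero: "B = fib (0\<^sub>v n)" by (simp add: B fib_def)
  have "fib u \<oplus>\<^bsub>quot_module M Z B\<^esub> fib v = fib (u + v)" if "u \<in> carrier_vec n" "v \<in> carrier_vec n" for u v
    using fib_add[OF that] by (simp add: quot_module_def)
  moreover have "a \<odot>\<^bsub>quot_module M Z B\<^esub> fib v = fib (a \<cdot>\<^sub>v v)" if "v \<in> carrier_vec n" for a v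
    using fib_smult[OF that] by (simp add: quot_module_def)
  moreover have "\<zero>\<^bsub>quot_module M Z B\<^esub> = fib (0\<^sub>v n)" using zero by (simp add: quot_module_def)
  ultimately show "vectorspace class_ring (quot_module M Z B)" "vectorspace.fin_dim class_ring (quot_module M Z B)"
    "vectorspace.dim class_ring (quot_module M Z B) = n"
    using vectorspace_of_vec_iso[OF inj carrier] by blast+
qed

text \<open>Extracts a homogeneous primitive from one of mixed degree. Values of the coboundary
  outside degree \<open>Suc p\<close> may be wrong for \<open>b\<close>; truncation removes
  them.\<close>

lemma cobdry_restrict_degree:
  fixes b f :: "'w set \<Rightarrow> 'k::field"
  assumes fin: "\<forall>F\<in>B. finite F" and f: "\<And>F. card F \<noteq> Suc p \<Longrightarrow> f F = 0"
    and eq: "\<And>F. card F = Suc p \<Longrightarrow> f F = cobdry h B b F"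
  shows "cobdry h B (restrict_to {F. card F = p} b) = f"
proof
  fix F
  show "cobdry h B (restrict_to {F. card F = p} b) F = f F"
  proof (cases "F \<in> B")
    case True
    then have card: "Suc (card (F - {v})) = card F" if "v \<in> F" for v
    proof -
      have "finite F" using fin True by blast
      then show ?thesis using that by (rule card_Suc_Diff1)
    qed
    show ?thesis
    proof (cases "card F = Suc p")
      case True
      have "cobdry h B (restrict_to {F. card F = p} b) F = cobdry h B b F"
        unfolding cobdry_def by (intro if_cong sum.cong refl) (use card True in \<open>auto simp: restrict_to_def\<close>)
      then show ?thesis using eq True by simp
    next
      case False
      have "cobdry h B (restrict_to {F. card F = p} b) F = 0"
        unfolding cobdry_def using card False by (auto simp: restrict_to_def intro!: sum.neutral)
      then show ?thesis using f False by simp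
    qed
  next
    case False
    then have "cobdry h B b' F = 0" for b' :: "'w set \<Rightarrow> 'k" by (simp add: cobdry_def)
    then show ?thesis using f[of F] eq[of F] by (cases "card F = Suc p") auto
  qed
qed

section \<open>The Cech cochains split by exponents\<close>

context edge_ring
begin

definition total :: "('w \<Rightarrow>\<^sub>0 int) \<Rightarrow> int" where
  "total a = (\<Sum>v\<in>keys a. lookup a v)"

lemma total_eq: "keys a \<subseteq> V \<Longrightarrow> total a = (\<Sum>v\<in>V. lookup a v)"
  unfolding total_def by (rule sum.mono_neutral_left[OF finite_V]) (auto simp: in_keys_iff)

lemma total_shift:
  assumes "F \<subseteq> V" "keys a \<subseteq> V"
  shows "total (a + constant_exp F k) = total a + k * int (card F)"
proof -
  have "keys (a + constant_exp F k) \<subseteq> V"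
    using keys_add[of a "constant_exp F k"] keys_constant_exp[OF finite_sub[OF assms(1)], of k] assms by blast
  then have "total (a + constant_exp F k) = (\<Sum>v\<in>V. lookup a v) + (\<Sum>v\<in>V. if v \<in> F then k else 0)"
    by (simp add: total_eq lookup_add lookup_constant_exp[OF finite_sub[OF assms(1)]] sum.distrib)
  also have "(\<Sum>v\<in>V. if v \<in> F then k else 0) = k * int (card F)"
    using assms(1) by (simp add: sum.If_cases finite_V Int_absorb1)
  finally show ?thesis using assms(2) by (simp add: total_eq)
qed

lemma poly_hom_iff: "p \<in> poly_hom V \<delta> \<longleftrightarrow> p \<in> polys \<and> (\<forall>m\<in>keys p. total (int_exp m) = \<delta>)"
  by (simp add: poly_hom_def total_def)

text \<open>The sets \<open>F\<close> for which the localization at \<open>var_prod F\<close> is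
  nonzero in multidegree \<open>a\<close>: denominators exist only at vertices of \<open>F\<close>,
  and a monomial dies if its support together with \<open>F\<close> contains an edge.\<close>

definition cech_block :: "('w \<Rightarrow>\<^sub>0 int) \<Rightarrow> 'w set set" where
  "cech_block a = {F. {v. lookup a v < 0} \<subseteq> F \<and> indep (F \<union> keys a)}"

text \<open>Describes the image of the homogeneous fractions under \<open>decode\<close>; necessity
  is \<open>Loc_hom_decode\<close>, sufficiency is \<open>Loc_hom_encode\<close>.\<close>

definition hom_coefs :: "'w set \<Rightarrow> int \<Rightarrow> (('w \<Rightarrow>\<^sub>0 int) \<Rightarrow> 'k::field) \<Rightarrow> bool" where
  "hom_coefs F \<delta> \<phi> \<longleftrightarrow> finite {a. \<phi> a \<noteq> 0} \<and> (\<forall>a. \<phi> a \<noteq> 0 \<longrightarrow> F \<in> cech_block a \<and> total a = \<delta>)"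

abbreviation Loc_hom :: "'w set \<Rightarrow> int \<Rightarrow> (('w, 'k::field) mpoly set \<times> nat) set set" where
  "Loc_hom F \<delta> \<equiv> loc_hom E (edge_module_hom G) F \<delta>"

lemma Loc_hom_eq: "Loc_hom F \<delta> = {frac F p k | p k. p \<in> poly_hom V (\<delta> + int k * int (card F))}"
  by (auto simp: loc_hom_def edge_module_hom_def cls_def)

lemma block_keys: "F \<in> cech_block a \<Longrightarrow> keys a \<subseteq> V \<and> F \<subseteq> V"
  using indep_V by (auto simp: cech_block_def)

lemma Loc_hom_decode:
  assumes F: "F \<subseteq> V" and X: "X \<in> Loc_hom F \<delta>"
  shows "X \<in> carrier (Loc F)" "hom_coefs F \<delta> (decode F X)"
proof -
  obtain p k where p: "X = frac F p k" "p \<in> poly_hom V (\<delta> + int k * int (card F))"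
    using X by (auto simp: Loc_hom_eq)
  have pp: "p \<in> polys" using p(2) by (simp add: poly_hom_iff)
  show "X \<in> carrier (Loc F)" unfolding p(1) by (rule LocI[OF F pp])
  have supp: "F \<in> cech_block a \<and> total a = \<delta> \<and> a \<in> (\<lambda>m. int_exp m - constant_exp F (int k)) ` keys p"
    if "frac_coef F p k a \<noteq> 0" for a
  proof -
    have ind: "indep (F \<union> keys a)" and "coef p (a + constant_exp F (int k)) \<noteq> 0"
      using that by (auto simp: frac_coef_def split: if_splits)
    then obtain m where m: "m \<in> keys p" "a + constant_exp F (int k) = int_exp m" by (metis coef_nonzeroE)
    have "v \<in> F" if "lookup a v < 0" for v
    proof (rule ccontr)
      assume "v \<notin> F"
      then have "lookup (int_exp m) v < 0"
        using that by (simp flip: m(2) add: lookup_add lookup_constant_exp[OF finite_sub[OF F]])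
      then show False by simp
    qed
    moreover have "total a + int k * int (card F) = \<delta> + int k * int (card F)"
      using total_shift[OF F, of a "int k"] indep_V[OF ind] p(2) m by (simp add: poly_hom_iff)
    moreover have "a = int_exp m - constant_exp F (int k)" by (simp flip: m(2))
    ultimately show ?thesis using ind m(1) by (auto simp: cech_block_def)
  qed
  have "finite {a. frac_coef F p k a \<noteq> 0}"
    by (rule finite_subset[of _ "(\<lambda>m. int_exp m - constant_exp F (int k)) ` keys p"]) (use supp in auto)
  then show "hom_coefs F \<delta> (decode F X)"
    unfolding p(1) decode_frac[OF F pp] hom_coefs_def using supp by blast
qed

lemma Loc_hom_encode:
  fixes \<phi> :: "('w \<Rightarrow>\<^sub>0 int) \<Rightarrow> 'k::field"
  assumes F: "F \<subseteq> V" and \<phi>: "hom_coefs F \<delta> \<phi>"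
  obtains X where "X \<in> Loc_hom F \<delta>" "decode F X = \<phi>"
proof -
  define A where "A = {a. \<phi> a \<noteq> 0}"
  have finA: "finite A" and A: "\<And>a. a \<in> A \<Longrightarrow> F \<in> cech_block a \<and> total a = \<delta>"
    using \<phi> by (auto simp: hom_coefs_def A_def)
  \<comment> \<open>The exponent of a common denominator: it bounds all negative entries that occur.
    Entries outside \<open>F\<close> are not shifted, but they are non-negative because
    \<open>F\<close> lies in the block.\<close>
  define k where "k = (\<Sum>a\<in>A. \<Sum>v\<in>V. nat (- lookup a v))"
  have k: "- lookup a v \<le> int k" if "a \<in> A" "v \<in> V" for a v
  proof -
    have "nat (- lookup a v) \<le> (\<Sum>v\<in>V. nat (- lookup a v))"
      by (rule member_le_sum) (use that finite_V in auto)
    also have "\<dots> \<le> k" unfolding k_def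
      by (rule member_le_sum[of a A "\<lambda>a. \<Sum>v\<in>V. nat (- lookup a v)"]) (use that finA in auto)
    finally show ?thesis by simp
  qed
  note lsf = lookup_constant_exp[OF finite_sub[OF F]]
  have "\<exists>m. a + constant_exp F (int k) = int_exp m" if a: "a \<in> A" for a
  proof -
    have "0 \<le> lookup (a + constant_exp F (int k)) v" for v
    proof (cases "v \<in> F")
      case True
      then show ?thesis using k[OF a, of v] F by (auto simp: lookup_add lsf)
    next
      case False
      moreover from this have "\<not> lookup a v < 0" using A[OF a] by (auto simp: cech_block_def)
      ultimately show ?thesis by (simp add: lookup_add lsf)
    qed
    then show ?thesis using int_exp_surj by metis
  qed
  then obtain \<mu> where \<mu>: "\<And>a. a \<in> A \<Longrightarrow> a + constant_exp F (int k) = int_exp (\<mu> a)" by metis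
  define p where "p = (\<Sum>a\<in>A. single (\<mu> a) (\<phi> a))"
  have keys_p: "keys p \<subseteq> \<mu> ` A"
  proof
    fix m assume "m \<in> keys p"
    then have "(\<Sum>a\<in>A. lookup (single (\<mu> a) (\<phi> a)) m) \<noteq> 0"
      by (simp add: in_keys_iff p_def lookup_sum)
    then obtain a where "a \<in> A" "lookup (single (\<mu> a) (\<phi> a)) m \<noteq> 0"
      by (meson sum.neutral)
    then show "m \<in> \<mu> ` A" by (auto simp: lookup_single when_def split: if_splits)
  qed
  have \<mu>_prop: "keys (\<mu> a) \<subseteq> V \<and> total (int_exp (\<mu> a)) = \<delta> + int k * int (card F)" if a: "a \<in> A" for a
  proof -
    have "keys (int_exp (\<mu> a)) \<subseteq> V"
      using keys_add[of a "constant_exp F (int k)"] keys_constant_exp[OF finite_sub[OF F], of "int k"] F block_keys[of F a] A[OF a]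
      by (auto simp flip: \<mu>[OF a])
    moreover have "total (int_exp (\<mu> a)) = \<delta> + int k * int (card F)"
      unfolding \<mu>[OF a, symmetric] using total_shift[OF F, of a "int k"] A[OF a] block_keys[of F a] by simp
    ultimately show ?thesis by simp
  qed
  have php: "p \<in> poly_hom V (\<delta> + int k * int (card F))"
    using keys_p \<mu>_prop by (auto simp: poly_hom_iff carrier_poly_ring)
  then have pp: "p \<in> polys" by (simp add: poly_hom_iff)
  have "frac_coef F p k a = \<phi> a" for a
  proof -
    have "coef p (a + constant_exp F (int k)) = (\<Sum>b\<in>A. if b = a then \<phi> b else 0)"
      unfolding p_def coef_sum by (intro sum.cong) (auto simp: coef_single simp flip: \<mu>)
    also have "\<dots> = \<phi> a" using finA by (auto simp: A_def)
    finally have "coef p (a + constant_exp F (int k)) = \<phi> a" .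
    moreover have "indep (F \<union> keys a)" if "\<phi> a \<noteq> 0"
      using A[of a] that by (simp add: A_def cech_block_def)
    ultimately show ?thesis by (auto simp: frac_coef_def)
  qed
  then have "decode F (frac F p k) = \<phi>" unfolding decode_frac[OF F pp] by blast
  moreover have "frac F p k \<in> Loc_hom F \<delta>" using php by (auto simp: Loc_hom_eq)
  ultimately show ?thesis using that by blast
qed

abbreviation pos :: "'w \<Rightarrow> nat" where "pos \<equiv> vertex_pos V"

lemma inj_pos: "inj_on pos V"
proof -
  have "\<exists>h :: 'w \<Rightarrow> nat. inj_on h V" using finite_imp_inj_to_nat_seg[OF finite_V] by blast
  then show ?thesis unfolding vertex_pos_def by (rule someI_ex)
qed

abbreviation cochains :: "nat \<Rightarrow> int \<Rightarrow> ('k::field, 'w set \<Rightarrow> (('w, 'k) mpoly set \<times> nat) set) module" where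
  "cochains p \<delta> \<equiv> cech_cochains V E (edge_module_hom G) p \<delta>"

text \<open>A Cech cochain as a family of cochains on the blocks of the multigraded pieces.\<close>

definition unravel :: "nat \<Rightarrow> ('w set \<Rightarrow> (('w, 'k::field) mpoly set \<times> nat) set) \<Rightarrow> ('w \<Rightarrow>\<^sub>0 int) \<Rightarrow> 'w set \<Rightarrow> 'k" where
  "unravel p c a F = (if F \<subseteq> V \<and> card F = p then decode F (c F) a else 0)"

text \<open>Finitely many exponents in total, since there are finitely many sets \<open>F\<close>
  and each component is a single fraction.\<close>

definition block_cochains :: "nat \<Rightarrow> int \<Rightarrow> (('w \<Rightarrow>\<^sub>0 int) \<Rightarrow> 'w set \<Rightarrow> 'k::field) set" where
  "block_cochains p \<delta> = {g. finite {a. g a \<noteq> (\<lambda>_. 0)} \<and>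
     (\<forall>a F. g a F \<noteq> 0 \<longrightarrow> card F = p \<and> F \<in> cech_block a \<and> total a = \<delta>)}"

lemma cochains_carrier:
  "c \<in> carrier (cochains p \<delta>) \<longleftrightarrow> c \<in> (\<Pi>\<^sub>E F\<in>{F. F \<subseteq> V \<and> card F = p}. Loc_hom F \<delta>)"
  by (simp add: cech_cochains_def Let_def)

lemma unravel_in:
  assumes c: "c \<in> carrier (cochains p \<delta>)"
  shows "unravel p c \<in> block_cochains p \<delta>"
proof -
  let ?FF = "{F. F \<subseteq> V \<and> card F = p}"
  have h: "hom_coefs F \<delta> (decode F (c F))" if "F \<in> ?FF" for F
    using Loc_hom_decode(2)[of F "c F"] c that by (auto simp: cochains_carrier)
  have "{a. unravel p c a \<noteq> (\<lambda>_. 0)} \<subseteq> (\<Union>F\<in>?FF. {a. decode F (c F) a \<noteq> 0})"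
    by (auto simp: unravel_def fun_eq_iff)
  moreover have "finite (\<Union>F\<in>?FF. {a. decode F (c F) a \<noteq> 0})"
    using h finite_V by (intro finite_UN_I) (auto simp: hom_coefs_def intro: finite_subset[of _ "Pow V"])
  ultimately have "finite {a. unravel p c a \<noteq> (\<lambda>_. 0)}" by (rule finite_subset)
  moreover have "card F = p \<and> F \<in> cech_block a \<and> total a = \<delta>" if "unravel p c a F \<noteq> 0" for a F
  proof -
    have F: "F \<in> ?FF" and "decode F (c F) a \<noteq> 0" using that by (auto simp: unravel_def split: if_splits)
    then show ?thesis using h[OF F] by (auto simp: hom_coefs_def)
  qed
  ultimately show ?thesis unfolding block_cochains_def by blast
qed

lemma unravel_inj:
  assumes c: "c \<in> carrier (cochains p \<delta>)" "c' \<in> carrier (cochains p \<delta>)" and eq: "unravel p c = unravel p c'"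
  shows "c = c'"
proof (rule PiE_ext)
  show "c \<in> (\<Pi>\<^sub>E F\<in>{F. F \<subseteq> V \<and> card F = p}. Loc_hom F \<delta>)" "c' \<in> (\<Pi>\<^sub>E F\<in>{F. F \<subseteq> V \<and> card F = p}. Loc_hom F \<delta>)"
    using c by (simp_all add: cochains_carrier)
  fix F assume F: "F \<in> {F. F \<subseteq> V \<and> card F = p}"
  then have FV: "F \<subseteq> V" by simp
  have "c F \<in> Loc_hom F \<delta>" "c' F \<in> Loc_hom F \<delta>" using c F by (auto simp: cochains_carrier)
  then have "c F \<in> carrier (Loc F)" "c' F \<in> carrier (Loc F)" using Loc_hom_decode(1)[OF FV] by blast+
  moreover have "decode F (c F) a = decode F (c' F) a" for a
    using fun_cong[OF fun_cong[OF eq, of a], of F] F by (simp add: unravel_def)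
  ultimately show "c F = c' F" using decode_inj[OF FV] by blast
qed

lemma block_hom_coefs:
  assumes "g \<in> block_cochains p \<delta>"
  shows "hom_coefs F \<delta> (\<lambda>a. g a F)"
proof -
  have "{a. g a F \<noteq> 0} \<subseteq> {a. g a \<noteq> (\<lambda>_. 0)}" by auto
  then have "finite {a. g a F \<noteq> 0}" using assms finite_subset by (auto simp: block_cochains_def)
  then show ?thesis using assms by (auto simp: hom_coefs_def block_cochains_def)
qed

lemma ravel:
  fixes g :: "('w \<Rightarrow>\<^sub>0 int) \<Rightarrow> 'w set \<Rightarrow> 'k::field"
  assumes g: "g \<in> block_cochains p \<delta>"
  obtains c where "c \<in> carrier (cochains p \<delta>)" "unravel p c = g"
proof -
  let ?FF = "{F. F \<subseteq> V \<and> card F = p}"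
  have "\<exists>X. X \<in> Loc_hom F \<delta> \<and> decode F X = (\<lambda>a. g a F)" if F: "F \<in> ?FF" for F
    by (rule Loc_hom_encode[of F \<delta> "\<lambda>a. g a F"]) (use F block_hom_coefs[OF g] in auto)
  then obtain X where X: "\<And>F. F \<in> ?FF \<Longrightarrow> X F \<in> Loc_hom F \<delta> \<and> decode F (X F) = (\<lambda>a. g a F)" by metis
  show ?thesis
  proof (rule that[of "\<lambda>F\<in>?FF. X F"])
    show "(\<lambda>F\<in>?FF. X F) \<in> carrier (cochains p \<delta>)" using X by (simp add: cochains_carrier)
    have "g a F = 0" if "F \<notin> ?FF" for a F
    proof (rule ccontr)
      assume "g a F \<noteq> 0"
      then have "card F = p" "F \<in> cech_block a" using g by (auto simp: block_cochains_def)
      then show False using block_keys[of F a] that by simp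
    qed
    then show "unravel p (\<lambda>F\<in>?FF. X F) = g" using X by (auto simp: unravel_def fun_eq_iff)
  qed
qed

text \<open>Homogeneity of the values need not be checked on fractions: a homogeneous fraction with
  the same coordinates exists, and \<open>decode\<close> is injective.\<close>

lemma cochain_memI:
  fixes c :: "'w set \<Rightarrow> (('w, 'k::field) mpoly set \<times> nat) set"
  assumes ext: "c \<in> extensional {F. F \<subseteq> V \<and> card F = p}"
    and loc: "\<And>F. F \<subseteq> V \<Longrightarrow> card F = p \<Longrightarrow> c F \<in> carrier (Loc F)"
    and un: "unravel p c \<in> block_cochains p \<delta>"
  shows "c \<in> carrier (cochains p \<delta>)"
  unfolding cochains_carrier
proof (rule PiE_I)
  fix F assume "F \<in> {F. F \<subseteq> V \<and> card F = p}"
  then have F: "F \<subseteq> V" "card F = p" by auto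
  have "hom_coefs F \<delta> (decode F (c F))"
    using block_hom_coefs[OF un, of F] F by (simp add: unravel_def)
  then obtain X where X: "X \<in> Loc_hom F \<delta>" "decode F X = decode F (c F)" using Loc_hom_encode[OF F(1)] by blast
  have "X = c F" by (rule decode_inj[OF F(1) Loc_hom_decode(1)[OF F(1) X(1)] loc[OF F] X(2)])
  then show "c F \<in> Loc_hom F \<delta>" using X(1) by simp
qed (use ext in \<open>auto simp: extensional_def\<close>)

lemma cochain_loc: "c \<in> carrier (cochains p \<delta>) \<Longrightarrow> F \<subseteq> V \<Longrightarrow> card F = p \<Longrightarrow> c F \<in> carrier (Loc F)"
  using Loc_hom_decode(1)[of F "c F" \<delta>] by (auto simp: cochains_carrier)

lemma block_cochains_add:
  assumes "g \<in> block_cochains p \<delta>" "g' \<in> block_cochains p \<delta>"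
  shows "(\<lambda>a F. g a F + g' a F) \<in> block_cochains p \<delta>"
proof -
  have "{a. (\<lambda>F. g a F + g' a F) \<noteq> (\<lambda>_. 0)} \<subseteq> {a. g a \<noteq> (\<lambda>_. 0)} \<union> {a. g' a \<noteq> (\<lambda>_. 0)}" by auto
  then have "finite {a. (\<lambda>F. g a F + g' a F) \<noteq> (\<lambda>_. 0)}"
    by (rule finite_subset) (use assms in \<open>auto simp: block_cochains_def\<close>)
  moreover have "g a F \<noteq> 0 \<or> g' a F \<noteq> 0" if "g a F + g' a F \<noteq> 0" for a F using that by auto
  ultimately show ?thesis using assms unfolding block_cochains_def by blast
qed

lemma block_cochains_scale:
  assumes "g \<in> block_cochains p \<delta>"
  shows "(\<lambda>a F. r * g a F) \<in> block_cochains p \<delta>"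
proof -
  have "{a. (\<lambda>F. r * g a F) \<noteq> (\<lambda>_. 0)} \<subseteq> {a. g a \<noteq> (\<lambda>_. 0)}" by auto
  then have "finite {a. (\<lambda>F. r * g a F) \<noteq> (\<lambda>_. 0)}"
    by (rule finite_subset) (use assms in \<open>auto simp: block_cochains_def\<close>)
  then show ?thesis using assms by (auto simp: block_cochains_def)
qed

lemma block_cochains_cobdry:
  assumes g: "g \<in> block_cochains p \<delta>"
  shows "(\<lambda>a. cobdry pos (cech_block a) (g a)) \<in> block_cochains (Suc p) \<delta>"
proof -
  have "{a. cobdry pos (cech_block a) (g a) \<noteq> (\<lambda>_. 0)} \<subseteq> {a. g a \<noteq> (\<lambda>_. 0)}" by auto
  then have "finite {a. cobdry pos (cech_block a) (g a) \<noteq> (\<lambda>_. 0)}"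
    by (rule finite_subset) (use g in \<open>auto simp: block_cochains_def\<close>)
  moreover have "card F = Suc p \<and> F \<in> cech_block a \<and> total a = \<delta>" if nz: "cobdry pos (cech_block a) (g a) F \<noteq> 0" for a F
  proof -
    have F: "F \<in> cech_block a" using nz by (auto simp: cobdry_def split: if_splits)
    then have "(\<Sum>v\<in>F. below_sign pos F v * g a (F - {v})) \<noteq> 0" using nz by (simp add: cobdry_def)
    then obtain v where v: "v \<in> F" "g a (F - {v}) \<noteq> 0" by (metis (no_types, lifting) mult_zero_right sum.neutral)
    then have "card (F - {v}) = p" "total a = \<delta>" using g by (auto simp: block_cochains_def)
    then show ?thesis using F v(1) finite_sub[of F] block_keys[OF F] card_Suc_Diff1[of F v] by auto
  qed
  ultimately show ?thesis unfolding block_cochains_def by blast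
qed

lemma unravel_add:
  fixes c c' :: "'w set \<Rightarrow> (('w, 'k::field) mpoly set \<times> nat) set"
  assumes c: "c \<in> carrier (cochains p \<delta>)" "c' \<in> carrier (cochains p \<delta>)"
  shows "c \<oplus>\<^bsub>cochains p \<delta>\<^esub> c' \<in> carrier (cochains p \<delta>)"
    "unravel p (c \<oplus>\<^bsub>cochains p \<delta>\<^esub> c') = (\<lambda>a F. unravel p c a F + unravel p c' a F)"
proof -
  let ?FF = "{F. F \<subseteq> V \<and> card F = p}"
  have eq: "c \<oplus>\<^bsub>cochains p \<delta>\<^esub> c' = (\<lambda>F\<in>?FF. c F \<oplus>\<^bsub>Loc F\<^esub> c' F)" by (simp add: cech_cochains_def Let_def)
  note loc = decode_add[OF _ cochain_loc[OF c(1)] cochain_loc[OF c(2)]]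
  show un: "unravel p (c \<oplus>\<^bsub>cochains p \<delta>\<^esub> c') = (\<lambda>a F. unravel p c a F + unravel p c' a F)"
    unfolding eq by (auto simp: unravel_def fun_eq_iff loc)
  have "unravel p (c \<oplus>\<^bsub>cochains p \<delta>\<^esub> c') \<in> block_cochains p \<delta>"
    unfolding un by (intro block_cochains_add unravel_in c)
  then show "c \<oplus>\<^bsub>cochains p \<delta>\<^esub> c' \<in> carrier (cochains p \<delta>)"
    unfolding eq by (intro cochain_memI) (auto simp: loc)
qed

lemma unravel_smult:
  fixes c :: "'w set \<Rightarrow> (('w, 'k::field) mpoly set \<times> nat) set"
  assumes c: "c \<in> carrier (cochains p \<delta>)"
  shows "r \<odot>\<^bsub>cochains p \<delta>\<^esub> c \<in> carrier (cochains p \<delta>)"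
    "unravel p (r \<odot>\<^bsub>cochains p \<delta>\<^esub> c) = (\<lambda>a F. r * unravel p c a F)"
proof -
  let ?FF = "{F. F \<subseteq> V \<and> card F = p}"
  have eq: "r \<odot>\<^bsub>cochains p \<delta>\<^esub> c = (\<lambda>F\<in>?FF. poly_const r \<odot>\<^bsub>Loc F\<^esub> c F)" by (simp add: cech_cochains_def Let_def)
  note loc = decode_smult[OF _ cochain_loc[OF c]]
  show un: "unravel p (r \<odot>\<^bsub>cochains p \<delta>\<^esub> c) = (\<lambda>a F. r * unravel p c a F)"
    unfolding eq by (auto simp: unravel_def fun_eq_iff loc)
  have "unravel p (r \<odot>\<^bsub>cochains p \<delta>\<^esub> c) \<in> block_cochains p \<delta>"
    unfolding un by (intro block_cochains_scale unravel_in c)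
  then show "r \<odot>\<^bsub>cochains p \<delta>\<^esub> c \<in> carrier (cochains p \<delta>)"
    unfolding eq by (intro cochain_memI) (auto simp: loc)
qed

lemma unravel_zero: "unravel p (\<zero>\<^bsub>cochains p \<delta>\<^esub>) = (\<lambda>a F. 0 :: 'k::field)"
  and zero_cochain: "\<zero>\<^bsub>cochains p \<delta>\<^esub> \<in> carrier (cochains p \<delta> :: ('k, _) module)"
proof -
  let ?FF = "{F. F \<subseteq> V \<and> card F = p}"
  have eq: "\<zero>\<^bsub>cochains p \<delta>\<^esub> = (\<lambda>F\<in>?FF. \<zero>\<^bsub>Loc F\<^esub> :: (('w, 'k) mpoly set \<times> nat) set)" by (simp add: cech_cochains_def Let_def)
  show un: "unravel p (\<zero>\<^bsub>cochains p \<delta>\<^esub>) = (\<lambda>a F. 0 :: 'k)"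
    unfolding eq by (auto simp: unravel_def fun_eq_iff decode_zero)
  have "unravel p (\<zero>\<^bsub>cochains p \<delta>\<^esub> :: _ \<Rightarrow> (('w, 'k) mpoly set \<times> nat) set) \<in> block_cochains p \<delta>"
    unfolding un by (simp add: block_cochains_def)
  then show "\<zero>\<^bsub>cochains p \<delta>\<^esub> \<in> carrier (cochains p \<delta> :: ('k, _) module)"
    unfolding eq by (intro cochain_memI) (auto simp: decode_zero)
qed

text \<open>The condition for a term of the Cech differential to survive localization mentions only
  independence. The other half of membership in the block, that \<open>F\<close> contains the
  negative support, is automatic where the cochain is nonzero.\<close>

lemma unravel_diff:
  fixes c :: "'w set \<Rightarrow> (('w, 'k::field) mpoly set \<times> nat) set"
  assumes c: "c \<in> carrier (cochains p \<delta>)"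
  shows "cech_diff V E p c \<in> carrier (cochains (Suc p) \<delta>)"
    "unravel (Suc p) (cech_diff V E p c) = (\<lambda>a. cobdry pos (cech_block a) (unravel p c a))"
proof -
  let ?FF = "{F. F \<subseteq> V \<and> card F = Suc p}"
  define t where "t = (\<lambda>F v. poly_const (cech_sign V F v) \<odot>\<^bsub>Loc F\<^esub>
            loc_map E (var_prod (F - {v})) (poly_var v) (c (F - {v})))"
  have eq: "cech_diff V E p c = (\<lambda>F\<in>?FF. \<Oplus>\<^bsub>Loc F\<^esub>v\<in>F. t F v)" by (simp add: cech_diff_def t_def)
  have sign: "cech_sign V F v = (below_sign pos F v :: 'k)" for F v
    by (simp add: cech_sign_def below_sign_def)
  have t: "t F v \<in> carrier (Loc F)"
    "decode F (t F v) = (\<lambda>a. below_sign pos F v * (if indep (F \<union> keys a) then unravel p c a (F - {v}) else 0))"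
    if F: "F \<subseteq> V" "card F = Suc p" and v: "v \<in> F" for F v
  proof -
    have F': "F - {v} \<subseteq> V" "v \<in> V" "v \<notin> F - {v}" "card (F - {v}) = p" "insert v (F - {v}) = F" using F v by auto
    note l = decode_loc_map[OF F'(1-3) cochain_loc[OF c F'(1,4)], unfolded F'(5)]
    show "t F v \<in> carrier (Loc F)" unfolding t_def by (rule decode_smult(1)[OF F(1) l(1)])
    show "decode F (t F v) = (\<lambda>a. below_sign pos F v * (if indep (F \<union> keys a) then unravel p c a (F - {v}) else 0))"
      unfolding t_def decode_smult(2)[OF F(1) l(1)] l(2) sign using F' by (auto simp: unravel_def fun_eq_iff)
  qed
  have sum: "(\<Oplus>\<^bsub>Loc F\<^esub>v\<in>F. t F v) \<in> carrier (Loc F)"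
    "decode F (\<Oplus>\<^bsub>Loc F\<^esub>v\<in>F. t F v) = (\<lambda>a. \<Sum>v\<in>F. decode F (t F v) a)" if F: "F \<subseteq> V" "card F = Suc p" for F
    by (rule decode_finsum[OF F(1) finite_sub[OF F(1)] t(1)[OF F]]; assumption)+
  note g = unravel_in[OF c, unfolded block_cochains_def]
  show un: "unravel (Suc p) (cech_diff V E p c) = (\<lambda>a. cobdry pos (cech_block a) (unravel p c a))"
  proof (intro ext)
    fix a F
    \<comment> \<open>If \<open>F\<close> misses a negative entry, so does every
      \<open>F - {v}\<close>, and the sum of its terms is zero as \<open>cobdry\<close> demands
      outside the block.\<close>
    have blk: "unravel p c a (F - {v}) = 0" if "\<not> {v. lookup a v < 0} \<subseteq> F" for v
    proof (rule ccontr)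
      assume "unravel p c a (F - {v}) \<noteq> 0"
      then have "F - {v} \<in> cech_block a" using g by auto
      then show False using that by (auto simp: cech_block_def)
    qed
    show "unravel (Suc p) (cech_diff V E p c) a F = cobdry pos (cech_block a) (unravel p c a) F"
    proof (cases "F \<in> ?FF")
      case True
      then have "unravel (Suc p) (cech_diff V E p c) a F = (\<Sum>v\<in>F. below_sign pos F v * (if indep (F \<union> keys a) then unravel p c a (F - {v}) else 0))"
        by (simp add: eq unravel_def sum t(2) cong: sum.cong)
      moreover have "F \<in> cech_block a \<longleftrightarrow> {v. lookup a v < 0} \<subseteq> F \<and> indep (F \<union> keys a)"
        by (simp add: cech_block_def)
      ultimately show ?thesis
        using blk by (cases "{v. lookup a v < 0} \<subseteq> F") (simp_all add: cobdry_def)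
    next
      case False
      have "cobdry pos (cech_block a) (unravel p c a) F = 0"
      proof (rule ccontr)
        assume "cobdry pos (cech_block a) (unravel p c a) F \<noteq> 0"
        then have "card F = Suc p" "F \<in> cech_block a"
          using block_cochains_cobdry[OF unravel_in[OF c]] by (auto simp: block_cochains_def)
        then show False using False block_keys by blast
      qed
      moreover have "unravel (Suc p) (cech_diff V E p c) a F = 0" using False by (auto simp: unravel_def)
      ultimately show ?thesis by simp
    qed
  qed
  have "unravel (Suc p) (cech_diff V E p c) \<in> block_cochains (Suc p) \<delta>"
    unfolding un by (rule block_cochains_cobdry[OF unravel_in[OF c]])
  then show "cech_diff V E p c \<in> carrier (cochains (Suc p) \<delta>)"
    unfolding eq by (intro cochain_memI) (auto simp: sum)
qed

end

section \<open>Local cohomology in a single degree\<close>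

context edge_ring
begin

lemma convex_cech_block: "convex_family (cech_block a)"
  unfolding convex_family_def cech_block_def
  by (auto intro: indep_subset)

lemma fin_cech_block: "\<forall>F\<in>cech_block a. finite F \<and> inj_on pos F"
proof
  fix F assume "F \<in> cech_block a"
  then have "F \<subseteq> V" using block_keys by blast
  then show "finite F \<and> inj_on pos F" using finite_sub inj_on_subset[OF inj_pos] by blast
qed

lemma cocycles_iff:
  fixes c :: "'w set \<Rightarrow> (('w, 'k::field) mpoly set \<times> nat) set"
  shows "c \<in> cech_cocycles V E (edge_module_hom G) p \<delta> \<longleftrightarrow>
    c \<in> carrier (cochains p \<delta>) \<and> (\<forall>a. cobdry pos (cech_block a) (unravel p c a) = (\<lambda>_. 0))"
proof -
  have "cech_diff V E p c = \<zero>\<^bsub>cochains (Suc p) \<delta>\<^esub> \<longleftrightarrow> (\<forall>a. cobdry pos (cech_block a) (unravel p c a) = (\<lambda>_. 0))"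
    if c: "c \<in> carrier (cochains p \<delta>)"
  proof
    assume eq: "cech_diff V E p c = \<zero>\<^bsub>cochains (Suc p) \<delta>\<^esub>"
    have "(\<lambda>a. cobdry pos (cech_block a) (unravel p c a)) = (\<lambda>a F. 0)"
      using unravel_diff(2)[OF c] unfolding eq unravel_zero by simp
    then show "\<forall>a. cobdry pos (cech_block a) (unravel p c a) = (\<lambda>_. 0)" by metis
  next
    assume "\<forall>a. cobdry pos (cech_block a) (unravel p c a) = (\<lambda>_. 0)"
    then have "unravel (Suc p) (cech_diff V E p c) = unravel (Suc p) (\<zero>\<^bsub>cochains (Suc p) \<delta>\<^esub>)"
      unfolding unravel_diff(2)[OF c] unravel_zero by auto
    then show "cech_diff V E p c = \<zero>\<^bsub>cochains (Suc p) \<delta>\<^esub>"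
      by (rule unravel_inj[OF unravel_diff(1)[OF c] zero_cochain])
  qed
  then show ?thesis by (auto simp: cech_cocycles_def)
qed

text \<open>The classes \<zeta> are a basis, one vector for each exponent in \<open>J\<close>; by
  the last hypothesis the other exponents contribute nothing in degree \<open>p\<close>. As
  \<open>p > 0\<close>, the coboundaries are the image of a differential.\<close>

theorem local_cohomology_dim:
  fixes \<zeta> :: "('w \<Rightarrow>\<^sub>0 int) \<Rightarrow> 'w set \<Rightarrow> 'k::field"
  assumes p: "p > 0" and finJ: "finite J"
    and J: "\<And>a. a \<in> J \<Longrightarrow> total a = \<delta> \<and> sphere_like pos (cech_block a) p (\<zeta> a)"
    and out: "\<And>a. a \<notin> J \<Longrightarrow> total a = \<delta> \<Longrightarrow> acyclic_family TYPE('k) pos (cech_block a) \<or>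
      (\<exists>m z. m \<noteq> p \<and> sphere_like pos (cech_block a) m (z :: 'w set \<Rightarrow> 'k))"
  defines "H \<equiv> local_cohomology V (E :: (('w, 'k) mpoly, _) module) (edge_module_hom G) p \<delta>"
  shows "vectorspace class_ring H" "vectorspace.fin_dim class_ring H" "vectorspace.dim class_ring H = card J"
proof -
  obtain q where q: "p = Suc q" using p gr0_implies_Suc by blast
  define Z where "Z = cech_cocycles V (E :: (('w, 'k) mpoly, _) module) (edge_module_hom G) p \<delta>"
  define B where "B = cech_coboundaries V (E :: (('w, 'k) mpoly, _) module) (edge_module_hom G) p \<delta>"
  let ?D = "\<lambda>a. cobdry pos (cech_block a) :: ('w set \<Rightarrow> 'k) \<Rightarrow> _"
  \<comment> \<open>The coordinate of a class in the one-dimensional cohomology of a block. It is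
    unique because two different values would exhibit \<zeta> as a coboundary.\<close>
  define coord where "coord = (\<lambda>a f. THE \<alpha>. \<exists>b. supported (cech_block a) b \<and> f = (\<lambda>F. \<alpha> * \<zeta> a F + ?D a b F))"
  have coordI: "coord a f = \<alpha>" if a: "a \<in> J" and b: "supported (cech_block a) b" and f: "f = (\<lambda>F. \<alpha> * \<zeta> a F + ?D a b F)" for a f \<alpha> b
    unfolding coord_def
  proof (rule the_equality)
    show "\<exists>b. supported (cech_block a) b \<and> f = (\<lambda>F. \<alpha> * \<zeta> a F + ?D a b F)" using b f by blast
    fix \<beta> assume "\<exists>b. supported (cech_block a) b \<and> f = (\<lambda>F. \<beta> * \<zeta> a F + ?D a b F)"
    then obtain b' where b': "supported (cech_block a) b'" "f = (\<lambda>F. \<beta> * \<zeta> a F + ?D a b' F)" by blast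
    show "\<beta> = \<alpha>"
    proof (rule ccontr)
      assume ne: "\<beta> \<noteq> \<alpha>"
      define w where "w = (\<lambda>F. 1 / (\<beta> - \<alpha>) * (b F - b' F))"
      have "?D a w F = \<zeta> a F" for F
      proof -
        have "\<alpha> * \<zeta> a F + ?D a b F = \<beta> * \<zeta> a F + ?D a b' F" using fun_cong[OF f, of F] fun_cong[OF b'(2), of F] by simp
        then have "?D a b F - ?D a b' F = (\<beta> - \<alpha>) * \<zeta> a F" by (simp add: algebra_simps)
        then show ?thesis unfolding w_def cobdry_scale cobdry_diff using ne by simp
      qed
      moreover have "supported (cech_block a) w" using b b'(1) by (simp add: w_def supported_def)
      ultimately show False using J[OF a] unfolding sphere_like_def by blast
    qed
  qed
  have coordE: "\<exists>b. supported (cech_block a) b \<and> f = (\<lambda>F. coord a f * \<zeta> a F + ?D a b F)"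
    if a: "a \<in> J" and f: "supported (cech_block a) f" "?D a f = (\<lambda>_. 0)" for a f
  proof -
    obtain \<alpha> b where b: "supported (cech_block a) b" "f = (\<lambda>F. \<alpha> * \<zeta> a F + ?D a b F)"
      using J[OF a] f unfolding sphere_like_def by blast
    show ?thesis by (rule exI[of _ b]) (use b coordI[OF a b] in simp)
  qed
  obtain e where e: "bij_betw e {..<card J} J"
    using ex_bij_betw_nat_finite[OF finJ] by (auto simp: atLeast0LessThan)
  have eJ: "e i \<in> J" if "i < card J" for i using e that by (auto simp: bij_betw_def)
  define \<psi> where "\<psi> = (\<lambda>c. vec (card J) (\<lambda>i. coord (e i) (unravel p c (e i))))"
  have Zc: "c \<in> carrier (cochains p \<delta>)" "?D a (unravel p c a) = (\<lambda>_. 0)" "supported (cech_block a) (unravel p c a)" if "c \<in> Z" for c a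
    using that unravel_in[of c p \<delta>] by (auto simp: Z_def cocycles_iff block_cochains_def supported_def)
  have ZI: "c \<in> Z" if "c \<in> carrier (cochains p \<delta>)" "\<And>a. ?D a (unravel p c a) = (\<lambda>_. 0)" for c
    using that by (simp add: Z_def cocycles_iff)
  have dd: "?D a (?D a f) = (\<lambda>_. 0)" if "supported (cech_block a) f" for a f
    by (rule cobdry_cobdry[OF convex_cech_block that fin_cech_block])
  have Z_add: "z \<oplus>\<^bsub>cochains p \<delta>\<^esub> z' \<in> Z \<and> \<psi> (z \<oplus>\<^bsub>cochains p \<delta>\<^esub> z') = \<psi> z + \<psi> z'" if z: "z \<in> Z" "z' \<in> Z" for z z'
  proof
    note u = unravel_add[OF Zc(1)[OF z(1)] Zc(1)[OF z(2)]]
    show "z \<oplus>\<^bsub>cochains p \<delta>\<^esub> z' \<in> Z"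
      by (rule ZI[OF u(1)]) (use Zc(2)[OF z(1)] Zc(2)[OF z(2)] in \<open>simp add: u(2) cobdry_add fun_eq_iff\<close>)
    show "\<psi> (z \<oplus>\<^bsub>cochains p \<delta>\<^esub> z') = \<psi> z + \<psi> z'"
    proof (rule eq_vecI)
      fix i assume "i < dim_vec (\<psi> z + \<psi> z')"
      then have i: "i < card J" by (simp add: \<psi>_def)
      obtain b where b: "supported (cech_block (e i)) b" "unravel p z (e i) = (\<lambda>F. coord (e i) (unravel p z (e i)) * \<zeta> (e i) F + ?D (e i) b F)"
        using coordE[OF eJ[OF i] Zc(3)[OF z(1)] Zc(2)[OF z(1)]] by blast
      obtain b' where b': "supported (cech_block (e i)) b'" "unravel p z' (e i) = (\<lambda>F. coord (e i) (unravel p z' (e i)) * \<zeta> (e i) F + ?D (e i) b' F)"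
        using coordE[OF eJ[OF i] Zc(3)[OF z(2)] Zc(2)[OF z(2)]] by blast
      have "coord (e i) (unravel p (z \<oplus>\<^bsub>cochains p \<delta>\<^esub> z') (e i)) = coord (e i) (unravel p z (e i)) + coord (e i) (unravel p z' (e i))"
      proof (rule coordI[OF eJ[OF i]])
        show "supported (cech_block (e i)) (\<lambda>F. b F + b' F)" using b(1) b'(1) by (simp add: supported_def)
        show "unravel p (z \<oplus>\<^bsub>cochains p \<delta>\<^esub> z') (e i) = (\<lambda>F. (coord (e i) (unravel p z (e i)) + coord (e i) (unravel p z' (e i))) * \<zeta> (e i) F + ?D (e i) (\<lambda>F. b F + b' F) F)"
        proof
          fix F
          show "unravel p (z \<oplus>\<^bsub>cochains p \<delta>\<^esub> z') (e i) F = (coord (e i) (unravel p z (e i)) + coord (e i) (unravel p z' (e i))) * \<zeta> (e i) F + ?D (e i) (\<lambda>F. b F + b' F) F"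
            unfolding u(2) using fun_cong[OF b(2), of F] fun_cong[OF b'(2), of F] by (simp add: cobdry_add algebra_simps)
        qed
      qed
      then show "\<psi> (z \<oplus>\<^bsub>cochains p \<delta>\<^esub> z') $ i = (\<psi> z + \<psi> z') $ i" using i by (simp add: \<psi>_def)
    qed (simp add: \<psi>_def)
  qed
  have Z_smult: "r \<odot>\<^bsub>cochains p \<delta>\<^esub> z \<in> Z \<and> \<psi> (r \<odot>\<^bsub>cochains p \<delta>\<^esub> z) = r \<cdot>\<^sub>v \<psi> z" if z: "z \<in> Z" for r z
  proof
    note u = unravel_smult[OF Zc(1)[OF z]]
    show "r \<odot>\<^bsub>cochains p \<delta>\<^esub> z \<in> Z"
      by (rule ZI[OF u(1)]) (use Zc(2)[OF z] in \<open>simp add: u(2) cobdry_scale fun_eq_iff\<close>)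
    show "\<psi> (r \<odot>\<^bsub>cochains p \<delta>\<^esub> z) = r \<cdot>\<^sub>v \<psi> z"
    proof (rule eq_vecI)
      fix i assume "i < dim_vec (r \<cdot>\<^sub>v \<psi> z)"
      then have i: "i < card J" by (simp add: \<psi>_def)
      obtain b where b: "supported (cech_block (e i)) b" "unravel p z (e i) = (\<lambda>F. coord (e i) (unravel p z (e i)) * \<zeta> (e i) F + ?D (e i) b F)"
        using coordE[OF eJ[OF i] Zc(3)[OF z] Zc(2)[OF z]] by blast
      have "coord (e i) (unravel p (r \<odot>\<^bsub>cochains p \<delta>\<^esub> z) (e i)) = r * coord (e i) (unravel p z (e i))"
      proof (rule coordI[OF eJ[OF i]])
        show "supported (cech_block (e i)) (\<lambda>F. r * b F)" using b(1) by (simp add: supported_def)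
        show "unravel p (r \<odot>\<^bsub>cochains p \<delta>\<^esub> z) (e i) = (\<lambda>F. (r * coord (e i) (unravel p z (e i))) * \<zeta> (e i) F + ?D (e i) (\<lambda>F. r * b F) F)"
        proof
          fix F
          show "unravel p (r \<odot>\<^bsub>cochains p \<delta>\<^esub> z) (e i) F = (r * coord (e i) (unravel p z (e i))) * \<zeta> (e i) F + ?D (e i) (\<lambda>F. r * b F) F"
            unfolding u(2) using fun_cong[OF b(2), of F] by (simp add: cobdry_scale algebra_simps)
        qed
      qed
      then show "\<psi> (r \<odot>\<^bsub>cochains p \<delta>\<^esub> z) $ i = (r \<cdot>\<^sub>v \<psi> z) $ i" using i by (simp add: \<psi>_def)
    qed (simp add: \<psi>_def)
  qed
  have assoc: "u \<oplus>\<^bsub>cochains p \<delta>\<^esub> v \<oplus>\<^bsub>cochains p \<delta>\<^esub> w = u \<oplus>\<^bsub>cochains p \<delta>\<^esub> (v \<oplus>\<^bsub>cochains p \<delta>\<^esub> w)"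
    if "u \<in> Z" "v \<in> Z" "w \<in> Z" for u v w
    by (rule unravel_inj[of _ p \<delta>]) (use that[THEN Zc(1)] in \<open>simp_all add: unravel_add add.assoc\<close>)
  have surj: "\<psi> ` Z = carrier_vec (card J)"
  proof (intro equalityI subsetI)
    fix w :: "'k vec" assume w: "w \<in> carrier_vec (card J)"
    define e' where "e' = inv_into {..<card J} e"
    define g where "g = (\<lambda>a F. if a \<in> J then w $ e' a * \<zeta> a F else 0)"
    have "finite {a. g a \<noteq> (\<lambda>_. 0)}"
      by (rule finite_subset[OF _ finJ]) (auto simp: g_def)
    moreover have "card F = p \<and> F \<in> cech_block a \<and> total a = \<delta>" if nz: "g a F \<noteq> 0" for a F
    proof -
      have a: "a \<in> J" "\<zeta> a F \<noteq> 0" using nz by (auto simp: g_def split: if_splits)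
      then show ?thesis using J[OF a(1)] unfolding sphere_like_def supported_def by auto
    qed
    ultimately have "g \<in> block_cochains p \<delta>" unfolding block_cochains_def by blast
    then obtain c where c: "c \<in> carrier (cochains p \<delta>)" "unravel p c = g" using ravel by blast
    have "c \<in> Z"
    proof (rule ZI[OF c(1)])
      fix a
      show "?D a (unravel p c a) = (\<lambda>_. 0)"
      proof (cases "a \<in> J")
        case True
        have "?D a (\<lambda>F. w $ e' a * \<zeta> a F) = (\<lambda>_. 0)"
          using J[OF True] by (simp add: sphere_like_def cobdry_scale fun_eq_iff)
        then show ?thesis using True by (simp add: c(2) g_def)
      qed (simp add: c(2) g_def)
    qed
    moreover have "\<psi> c = w"
    proof (rule eq_vecI)
      fix i assume "i < dim_vec w"
      then have i: "i < card J" using w by simp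
      have e'i: "e' (e i) = i" unfolding e'_def using e i by (auto simp: bij_betw_def inv_into_f_f)
      have "supported (cech_block (e i)) (\<lambda>_. 0 :: 'k)" by (simp add: supported_def)
      then have "coord (e i) (unravel p c (e i)) = w $ i"
        by (rule coordI[OF eJ[OF i]]) (simp add: c(2) g_def eJ[OF i] e'i)
      then show "\<psi> c $ i = w $ i" using i by (simp add: \<psi>_def)
    qed (use w in \<open>simp add: \<psi>_def\<close>)
    ultimately show "w \<in> \<psi> ` Z" by blast
  qed (auto simp: \<psi>_def)
  have B: "B = {z \<in> Z. \<psi> z = 0\<^sub>v (card J)}"
  proof (intro equalityI subsetI)
    fix c assume "c \<in> B"
    then obtain c' where c': "c' \<in> carrier (cochains q \<delta>)" "c = cech_diff V E q c'" by (auto simp: B_def q)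
    note u = unravel_diff[OF c'(1), folded c'(2) q]
    have supp: "supported (cech_block a) (unravel q c' a)" for a
      using unravel_in[OF c'(1)] by (auto simp: block_cochains_def supported_def)
    have "c \<in> Z" by (rule ZI[OF u(1)]) (simp add: u(2) dd[OF supp])
    moreover have "\<psi> c = 0\<^sub>v (card J)"
    proof (rule eq_vecI)
      fix i assume "i < dim_vec (0\<^sub>v (card J) :: 'k vec)"
      then have i: "i < card J" by simp
      have "coord (e i) (unravel p c (e i)) = 0"
        by (rule coordI[OF eJ[OF i] supp]) (simp add: u(2))
      then show "\<psi> c $ i = 0\<^sub>v (card J) $ i" using i by (simp add: \<psi>_def)
    qed (simp add: \<psi>_def)
    ultimately show "c \<in> {z \<in> Z. \<psi> z = 0\<^sub>v (card J)}" by blast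
  next
    fix c assume "c \<in> {z \<in> Z. \<psi> z = 0\<^sub>v (card J)}"
    then have c: "c \<in> Z" and c0: "\<psi> c = 0\<^sub>v (card J)" by auto
    define f where "f = unravel p c"
    have f: "f \<in> block_cochains p \<delta>" unfolding f_def by (rule unravel_in[OF Zc(1)[OF c]])
    \<comment> \<open>Primitives are only asked for on sets with \<open>p\<close> elements, so that
      a generator living in another degree \<open>m\<close> drops out.\<close>
    have "\<exists>b. supported (cech_block a) b \<and> (\<forall>F. card F = p \<longrightarrow> f a F = ?D a b F)" if nz: "f a \<noteq> (\<lambda>_. 0)" for a
    proof (cases "a \<in> J")
      case True
      then obtain i where i: "i < card J" "a = e i" using e by (auto simp: bij_betw_def)
      have "coord a (f a) = \<psi> c $ i" using i by (simp add: \<psi>_def f_def)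
      then have "coord a (f a) = 0" using i by (simp add: c0)
      then show ?thesis using coordE[OF True Zc(3)[OF c] Zc(2)[OF c]] by (auto simp: f_def)
    next
      case False
      have "total a = \<delta>" using f nz by (auto simp: block_cochains_def fun_eq_iff)
      from out[OF False this] show ?thesis
      proof
        assume "acyclic_family TYPE('k) pos (cech_block a)"
        then show ?thesis using acyclic_familyD Zc(2,3)[OF c] unfolding f_def by metis
      next
        assume "\<exists>m z. m \<noteq> p \<and> sphere_like pos (cech_block a) m (z :: 'w set \<Rightarrow> 'k)"
        then obtain m z where m: "m \<noteq> p" "sphere_like pos (cech_block a) m (z :: 'w set \<Rightarrow> 'k)" by blast
        then obtain \<alpha> b where b: "supported (cech_block a) b" "f a = (\<lambda>F. \<alpha> * z F + ?D a b F)"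
          using Zc(2,3)[OF c] unfolding sphere_like_def f_def by blast
        have "z F = 0" if "card F = p" for F using m that by (auto simp: sphere_like_def supported_def)
        then show ?thesis using b by auto
      qed
    qed
    then obtain \<beta> where \<beta>: "\<And>a. f a \<noteq> (\<lambda>_. 0) \<Longrightarrow> supported (cech_block a) (\<beta> a) \<and> (\<forall>F. card F = p \<longrightarrow> f a F = ?D a (\<beta> a) F)" by metis
    \<comment> \<open>Choosing zero wherever \<open>f a\<close> is zero keeps the family finitely
      supported, which makes it the coordinates of an actual cochain. Truncation to degree
      \<open>q\<close> repairs the mixed degree of the chosen primitives.\<close>
    define g where "g = (\<lambda>a. if f a = (\<lambda>_. 0) then (\<lambda>_. 0) else restrict_to {F. card F = q} (\<beta> a))"
    have Dg: "?D a (g a) = f a" for a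
    proof (cases "f a = (\<lambda>_. 0)")
      case True
      then show ?thesis by (simp add: g_def)
    next
      case False
      have "?D a (restrict_to {F. card F = q} (\<beta> a)) = f a"
      proof (rule cobdry_restrict_degree)
        show "\<forall>F\<in>cech_block a. finite F" using fin_cech_block by blast
        show "f a F = 0" if "card F \<noteq> Suc q" for F using f that by (auto simp: block_cochains_def q)
        show "f a F = ?D a (\<beta> a) F" if "card F = Suc q" for F using \<beta>[OF False] that by (simp add: q)
      qed
      then show ?thesis using False by (simp add: g_def)
    qed
    have "g \<in> block_cochains q \<delta>"
    proof -
      have "finite {a. g a \<noteq> (\<lambda>_. 0)}"
        by (rule finite_subset[of _ "{a. f a \<noteq> (\<lambda>_. 0)}"]) (use f in \<open>auto simp: g_def block_cochains_def\<close>)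
      moreover have "card F = q \<and> F \<in> cech_block a \<and> total a = \<delta>" if nz: "g a F \<noteq> 0" for a F
      proof -
        have fa: "f a \<noteq> (\<lambda>_. 0)" and F: "card F = q" "\<beta> a F \<noteq> 0"
          using nz by (auto simp: g_def restrict_to_def split: if_splits)
        moreover have "total a = \<delta>" using f fa by (auto simp: block_cochains_def fun_eq_iff)
        ultimately show ?thesis using \<beta>[OF fa] by (auto simp: supported_def)
      qed
      ultimately show ?thesis unfolding block_cochains_def by blast
    qed
    then obtain c' where c': "c' \<in> carrier (cochains q \<delta>)" "unravel q c' = g" using ravel by blast
    have "cech_diff V E q c' = c"
      using Zc(1)[OF c] unravel_diff[OF c'(1)] Dg by (intro unravel_inj[of _ p \<delta>]) (simp_all add: q c'(2) f_def)
    then show "c \<in> B" using c'(1) by (auto simp: B_def q)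
  qed
  have diff: "\<exists>b\<in>B. z' = b \<oplus>\<^bsub>cochains p \<delta>\<^esub> z" if z: "z \<in> Z" "z' \<in> Z" "\<psi> z = \<psi> z'" for z z'
  proof
    define m where "m = (-1) \<odot>\<^bsub>cochains p \<delta>\<^esub> z"
    have m: "m \<in> Z" "\<psi> m = (-1) \<cdot>\<^sub>v \<psi> z" using Z_smult[OF z(1)] by (simp_all add: m_def)
    have um: "unravel p m = (\<lambda>a F. - unravel p z a F)"
      using unravel_smult(2)[OF Zc(1)[OF z(1)], of "-1"] by (simp add: m_def)
    have "\<psi> (z' \<oplus>\<^bsub>cochains p \<delta>\<^esub> m) = \<psi> z' + (-1) \<cdot>\<^sub>v \<psi> z'" using Z_add[OF z(2) m(1)] m(2) z(3) by simp
    also have "\<dots> = 0\<^sub>v (card J)" by (rule eq_vecI) (auto simp: \<psi>_def)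
    finally show "z' \<oplus>\<^bsub>cochains p \<delta>\<^esub> m \<in> B" using Z_add[OF z(2) m(1)] by (simp add: B)
    show "z' = z' \<oplus>\<^bsub>cochains p \<delta>\<^esub> m \<oplus>\<^bsub>cochains p \<delta>\<^esub> z"
    proof (rule unravel_inj[of _ p \<delta>])
      note c = Zc(1)[OF z(1)] Zc(1)[OF z(2)] Zc(1)[OF m(1)]
      show "z' \<in> carrier (cochains p \<delta>)" "z' \<oplus>\<^bsub>cochains p \<delta>\<^esub> m \<oplus>\<^bsub>cochains p \<delta>\<^esub> z \<in> carrier (cochains p \<delta>)"
        using c by (simp_all add: unravel_add)
      show "unravel p z' = unravel p (z' \<oplus>\<^bsub>cochains p \<delta>\<^esub> m \<oplus>\<^bsub>cochains p \<delta>\<^esub> z)"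
        using c by (simp add: unravel_add um)
    qed
  qed
  have H: "H = quot_module (cochains p \<delta>) Z B" by (simp add: H_def local_cohomology_def Z_def B_def)
  note dim = quot_module_dim[of Z "cochains p \<delta>" \<psi> "card J" B, OF Z_add Z_smult assoc surj B diff]
  show "vectorspace class_ring H" "vectorspace.fin_dim class_ring H" "vectorspace.dim class_ring H = card J"
    unfolding H by (rule dim; assumption)+
qed

end

section \<open>Counting exponents\<close>

definition geometric_fps :: "rat fps" where
  "geometric_fps = Abs_fps (\<lambda>n. if n = 0 then 0 else 1)"

lemma geometric_fls: "fls_X / (1 - fls_X) = fps_to_fls geometric_fps"
proof -
  have "geometric_fps * (1 - fps_X) = fps_X"
  proof (rule fps_ext)
    fix n show "(geometric_fps * (1 - fps_X)) $ n = fps_X $ n"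
      by (cases n) (auto simp: geometric_fps_def right_diff_distrib fps_X_mult_right_nth fps_X_nth)
  qed
  then have "fps_to_fls (geometric_fps * (1 - fps_X)) = fps_to_fls fps_X" by simp
  then have "fps_to_fls geometric_fps * (1 - fls_X) = fls_X" by (simp add: fls_times_fps_to_fls)
  moreover have "1 - fls_X \<noteq> (0 :: rat fls)"
  proof
    assume "1 - fls_X = (0 :: rat fls)"
    then have "fls_nth (1 - fls_X :: rat fls) 0 = 0" by simp
    then show False by simp
  qed
  ultimately show ?thesis by (metis nonzero_eq_divide_eq)
qed

definition neg_exponents :: "'w set \<Rightarrow> int \<Rightarrow> ('w \<Rightarrow>\<^sub>0 int) set" where
  "neg_exponents N \<delta> = {a. keys a = N \<and> (\<forall>v. lookup a v \<le> 0) \<and>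
     (\<Sum>v\<in>N. lookup a v) = \<delta>}"

lemma neg_exponents_pos: "\<delta> > 0 \<Longrightarrow> neg_exponents N \<delta> = {}"
proof -
  assume "\<delta> > 0"
  then have "a \<notin> neg_exponents N \<delta>" for a
    using sum_nonpos[of N "lookup a"] by (auto simp: neg_exponents_def)
  then show ?thesis by blast
qed

text \<open>Splits off the entry \<open>- t\<close> at \<open>v\<close>. It is at least one in
  absolute value because \<open>v\<close> must lie in the support, and at most \<open>m\<close>
  because the other entries are not positive.\<close>

lemma neg_exponents_insert:
  assumes "finite N" "v \<notin> N"
  shows "neg_exponents (insert v N) (- int m) =
    (\<Union>t\<in>{1..m}. (\<lambda>a. a + single v (- int t)) ` neg_exponents N (- int (m - t)))"
proof (intro equalityI subsetI)
  fix a assume a: "a \<in> neg_exponents (insert v N) (- int m)"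
  define t where "t = nat (- lookup a v)"
  define b where "b = a + single v (int t)"
  have av: "lookup a v < 0"
    using a by (auto simp: neg_exponents_def in_keys_iff order.order_iff_strict)
  then have t: "lookup a v = - int t" "t \<ge> 1" by (simp_all add: t_def)
  have lb: "lookup b w = (if w = v then 0 else lookup a w)" for w
    using t by (simp add: b_def lookup_add lookup_single when_def)
  have kb: "keys b = N"
    using a assms(2) by (auto simp: neg_exponents_def in_keys_iff lb set_eq_iff split: if_splits)
  have s: "(\<Sum>w\<in>N. lookup b w) = (\<Sum>w\<in>N. lookup a w)"
    by (rule sum.cong) (use assms(2) in \<open>auto simp: lb\<close>)
  have tot: "- int t + (\<Sum>w\<in>N. lookup a w) = - int m"
    using a assms t by (simp add: neg_exponents_def)
  moreover have "(\<Sum>w\<in>N. lookup a w) \<le> 0"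
    by (rule sum_nonpos) (use a in \<open>auto simp: neg_exponents_def\<close>)
  ultimately have "t \<le> m" by linarith
  moreover have "b \<in> neg_exponents N (- int (m - t))"
    using a kb s tot \<open>t \<le> m\<close> by (auto simp: neg_exponents_def lb)
  moreover have "a = b + single v (- int t)" by (simp add: b_def single_uminus)
  ultimately show "a \<in> (\<Union>t\<in>{1..m}. (\<lambda>a. a + single v (- int t)) ` neg_exponents N (- int (m - t)))"
    using t(2) by auto
next
  fix a assume "a \<in> (\<Union>t\<in>{1..m}. (\<lambda>a. a + single v (- int t)) ` neg_exponents N (- int (m - t)))"
  then obtain t b where t: "1 \<le> t" "t \<le> m" and b: "b \<in> neg_exponents N (- int (m - t))"
    and a: "a = b + single v (- int t)" by auto
  have bv: "lookup b v = 0" using b assms(2) by (auto simp: neg_exponents_def in_keys_iff)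
  have la: "lookup a w = (if w = v then - int t else lookup b w)" for w
    using bv by (simp add: a lookup_add lookup_single when_def)
  have "keys a = insert v N"
    using b t by (auto simp: neg_exponents_def in_keys_iff la set_eq_iff)
  moreover have "(\<Sum>w\<in>N. lookup a w) = (\<Sum>w\<in>N. lookup b w)"
    by (rule sum.cong) (use assms(2) in \<open>auto simp: la\<close>)
  ultimately show "a \<in> neg_exponents (insert v N) (- int m)"
    using b t assms by (auto simp: neg_exponents_def la)
qed

text \<open>The negated entries form a composition of \<open>m\<close> into \<open>card N\<close>
  positive parts, and each part contributes one factor of the generating function.\<close>

lemma card_neg_exponents_nat:
  fixes N :: "'w set"
  assumes "finite N"
  shows "finite (neg_exponents N (- int m)) \<and> of_nat (card (neg_exponents N (- int m))) = (geometric_fps ^ card N) $ m"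
  using assms
proof (induction N arbitrary: m rule: finite_induct)
  case empty
  have "neg_exponents ({} :: 'w set) (- int m) = (if m = 0 then {0} else {})"
    by (auto simp: neg_exponents_def)
  then show ?case by auto
next
  case (insert v N)
  have inj: "inj_on (\<lambda>a. a + single v (- int t)) A" for t A by (rule inj_onI) simp
  have lv: "lookup a v = - int t"
    if "a \<in> (\<lambda>a. a + single v (- int t)) ` neg_exponents N \<delta>" for a t \<delta>
    using that insert(2) by (auto simp: neg_exponents_def lookup_add in_keys_iff)
  have fin: "finite (neg_exponents N (- int m))" for m using insert.IH by blast
  have "card (neg_exponents (insert v N) (- int m)) =
      (\<Sum>t\<in>{1..m}. card ((\<lambda>a. a + single v (- int t)) ` neg_exponents N (- int (m - t))))"
    unfolding neg_exponents_insert[OF insert(1,2)]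
  proof (rule card_UN_disjoint)
    show "\<forall>t\<in>{1..m}. finite ((\<lambda>a. a + single v (- int t)) ` neg_exponents N (- int (m - t)))"
      using fin by blast
    show "\<forall>t\<in>{1..m}. \<forall>s\<in>{1..m}. t \<noteq> s \<longrightarrow> (\<lambda>a. a + single v (- int t)) ` neg_exponents N (- int (m - t)) \<inter>
        (\<lambda>a. a + single v (- int s)) ` neg_exponents N (- int (m - s)) = {}"
    proof (intro ballI impI equals0I, elim IntE)
      fix t s a assume "t \<noteq> s" and "a \<in> (\<lambda>a. a + single v (- int t)) ` neg_exponents N (- int (m - t))"
        "a \<in> (\<lambda>a. a + single v (- int s)) ` neg_exponents N (- int (m - s))"
      then have "- int t = - int s" using lv by metis
      then show False using \<open>t \<noteq> s\<close> by simp
    qed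
  qed simp
  also have "\<dots> = (\<Sum>t\<in>{1..m}. card (neg_exponents N (- int (m - t))))"
    by (simp add: card_image inj)
  finally have "of_nat (card (neg_exponents (insert v N) (- int m))) = (\<Sum>t\<in>{1..m}. (geometric_fps ^ card N) $ (m - t))"
    by (simp only: of_nat_sum insert.IH[THEN conjunct2])
  \<comment> \<open>The summand at zero may be added since the series has no constant term; this
    makes the sum a convolution.\<close>
  also have "\<dots> = (\<Sum>t\<in>{0..m}. geometric_fps $ t * (geometric_fps ^ card N) $ (m - t))"
    by (rule sum.mono_neutral_cong_left) (auto simp: geometric_fps_def)
  also have "\<dots> = (geometric_fps ^ card (insert v N)) $ m"
    using insert(1,2) by (simp add: fps_mult_nth)
  finally have "of_nat (card (neg_exponents (insert v N) (- int m))) = (geometric_fps ^ card (insert v N)) $ m" .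
  moreover have "finite (neg_exponents (insert v N) (- int m))"
    unfolding neg_exponents_insert[OF insert(1,2)] using fin by blast
  ultimately show ?case by blast
qed

lemma card_neg_exponents:
  assumes "finite N"
  shows "finite (neg_exponents N \<delta>)"
    "of_nat (card (neg_exponents N \<delta>)) = fls_nth ((fls_X / (1 - fls_X) :: rat fls) ^ card N) (- \<delta>)"
proof -
  have "finite (neg_exponents N \<delta>) \<and> of_nat (card (neg_exponents N \<delta>)) = fls_nth ((fls_X / (1 - fls_X) :: rat fls) ^ card N) (- \<delta>)"
  proof (cases "\<delta> > 0")
    case True
    then show ?thesis unfolding geometric_fls fps_to_fls_power[symmetric] by (simp add: neg_exponents_pos)
  next
    case False
    then have "\<delta> = - int (nat (- \<delta>))" by simp
    then show ?thesis using card_neg_exponents_nat[OF assms, of "nat (- \<delta>)"] False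
      unfolding geometric_fls fps_to_fls_power[symmetric] by simp
  qed
  then show "finite (neg_exponents N \<delta>)"
    "of_nat (card (neg_exponents N \<delta>)) = fls_nth ((fls_X / (1 - fls_X) :: rat fls) ^ card N) (- \<delta>)" by blast+
qed

section \<open>From very well-covered graphs to the axioms of the matching\<close>

lemma minimal_cover_subset:
  assumes "finite (verts H)" "vertex_cover H C"
  obtains C' where "C' \<in> min_covers H" "C' \<subseteq> C"
proof -
  obtain C' where C': "vertex_cover H C' \<and> C' \<subseteq> C"
    and least: "\<And>D. vertex_cover H D \<and> D \<subseteq> C \<Longrightarrow> card C' \<le> card D"
    using ex_has_least_nat[of "\<lambda>D. vertex_cover H D \<and> D \<subseteq> C" C card] assms(2) by blast
  have fin: "finite C'" using C' assms(1) finite_subset by (auto simp: vertex_cover_def)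
  have "\<not> vertex_cover H D" if "D \<subset> C'" for D
    using least[of D] psubset_card_mono[OF fin that] that C' by fastforce
  then show ?thesis using that C' by (auto simp: min_covers_def)
qed

lemma well_covered_matchingI:
  fixes H :: "'v ugraph" and x y :: "nat \<Rightarrow> 'v"
  assumes simple: "simple_graph H"
    and vwc: "very_well_covered H"
    and card: "card (verts H) = 2 * d\<^sub>0"
    and verts: "verts H = x ` {1..d\<^sub>0} \<union> y ` {1..d\<^sub>0}"
    and yind: "independent_set H (y ` {1..d\<^sub>0})"
    and matched: "\<forall>i\<in>{1..d\<^sub>0}. {x i, y i} \<in> edges H"
    and ordered: "\<forall>i\<in>{1..d\<^sub>0}. \<forall>k\<in>{1..d\<^sub>0}. {x i, y k} \<in> edges H \<longrightarrow> i \<le> k"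
  shows "well_covered_matching H d\<^sub>0 x y"
proof -
  let ?I = "{1..d\<^sub>0}"
  have finV: "finite (verts H)" using simple by (simp add: simple_graph_def)
  have cx: "card (x ` ?I) \<le> d\<^sub>0" "card (y ` ?I) \<le> d\<^sub>0" using card_image_le[of ?I x] card_image_le[of ?I y] by simp_all
  have cu: "card (x ` ?I) + card (y ` ?I) = 2 * d\<^sub>0 + card (x ` ?I \<inter> y ` ?I)"
    using card_Un_Int[of "x ` ?I" "y ` ?I"] card verts by simp
  \<comment> \<open>There are \<open>2 * d\<^sub>0\<close> vertices and as many labels, so no label
    is repeated.\<close>
  have c: "card (x ` ?I) = d\<^sub>0" "card (y ` ?I) = d\<^sub>0" "card (x ` ?I \<inter> y ` ?I) = 0"
    using cx cu by linarith+
  have inj: "inj_on x ?I" "inj_on y ?I" using c(1,2) by (simp_all add: eq_card_imp_inj_on)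
  have disj: "x ` ?I \<inter> y ` ?I = {}" using c(3) by (metis card_eq_0_iff finite_Int finite_imageI finite_atLeastAtMost)
  \<comment> \<open>A minimal cover has half as many elements as there are vertices, and it has to
    meet each of the disjoint edges \<open>{x i, y i}\<close>; so nothing is left for a second
    end.\<close>
  have trans: "x i \<in> C \<longleftrightarrow> y i \<notin> C" if C: "C \<in> min_covers H" and i: "i \<in> ?I" for C i
  proof -
    define A where "A = {i \<in> ?I. x i \<in> C}"
    define B where "B = {i \<in> ?I. y i \<in> C}"
    have cov: "C \<subseteq> verts H" "\<And>e. e \<in> edges H \<Longrightarrow> e \<inter> C \<noteq> {}" using C by (auto simp: min_covers_def vertex_cover_def)
    have CAB: "C = x ` A \<union> y ` B" using cov(1) verts by (auto simp: A_def B_def)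
    have sub: "A \<subseteq> ?I" "B \<subseteq> ?I" by (auto simp: A_def B_def)
    have "A \<union> B = ?I"
    proof (intro equalityI subsetI)
      fix i assume "i \<in> ?I"
      then show "i \<in> A \<union> B" using cov(2)[of "{x i, y i}"] matched by (auto simp: A_def B_def)
    qed (use sub in blast)
    moreover have "card C = card A + card B"
    proof -
      have "card C = card (x ` A) + card (y ` B)"
        unfolding CAB
      proof (rule card_Un_disjoint)
        show "finite (x ` A)" "finite (y ` B)" by (simp_all add: A_def B_def)
        show "x ` A \<inter> y ` B = {}" using sub disj by blast
      qed
      then show ?thesis using card_image[OF inj_on_subset[OF inj(1) sub(1)]] card_image[OF inj_on_subset[OF inj(2) sub(2)]] by simp
    qed
    moreover have "2 * card C = 2 * d\<^sub>0" using vwc C card by (auto simp: very_well_covered_def)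
    moreover have "finite A" "finite B" by (simp_all add: A_def B_def)
    ultimately have "card (A \<inter> B) = 0" using card_Un_Int[of A B] by simp
    then have "A \<inter> B = {}" using \<open>finite A\<close> by simp
    then show ?thesis using \<open>A \<union> B = ?I\<close> i unfolding A_def B_def by blast
  qed
  \<comment> \<open>If \<open>{u, w}\<close> is not an edge, its complement is a cover. A minimal
    cover inside it avoids \<open>u\<close> and \<open>w\<close>, hence must contain both
    \<open>x i\<close> and \<open>y i\<close>. The argument covers \<open>u = w\<close> as
    well.\<close>
  have transfer: "{u, w} \<in> edges H" if i: "i \<in> ?I" and uw: "{u, x i} \<in> edges H" "{w, y i} \<in> edges H" for u w i
  proof (rule ccontr)
    assume no: "{u, w} \<notin> edges H"
    have "vertex_cover H (verts H - {u, w})"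
      unfolding vertex_cover_def
    proof (intro conjI ballI)
      fix e assume e: "e \<in> edges H"
      then obtain a b where ab: "a \<in> verts H" "b \<in> verts H" "a \<noteq> b" "e = {a, b}"
        using simple unfolding simple_graph_def by metis
      show "e \<inter> (verts H - {u, w}) \<noteq> {}"
      proof
        assume "e \<inter> (verts H - {u, w}) = {}"
        then have "a \<in> {u, w}" "b \<in> {u, w}" using ab by auto
        then have "e = {u, w}" using ab(3,4) by auto
        then show False using no e by simp
      qed
    qed auto
    then obtain C where C: "C \<in> min_covers H" "C \<subseteq> verts H - {u, w}" using minimal_cover_subset[OF finV] by blast
    then have "{u, x i} \<inter> C \<noteq> {}" "{w, y i} \<inter> C \<noteq> {}" using uw by (auto simp: min_covers_def vertex_cover_def)
    then have "x i \<in> C" "y i \<in> C" using C(2) by auto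
    then show False using trans[OF C(1) i] by simp
  qed
  have om: "ordered_matching H d\<^sub>0 x y"
  proof
    show "{y i, y k} \<notin> edges H" if "i \<in> ?I" "k \<in> ?I" for i k
      using yind that by (auto simp: independent_set_def)
    show "{x i, y i} \<in> edges H" if "i \<in> ?I" for i using matched that by blast
    show "{u, w} \<in> edges H" if "i \<in> ?I" "{u, x i} \<in> edges H" "{w, y i} \<in> edges H" for i u w
      using transfer[OF that] .
    show "i \<le> k" if "i \<in> ?I" "k \<in> ?I" "{x i, y k} \<in> edges H" for i k using ordered that by blast
  qed (fact simple verts inj disj)+
  then interpret ordered_matching H d\<^sub>0 x y .
  show ?thesis
    by unfold_locales (use trans in \<open>auto simp: transversal_def\<close>)
qed

lemma simple_blowup:
  assumes "simple_graph H"
  shows "simple_graph (blowup H d\<^sub>0 x y n)"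
proof -
  have *: "u \<noteq> v" if "{u, v} \<in> edges H" for u v
  proof
    assume "u = v"
    then have "{u} \<in> edges H" using that by simp
    then obtain a b where "a \<noteq> b" "{u} = {a, b}" using assms unfolding simple_graph_def by metis
    then show False by (simp add: doubleton_eq_iff)
  qed
  have "\<exists>p\<in>verts (blowup H d\<^sub>0 x y n). \<exists>q\<in>verts (blowup H d\<^sub>0 x y n). p \<noteq> q \<and> e = {p, q}"
    if e: "e \<in> edges (blowup H d\<^sub>0 x y n)" for e
  proof -
    have eq: "edges (blowup H d\<^sub>0 x y n) = {{(u, k), (v, l)} | u k v l. (u, k) \<in> verts (blowup H d\<^sub>0 x y n) \<and>
        (v, l) \<in> verts (blowup H d\<^sub>0 x y n) \<and> {u, v} \<in> edges H}"
      by (simp add: blowup_def Let_def)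
    obtain u k v l where "e = {(u, k), (v, l)}" "(u, k) \<in> verts (blowup H d\<^sub>0 x y n)"
        "(v, l) \<in> verts (blowup H d\<^sub>0 x y n)" "{u, v} \<in> edges H"
      using e unfolding eq by blast
    then show ?thesis using * by blast
  qed
  moreover have "finite (verts (blowup H d\<^sub>0 x y n))" by (simp add: blowup_def Let_def)
  ultimately show ?thesis unfolding simple_graph_def by blast
qed

context well_covered_matching
begin

text \<open>Outside \<open>T\<close> the set \<open>A\<close> agrees with the complement of a
  transversal cover; the pairs in \<open>T\<close> lie in the link and hence outside
  \<open>A\<close>.\<close>

lemma cross_link_pairs:
  assumes cross: "cross_link A T" and i: "i \<in> {1..d\<^sub>0}"
  shows "card ({x i, y i} \<inter> A) = (if i \<in> T then 0 else 1)"
proof -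
  have T: "T \<subseteq> {1..d\<^sub>0}" and L: "link_verts A = x ` T \<union> y ` T" using cross unfolding cross_link_def by blast+
  define C where "C = verts H - (A \<union> x ` T)"
  have C: "C \<in> min_covers H" "verts H - C - x ` T = A"
    using exchange_of_cross_link[OF cross] by (simp_all add: C_def)
  show ?thesis
  proof (cases "i \<in> T")
    case True
    then have "x i \<in> link_verts A" "y i \<in> link_verts A" unfolding L by auto
    then have "{x i, y i} \<inter> A = {}" by (auto simp: link_verts_def)
    then show ?thesis using True by simp
  next
    case False
    have "x i \<in> A \<longleftrightarrow> x i \<notin> C" "y i \<in> A \<longleftrightarrow> y i \<notin> C"
      using image_mem_iff[OF i T] False i C(2) by (metis Diff_iff x_verts, metis Diff_iff y_verts)
    moreover have "x i \<in> C \<longleftrightarrow> y i \<notin> C" using transversal_min_cover[OF C(1)] i by (simp add: transversal_def)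
    ultimately have "{x i, y i} \<inter> A = {x i} \<or> {x i, y i} \<inter> A = {y i}" using x_neq_y[OF i i] by auto
    then show ?thesis using False by (metis card_1_singleton_iff One_nat_def)
  qed
qed

lemma card_cross_link_le: "cross_link A T \<Longrightarrow> card T \<le> d\<^sub>0"
  using card_mono[of "{1..d\<^sub>0}" T] by (simp add: cross_link_def)

end

section \<open>The Hilbert series\<close>

locale well_covered_blowup = well_covered_matching H d\<^sub>0 x y
  for H :: "'v ugraph" and d\<^sub>0 :: nat and x y :: "nat \<Rightarrow> 'v" +
  fixes n :: "nat \<Rightarrow> nat"
  assumes n_pos: "i \<in> {1..d\<^sub>0} \<Longrightarrow> n i > 0"
begin

sublocale edge_ring "blowup H d\<^sub>0 x y n"
  by unfold_locales (rule simple_blowup[OF simple])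

text \<open>Algebra and combinatorics meet here: the order behind the Cech signs is taken for
  \<open>h\<close>.\<close>

sublocale blown_up_matching H d\<^sub>0 x y n pos
  by unfold_locales (use n_pos inj_pos in auto)

lemma cech_block_eq:
  "cech_block a = block {v. lookup a v < 0} {v. lookup a v > 0}"
proof -
  let ?N = "{v. lookup a v < 0}" and ?P = "{v. lookup a v > 0}"
  have "keys a = ?N \<union> ?P" by (auto simp: in_keys_iff)
  then have "F \<union> keys a = F \<union> ?P" if "?N \<subseteq> F" for F using that by auto
  then show ?thesis unfolding cech_block_def block_def by auto
qed

text \<open>The number \<open>j\<close> is the cohomological degree of the class that
  \<open>sphere_like_block\<close> attaches to \<open>A\<close>.\<close>

definition critical :: "nat \<Rightarrow> 'v set \<Rightarrow> bool" where
  "critical j A \<longleftrightarrow> (\<exists>T. cross_link A T \<and> card (preimage A) + card T = j)"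

definition critical_exponents :: "nat \<Rightarrow> int \<Rightarrow> ('v \<times> nat \<Rightarrow>\<^sub>0 int) set" where
  "critical_exponents j \<delta> = (\<Union>A\<in>Collect (critical j). neg_exponents (preimage A) \<delta>)"

lemma critical_exponents_iff:
  "a \<in> critical_exponents j \<delta> \<longleftrightarrow> total a = \<delta> \<and> (\<forall>v. lookup a v \<le> 0) \<and>
     (\<exists>A. critical j A \<and> keys a = preimage A)"
  by (auto simp: critical_exponents_def neg_exponents_def total_def)

lemma critical_block:
  assumes "critical j A" "keys a = preimage A" "\<forall>v. lookup a v \<le> 0"
  shows "\<exists>z :: ('v \<times> nat) set \<Rightarrow> 'k::field. sphere_like pos (cech_block a) j z"
proof -
  have "lookup a v < 0 \<longleftrightarrow> lookup a v \<noteq> 0" "\<not> lookup a v > 0" for v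
    using assms(3)[rule_format, of v] by linarith+
  then have "{v. lookup a v < 0} = preimage A" "{v. lookup a v > 0} = {}"
    using assms(2) by (auto simp: in_keys_iff)
  then have "cech_block a = block (preimage A) {}" by (simp only: cech_block_eq)
  then show ?thesis using assms(1) sphere_like_block unfolding critical_def by auto
qed

text \<open>A block that fails to be acyclic belongs to some cross link; not being critical for
  \<open>j\<close>, it has its class in a different degree.\<close>

lemma noncritical_block:
  assumes "a \<notin> critical_exponents j \<delta>" "total a = \<delta>"
  shows "acyclic_family TYPE('k::field) pos (cech_block a) \<or>
      (\<exists>m z. m \<noteq> j \<and> sphere_like pos (cech_block a) m (z :: ('v \<times> nat) set \<Rightarrow> 'k))"
proof (cases "\<exists>A T. {v. lookup a v > 0} = {} \<and> {v. lookup a v < 0} = preimage A \<and> cross_link A T")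
  case False
  have "acyclic_family TYPE('k) pos (cech_block a)"
    unfolding cech_block_eq by (rule acyclic_block[OF _ False]) auto
  then show ?thesis by blast
next
  case True
  then obtain A T where A: "{v. lookup a v > 0} = {}" "{v. lookup a v < 0} = preimage A" "cross_link A T"
    by blast
  have neg: "\<forall>v. lookup a v \<le> 0" using A(1) by (auto simp: not_less)
  have "lookup a v \<noteq> 0 \<longleftrightarrow> lookup a v < 0" for v
    using neg[rule_format, of v] by linarith
  then have "keys a = {v. lookup a v < 0}" by (auto simp: in_keys_iff)
  then have keys: "keys a = preimage A" using A(2) by simp
  define m where "m = card (preimage A) + card T"
  have crit: "critical m A" using A(3) by (auto simp: critical_def m_def)
  then have "m \<noteq> j" using assms neg keys by (auto simp: critical_exponents_iff)
  then show ?thesis using critical_block[OF crit keys neg] by blast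
qed

lemma critical_subset: "critical j A \<Longrightarrow> A \<subseteq> verts H"
  unfolding critical_def cross_link_def independent_iff by blast

lemma finite_critical: "finite (Collect (critical j))"
proof (rule finite_subset)
  show "Collect (critical j) \<subseteq> Pow (verts H)" using critical_subset by blast
  show "finite (Pow (verts H))" using finite_verts by simp
qed

lemma finite_preimage: "finite (preimage A)"
  using finite_verts_G by (simp add: preimage_def)

lemma preimage_inj:
  assumes "A \<subseteq> verts H" "A' \<subseteq> verts H" "preimage A = preimage A'"
  shows "A = A'"
proof -
  have "A = fst ` preimage A" if "A \<subseteq> verts H" for A
  proof
    show "A \<subseteq> fst ` preimage A"
    proof
      fix u assume u: "u \<in> A"
      then have "(u, 1) \<in> preimage A" using that first_copy by (auto simp: preimage_def)
      then show "u \<in> fst ` preimage A" by force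
    qed
  qed (auto simp: preimage_def)
  then show ?thesis using assms by metis
qed

lemma card_critical_exponents:
  "finite (critical_exponents j \<delta>)"
  "of_nat (card (critical_exponents j \<delta>)) =
    (\<Sum>A\<in>Collect (critical j). fls_nth ((fls_X / (1 - fls_X) :: rat fls) ^ card (preimage A)) (- \<delta>))"
proof -
  show "finite (critical_exponents j \<delta>)"
    unfolding critical_exponents_def
    using finite_critical card_neg_exponents(1)[OF finite_preimage] by blast
  have "card (critical_exponents j \<delta>) = (\<Sum>A\<in>Collect (critical j). card (neg_exponents (preimage A) \<delta>))"
    unfolding critical_exponents_def
  proof (rule card_UN_disjoint[OF finite_critical])
    show "\<forall>A\<in>Collect (critical j). finite (neg_exponents (preimage A) \<delta>)"
      using card_neg_exponents(1)[OF finite_preimage] by blast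
    show "\<forall>A\<in>Collect (critical j). \<forall>A'\<in>Collect (critical j). A \<noteq> A' \<longrightarrow>
        neg_exponents (preimage A) \<delta> \<inter> neg_exponents (preimage A') \<delta> = {}"
    proof (intro ballI impI equals0I, elim IntE)
      fix A A' a assume A: "A \<in> Collect (critical j)" "A' \<in> Collect (critical j)" "A \<noteq> A'"
        and a: "a \<in> neg_exponents (preimage A) \<delta>" "a \<in> neg_exponents (preimage A') \<delta>"
      have "A \<subseteq> verts H" "A' \<subseteq> verts H" using A critical_subset by auto
      moreover have "preimage A = preimage A'" using a by (auto simp: neg_exponents_def)
      ultimately show False using preimage_inj A(3) by blast
    qed
  qed
  then show "of_nat (card (critical_exponents j \<delta>)) =
    (\<Sum>A\<in>Collect (critical j). fls_nth ((fls_X / (1 - fls_X) :: rat fls) ^ card (preimage A)) (- \<delta>))"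
    by (simp add: card_neg_exponents(2)[OF finite_preimage])
qed

lemma card_verts_blowup: "card (verts G) = 2 * (\<Sum>i=1..d\<^sub>0. n i)"
proof -
  have "card (verts G) = (\<Sum>i\<in>{1..d\<^sub>0}. card ({x i, y i} \<times> {1..n i}))"
    unfolding verts_G
  proof (rule card_UN_disjoint)
    show "\<forall>i\<in>{1..d\<^sub>0}. \<forall>k\<in>{1..d\<^sub>0}. i \<noteq> k \<longrightarrow> {x i, y i} \<times> {1..n i} \<inter> {x k, y k} \<times> {1..n k} = {}"
    proof (intro ballI impI)
      fix i k assume ik: "i \<in> {1..d\<^sub>0}" "k \<in> {1..d\<^sub>0}" "i \<noteq> k"
      then have "{x i, y i} \<inter> {x k, y k} = {}"
        using x_eq_iff[of i k] y_eq_iff[of i k] x_neq_y[of i k] x_neq_y[of k i] by auto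
      then show "{x i, y i} \<times> {1..n i} \<inter> {x k, y k} \<times> {1..n k} = {}" by blast
    qed
  qed auto
  also have "\<dots> = (\<Sum>i\<in>{1..d\<^sub>0}. 2 * n i)"
    by (rule sum.cong) (use x_neq_y in \<open>auto simp: card_cartesian_product\<close>)
  finally show ?thesis by (simp add: sum_distrib_left)
qed

lemma card_preimage:
  assumes cross: "cross_link A T"
  shows "card (preimage A) + (\<Sum>i\<in>T. n i) = (\<Sum>i=1..d\<^sub>0. n i)"
proof -
  have T: "T \<subseteq> {1..d\<^sub>0}" using cross unfolding cross_link_def by blast
  have eq: "preimage A = (\<Union>i\<in>{1..d\<^sub>0}. ({x i, y i} \<inter> A) \<times> {1..n i})"
    unfolding preimage_def verts_G by auto
  have "card (preimage A) = (\<Sum>i\<in>{1..d\<^sub>0}. card (({x i, y i} \<inter> A) \<times> {1..n i}))"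
    unfolding eq
  proof (rule card_UN_disjoint)
    show "\<forall>i\<in>{1..d\<^sub>0}. \<forall>k\<in>{1..d\<^sub>0}. i \<noteq> k \<longrightarrow> ({x i, y i} \<inter> A) \<times> {1..n i} \<inter> ({x k, y k} \<inter> A) \<times> {1..n k} = {}"
    proof (intro ballI impI)
      fix i k assume ik: "i \<in> {1..d\<^sub>0}" "k \<in> {1..d\<^sub>0}" "i \<noteq> k"
      then have "{x i, y i} \<inter> {x k, y k} = {}"
        using x_eq_iff[of i k] y_eq_iff[of i k] x_neq_y[of i k] x_neq_y[of k i] by auto
      then show "({x i, y i} \<inter> A) \<times> {1..n i} \<inter> ({x k, y k} \<inter> A) \<times> {1..n k} = {}" by blast
    qed
  qed auto
  also have "\<dots> = (\<Sum>i\<in>{1..d\<^sub>0}. if i \<in> T then 0 else n i)"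
    by (rule sum.cong) (use cross_link_pairs[OF cross] in \<open>auto simp: card_cartesian_product\<close>)
  finally have "card (preimage A) = (\<Sum>i\<in>{1..d\<^sub>0}. if i \<in> T then 0 else n i)" .
  then have "card (preimage A) + (\<Sum>i\<in>T. n i) = (\<Sum>i\<in>{1..d\<^sub>0}. if i \<in> T then 0 else n i) + (\<Sum>i\<in>{1..d\<^sub>0}. if i \<in> T then n i else 0)"
    using T by (simp add: sum.If_cases Int_absorb1)
  also have "\<dots> = (\<Sum>i=1..d\<^sub>0. n i)"
    unfolding sum.distrib[symmetric] by (rule sum.cong) auto
  finally show ?thesis .
qed

lemma weight_image:
  assumes "T \<subseteq> {1..d\<^sub>0}"
  shows "weight d\<^sub>0 x y n (x ` T) = (\<Sum>i\<in>T. n i)"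
proof -
  have "{s. s \<in> {1..d\<^sub>0} \<and> (x s \<in> x ` T \<or> y s \<in> x ` T)} = T"
    using image_mem_iff[OF _ assms] assms by blast
  then show ?thesis by (simp add: weight_def)
qed

text \<open>Reindexing by \<open>A = verts H - C - D\<close>. As \<open>G\<close> has
  \<open>2 * d\<close> vertices, the condition on \<open>D\<close> says that
  \<open>card (preimage A) + card D = j\<close>. Hence \<open>j - i\<close> is the natural number
  \<open>card (preimage A)\<close>, and the integer power is an ordinary one.\<close>

lemma hilbert_sum:
  defines "d \<equiv> (\<Sum>i=1..d\<^sub>0. n i)"
  shows "(\<Sum>i=0..d\<^sub>0. \<Sum>C\<in>min_covers H.
       of_nat (card {D. D \<subseteq> exchange_set H d\<^sub>0 x y C \<and>
          int d + int (weight d\<^sub>0 x y n D) = int (card (verts G)) - int j + int i \<and> card D = i})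
       * (\<tau> :: rat fls) powi (int j - int i)) = (\<Sum>A\<in>Collect (critical j). \<tau> ^ card (preimage A))"
proof -
  let ?cond = "\<lambda>D. int d + int (weight d\<^sub>0 x y n D) = int (card (verts G)) - int j + int (card D)"
  let ?X = "\<lambda>C. exchange_set H d\<^sub>0 x y C"
  define S where "S = (SIGMA C:min_covers H. {D. D \<subseteq> ?X C \<and> ?cond D})"
  have finM: "finite (min_covers H)"
    by (rule finite_subset[of _ "Pow (verts H)"]) (auto simp: min_covers_iff finite_verts)
  have finX: "finite (?X C)" for C by (simp add: exchange_set_def)
  have DT: "\<exists>T. D = x ` T \<and> cross_link (verts H - C - D) T" if CD: "C \<in> min_covers H" "D \<subseteq> ?X C" for C D
  proof -
    obtain T where T: "D = x ` T" "T \<subseteq> {1..d\<^sub>0}" "\<And>s. s \<in> T \<Longrightarrow> y s \<in> C \<and> x s \<in> verts H - C"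
        "\<And>s. s \<in> T \<Longrightarrow> C - {y s} \<union> {x s} \<in> min_covers H" using exchange_set_alt[OF CD] by metis
    then show ?thesis using cross_link_of_exchange[OF CD(1) T(2-4)] by blast
  qed
  have cardT: "card (x ` T) = card T" if "cross_link A T" for A T
  proof -
    have "T \<subseteq> {1..d\<^sub>0}" using that unfolding cross_link_def by blast
    then show ?thesis by (rule card_image[OF inj_on_subset[OF inj_x]])
  qed
  have cond_iff: "?cond (x ` T) \<longleftrightarrow> card (preimage A) + card T = j" if c: "cross_link A T" for A T
  proof -
    have "T \<subseteq> {1..d\<^sub>0}" using c unfolding cross_link_def by blast
    then obtain s where "weight d\<^sub>0 x y n (x ` T) = s" "card (preimage A) + s = d"
      using card_preimage[OF c] weight_image unfolding d_def by blast
    moreover have "card (verts G) = 2 * d" by (simp add: card_verts_blowup d_def)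
    ultimately show ?thesis using cardT[OF c] by auto
  qed
  have "(\<Sum>i=0..d\<^sub>0. \<Sum>C\<in>min_covers H.
       of_nat (card {D. D \<subseteq> ?X C \<and> int d + int (weight d\<^sub>0 x y n D) = int (card (verts G)) - int j + int i \<and> card D = i})
       * \<tau> powi (int j - int i)) =
     (\<Sum>i=0..d\<^sub>0. \<Sum>C\<in>min_covers H. \<Sum>D | D \<in> {D. D \<subseteq> ?X C \<and> ?cond D} \<and> card D = i. \<tau> powi (int j - int (card D)))"
  proof (intro sum.cong refl)
    fix i C
    have "{D. D \<subseteq> ?X C \<and> int d + int (weight d\<^sub>0 x y n D) = int (card (verts G)) - int j + int i \<and> card D = i}
      = {D \<in> {D. D \<subseteq> ?X C \<and> ?cond D}. card D = i}" by auto
    then show "of_nat (card {D. D \<subseteq> ?X C \<and> int d + int (weight d\<^sub>0 x y n D) = int (card (verts G)) - int j + int i \<and> card D = i})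
       * \<tau> powi (int j - int i) = (\<Sum>D | D \<in> {D. D \<subseteq> ?X C \<and> ?cond D} \<and> card D = i. \<tau> powi (int j - int (card D)))"
      by simp
  qed
  also have "\<dots> = (\<Sum>C\<in>min_covers H. \<Sum>i=0..d\<^sub>0. \<Sum>D | D \<in> {D. D \<subseteq> ?X C \<and> ?cond D} \<and> card D = i. \<tau> powi (int j - int (card D)))"
    by (rule sum.swap)
  \<comment> \<open>The range up to \<open>d\<^sub>0\<close> loses nothing, because \<open>D\<close>
    corresponds to a set of indices of pairs.\<close>
  also have "\<dots> = (\<Sum>C\<in>min_covers H. \<Sum>D\<in>{D. D \<subseteq> ?X C \<and> ?cond D}. \<tau> powi (int j - int (card D)))"
  proof (intro sum.cong refl sum.group)
    fix C assume C: "C \<in> min_covers H"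
    show "finite {D. D \<subseteq> ?X C \<and> ?cond D}" by (rule finite_subset[of _ "Pow (?X C)"]) (auto simp: finX)
    show "card ` {D. D \<subseteq> ?X C \<and> ?cond D} \<subseteq> {0..d\<^sub>0}"
    proof (clarsimp)
      fix D assume "D \<subseteq> ?X C"
      then show "card D \<le> d\<^sub>0" using DT[OF C] cardT card_cross_link_le by metis
    qed
  qed simp
  also have "\<dots> = (\<Sum>(C, D)\<in>S. \<tau> powi (int j - int (card D)))"
    unfolding S_def by (rule sum.Sigma) (auto simp: finM intro: finite_subset[of _ "Pow (?X _)"] finX)
  also have "\<dots> = (\<Sum>A\<in>Collect (critical j). \<tau> ^ card (preimage A))"
  proof -
    let ?h = "\<lambda>(C, D). verts H - C - D"
    let ?Sig = "SIGMA C:min_covers H. Pow (?X C)"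
    have crit: "?cond D \<longleftrightarrow> critical j (verts H - C - D)" and pow: "?cond D \<Longrightarrow> \<tau> powi (int j - int (card D)) = \<tau> ^ card (preimage (verts H - C - D))"
      if CD: "C \<in> min_covers H" "D \<subseteq> ?X C" for C D
    proof -
      obtain T where T: "D = x ` T" "cross_link (verts H - C - D) T" using DT[OF CD] by blast
      show "?cond D \<longleftrightarrow> critical j (verts H - C - D)"
        using cond_iff[OF T(2)] cross_link_unique T unfolding critical_def by metis
      assume "?cond D"
      then have "card (preimage (verts H - C - D)) + card T = j" using cond_iff[OF T(2)] T(1) by simp
      then have "int j - int (card D) = int (card (preimage (verts H - C - D)))" using cardT[OF T(2)] T(1) by simp
      then show "\<tau> powi (int j - int (card D)) = \<tau> ^ card (preimage (verts H - C - D))" by simp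
    qed
    have SS: "S \<subseteq> ?Sig" by (auto simp: S_def)
    have "bij_betw ?h S (Collect (critical j))"
    proof (rule bij_betw_subset[OF bij_exchange_cross_link SS])
      show "?h ` S = Collect (critical j)"
      proof (intro equalityI subsetI)
        fix A assume "A \<in> ?h ` S"
        then show "A \<in> Collect (critical j)" using crit by (auto simp: S_def)
      next
        fix A assume A: "A \<in> Collect (critical j)"
        then have "A \<in> ?h ` ?Sig" using bij_exchange_cross_link by (auto simp: critical_def bij_betw_def)
        then obtain C D where CD: "C \<in> min_covers H" "D \<subseteq> ?X C" "A = verts H - C - D" by auto
        then have "(C, D) \<in> S" using crit[OF CD(1,2)] A by (simp add: S_def)
        then show "A \<in> ?h ` S" using CD(3) by force
      qed
    qed
    then have "(\<Sum>p\<in>S. \<tau> ^ card (preimage (?h p))) = (\<Sum>A\<in>Collect (critical j). \<tau> ^ card (preimage A))"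
      by (rule sum.reindex_bij_betw)
    moreover have "(\<Sum>(C, D)\<in>S. \<tau> powi (int j - int (card D))) = (\<Sum>p\<in>S. \<tau> ^ card (preimage (?h p)))"
      by (rule sum.cong) (use pow in \<open>auto simp: S_def\<close>)
    ultimately show ?thesis by simp
  qed
  finally show ?thesis .
qed

text \<open>Each critical exponent of total degree \<delta> contributes one dimension. For fixed
  \<open>A\<close> these are the exponents with support \<open>preimage A\<close> and negative
  entries there, whence a power of the geometric series.\<close>

theorem hilbert_series:
  assumes j: "j > 0"
  shows "has_hilbert_series
    (edge_local_cohomology G j :: int \<Rightarrow>
       ('k::field, (('v \<times> nat) set \<Rightarrow> (('v \<times> nat, 'k) mpoly set \<times> nat) set) set) module)
    (\<Sum>A\<in>Collect (critical j). (fls_X / (1 - fls_X)) ^ card (preimage A))"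
  unfolding has_hilbert_series_def
proof
  fix \<delta>
  define \<zeta> where "\<zeta> = (\<lambda>a. SOME z :: ('v \<times> nat) set \<Rightarrow> 'k. sphere_like pos (cech_block a) j z)"
  have J: "total a = \<delta> \<and> sphere_like pos (cech_block a) j (\<zeta> a)" if "a \<in> critical_exponents j \<delta>" for a
  proof -
    obtain A where "total a = \<delta>" "critical j A" "keys a = preimage A" "\<forall>v. lookup a v \<le> 0"
      using \<open>a \<in> critical_exponents j \<delta>\<close> by (auto simp: critical_exponents_iff)
    then show ?thesis unfolding \<zeta>_def using someI_ex[OF critical_block] by blast
  qed
  note dim = local_cohomology_dim[OF j card_critical_exponents(1) J noncritical_block]
  let ?W = "edge_local_cohomology G j \<delta> :: ('k, (('v \<times> nat) set \<Rightarrow> (('v \<times> nat, 'k) mpoly set \<times> nat) set) set) module"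
  have "vectorspace class_ring ?W" "vectorspace.fin_dim class_ring ?W"
    "vectorspace.dim class_ring ?W = card (critical_exponents j \<delta>)"
    unfolding edge_local_cohomology_def by (rule dim; assumption)+
  then show "vectorspace class_ring ?W \<and> vectorspace.fin_dim class_ring ?W \<and>
    of_nat (vectorspace.dim class_ring ?W) =
      fls_nth (\<Sum>A\<in>Collect (critical j). (fls_X / (1 - fls_X) :: rat fls) ^ card (preimage A)) (- \<delta>)"
    by (simp add: card_critical_exponents(2) fls_nth_sum)
qed

end

text \<open>The condition on \<open>D\<close> contains a summand \<open>int i\<close> that the
  formula in words lacks: the class of \<open>(C, D)\<close> has degree d - N_D +
  \<open>card D\<close>, and only with this summand does the exponent \<open>j - i\<close> equal the
  number d - N_D of negative entries. For a single edge \<open>H\<close> with \<open>n 1 = 2\<close>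
  the graph \<open>G\<close> is a four-cycle, whose independence complex has two components; the
  nonempty \<open>D\<close> accounts for them by a one-dimensional space in degree zero for
  \<open>j = 1\<close>.\<close>

theorem corollary5p14:
  fixes H :: "'v ugraph" and x y :: "nat \<Rightarrow> 'v" and n :: "nat \<Rightarrow> nat"
    and d\<^sub>0 d j :: nat and G :: "('v \<times> nat) ugraph"
  assumes "simple_graph H"
    and "very_well_covered H"
    and "cohen_macaulay_graph TYPE('k :: field) H"
    and "card (verts H) = 2 * d\<^sub>0"
    and "verts H = x ` {1..d\<^sub>0} \<union> y ` {1..d\<^sub>0}"
    and "x ` {1..d\<^sub>0} \<in> min_covers H"
    and "maximal_independent_set H (y ` {1..d\<^sub>0})"
    and "\<forall>i\<in>{1..d\<^sub>0}. {x i, y i} \<in> edges H"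
    and "\<forall>i\<in>{1..d\<^sub>0}. \<forall>k\<in>{1..d\<^sub>0}. {x i, y k} \<in> edges H \<longrightarrow> i \<le> k"
    and "\<forall>i\<in>{1..d\<^sub>0}. n i > 0"
    and "d = (\<Sum>i=1..d\<^sub>0. n i)"
    and "G = blowup H d\<^sub>0 x y n"
    and "j > 0"
  shows "has_hilbert_series
    (edge_local_cohomology G j :: int \<Rightarrow>
       ('k, (('v \<times> nat) set \<Rightarrow> (('v \<times> nat, 'k) mpoly set \<times> nat) set) set) module)
    (\<Sum>i=0..d\<^sub>0. \<Sum>C\<in>min_covers H.
       of_nat (card {D. D \<subseteq> exchange_set H d\<^sub>0 x y C \<and>
          int d + int (weight d\<^sub>0 x y n D) = int (card (verts G)) - int j + int i \<and> card D = i})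
       * (fls_X / (1 - fls_X)) powi (int j - int i))"
proof -
  have "independent_set H (y ` {1..d\<^sub>0})" using assms(7) by (simp add: maximal_independent_set_def)
  then interpret well_covered_matching H d\<^sub>0 x y
    using well_covered_matchingI assms(1,2,4,5,8,9) by blast
  interpret well_covered_blowup H d\<^sub>0 x y n
    by unfold_locales (use assms(10) in blast)
  show ?thesis
    unfolding assms(11,12) hilbert_sum by (rule hilbert_series[OF assms(13)])
qed

end
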